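(* Let $R$ be a commutative $\mathbb S$-cotorsion-free ring of cardinality less than $2^{\aleph_0}$. Let $\kappa$ be an uncountable cardinal with $\kappa^{<\kappa}=\kappa$. Then there is a Borel reduction from the embeddability quasi-order $\sqsubseteq^\kappa_{\mathsf{GRAPHS}}$ on the $\kappa$-space of graphs of size $\kappa$ to the embeddability quasi-order $\sqsubseteq^\kappa_{R\text{-}\mathsf{MOD}}$ on the $\kappa$-space of $R$-modules of size $\kappa$; i.e., a $\kappa^+$-Borel map $f\colon X^\kappa_{\mathsf{GRAPHS}}\to X^\kappa_{R\text{-}\mathsf{MOD}}$ with $T\sqsubseteq^\kappa_{\mathsf{GRAPHS}}V\iff f(T)\sqsubseteq^\kappa_{R\text{-}\mathsf{MOD}}f(V)$ for all $T,V$.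
   Context: $R$ is a commutative ring with $1$, and $\mathbb S$ is a countable subset of $R\setminus\{0\}$ containing $1$ and closed under multiplication. An $R$-module $M$ is $\mathbb S$-reduced if $\bigcap_{s\in\mathbb S}sM=0$ and $\mathbb S$-torsion-free if $sm=0$ with $s\in\mathbb S$ implies $m=0$; $R$ is an $\mathbb S$-ring if it is $\mathbb S$-reduced and $\mathbb S$-torsion-free as a module over itself. The $\mathbb S$-completion of $M$ is $\widehat M=\varprojlim_{s\in\mathbb S}M/sM$ (inverse system indexed by divisibility $q\preceq s$ iff $s=qt$ for some $t\in\mathbb S$, with the natural projections). $M$ is $\mathbb S$-cotorsion-free if it is $\mathbb S$-reduced and $\mathrm{Hom}_R(\widehat R,M)=0$; the ring $R$ is $\mathbb S$-cotorsion-free if it is so as an $R$-module. Generalized descriptive set theory: ${}^\kappa\kappa$ carries the bounded topology generated by $N_s=\{x:s\subseteq x\}$, $s\in{}^{<\kappa}\kappa$; $\kappa^+$-Borel sets form the smallest $\kappa^+$-algebra containing the open sets, and a map is $\kappa^+$-Borel if preimages of open sets are $\kappa^+$-Borel. For a language $L$ of size $<\kappa$, $X^\kappa_L$ is the space of $L$-structures with universe $\kappa$, identified with a product of spaces ${}^{({}^{n}\kappa)}2$ with the bounded topologies; for an $L_{\kappa^+\kappa}$-sentence $\phi$, $X^\kappa_\phi$ is the subspace of models of $\phi$. $X^\kappa_{\mathsf{GRAPHS}}$ is the space of (undirected irreflexive) graphs on $\kappa$. Since $|R|<2^{\aleph_0}\le\kappa$, $R$-modules are described in the language with $+$ and a unary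 function symbol for each $r\in R$ (left scalar multiplication) by an $L_{\kappa^+\kappa}$-sentence, and $X^\kappa_{R\text{-}\mathsf{MOD}}$ is the resulting space of $R$-modules with universe $\kappa$. For structures $\mathcal A,\mathcal B$ in such a space, $\mathcal A\sqsubseteq^\kappa\mathcal B$ means there is an injective $x\colon\kappa\to\kappa$ which is an isomorphism of $\mathcal A$ onto the substructure of $\mathcal B$ on $\mathrm{Im}(x)$. *)

theory Defs
  imports
    "HOL-Analysis.Function_Topology"
    "HOL-Algebra.Module"
    "HOL-Algebra.AbelCoset"
    "HOL-Library.Countable_Set"
begin

unbundle cardinal_syntax

section \<open>Completions and cotorsion-freeness\<close>

definition self_module :: "('a, 'b) ring_scheme \<Rightarrow> ('a, 'a) module" where
  "self_module R = \<lparr>carrier = carrier R, mult = mult R, one = one R, zero = zero R,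
     add = add R, smult = mult R\<rparr>"

definition module_hom ::
  "('a, 'b) ring_scheme \<Rightarrow> ('a, 'm, 'c) module_scheme \<Rightarrow> ('a, 'n, 'd) module_scheme \<Rightarrow> ('m \<Rightarrow> 'n) set"
  where
  "module_hom R M N = {h. h \<in> carrier M \<rightarrow> carrier N
     \<and> (\<forall>x\<in>carrier M. \<forall>y\<in>carrier M. h (x \<oplus>\<^bsub>M\<^esub> y) = h x \<oplus>\<^bsub>N\<^esub> h y)
     \<and> (\<forall>r\<in>carrier R. \<forall>x\<in>carrier M. h (r \<odot>\<^bsub>M\<^esub> x) = r \<odot>\<^bsub>N\<^esub> h x)}"

definition multiple :: "('a, 'm, 'c) module_scheme \<Rightarrow> 'a \<Rightarrow> 'm set" where
  "multiple M s = (\<lambda>x. s \<odot>\<^bsub>M\<^esub> x) ` carrier M"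

definition S_reduced :: "'a set \<Rightarrow> ('a, 'm, 'c) module_scheme \<Rightarrow> bool" where
  "S_reduced S M \<longleftrightarrow> (\<Inter>s\<in>S. multiple M s) = {\<zero>\<^bsub>M\<^esub>}"

text \<open>
  The inverse limit of the quotients \<open>M/sM\<close>, realised as the module of compatible families of
  cosets. For \<open>s = qt\<close> the natural projection \<open>M/sM \<rightarrow> M/qM\<close> maps a coset \<open>X = m + sM\<close> to
  \<open>m + qM\<close>, which is the set sum \<open>X + qM\<close> because \<open>sM \<subseteq> qM\<close>. Likewise \<open>r \<cdot> (m + sM) = rm + sM\<close>
  is the set sum of the pointwise multiple \<open>rX\<close> and \<open>sM\<close>. The fields \<open>mult\<close> and \<open>one\<close> of the
  module record play no role.
\<close>

definition S_completion ::
  "('a, 'b) ring_scheme \<Rightarrow> 'a set \<Rightarrow> ('a, 'm, 'c) module_scheme \<Rightarrow> ('a, 'a \<Rightarrow> 'm set) module"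
  where
  "S_completion R S M =
    \<lparr>carrier = {x \<in> (\<Pi>\<^sub>E s\<in>S. a_rcosets\<^bsub>M\<^esub> (multiple M s)).
        \<forall>q\<in>S. \<forall>s\<in>S. (\<exists>t\<in>S. s = q \<otimes>\<^bsub>R\<^esub> t) \<longrightarrow> x s <+>\<^bsub>M\<^esub> multiple M q = x q},
     mult = undefined,
     one = undefined,
     zero = (\<lambda>s\<in>S. multiple M s),
     add = (\<lambda>x y. \<lambda>s\<in>S. x s <+>\<^bsub>M\<^esub> y s),
     smult = (\<lambda>r x. \<lambda>s\<in>S. ((\<lambda>m. r \<odot>\<^bsub>M\<^esub> m) ` x s) <+>\<^bsub>M\<^esub> multiple M s)\<rparr>"

definition S_cotorsion_free ::
  "('a, 'b) ring_scheme \<Rightarrow> 'a set \<Rightarrow> ('a, 'm, 'c) module_scheme \<Rightarrow> bool" where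
  "S_cotorsion_free R S M \<longleftrightarrow> S_reduced S M \<and>
     (\<forall>h\<in>module_hom R (S_completion R S (self_module R)) M.
        \<forall>x\<in>carrier (S_completion R S (self_module R)). h x = \<zero>\<^bsub>M\<^esub>)"

section \<open>The cardinal \<open>\<kappa>\<close>\<close>

text \<open>
  A cardinal is a cardinal order \<open>\<kappa>\<close>; the elements of \<open>Field \<kappa>\<close> stand for the ordinals below it,
  and \<open>underS \<kappa> a\<close> is the set of predecessors of the ordinal \<open>a\<close>. The set of sequences of length
  less than \<open>\<kappa>\<close> is a disjoint union, since \<open>Func\<close> encodes partial functions by an arbitrary default
  value and therefore does not determine their domain.
\<close>

definition sequences_below :: "'k rel \<Rightarrow> ('k \<times> ('k \<Rightarrow> 'k)) set" where
  "sequences_below \<kappa> = (SIGMA a : Field \<kappa>. Func (underS \<kappa> a) (Field \<kappa>))"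

section \<open>Structures with universe \<open>\<kappa>\<close>\<close>

record ('p, 'f) language =
  rel_syms :: "'p set"
  fun_syms :: "'f set"
  rel_arity :: "'p \<Rightarrow> nat"
  fun_arity :: "'f \<Rightarrow> nat"

record ('p, 'f, 'k) struct =
  rel_interp :: "'p \<Rightarrow> 'k list \<Rightarrow> bool"
  fun_interp :: "'f \<Rightarrow> 'k list \<Rightarrow> 'k"

definition tuples :: "'k rel \<Rightarrow> nat \<Rightarrow> 'k list set" where
  "tuples \<kappa> n = {xs. set xs \<subseteq> Field \<kappa> \<and> length xs = n}"

definition structures :: "'k rel \<Rightarrow> ('p, 'f) language \<Rightarrow> ('p, 'f, 'k) struct set" where
  "structures \<kappa> L = {A.
     rel_interp A \<in> (\<Pi>\<^sub>E p\<in>rel_syms L. tuples \<kappa> (rel_arity L p) \<rightarrow>\<^sub>E UNIV) \<and>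
     fun_interp A \<in> (\<Pi>\<^sub>E f\<in>fun_syms L. tuples \<kappa> (fun_arity L f) \<rightarrow>\<^sub>E Field \<kappa>)}"

text \<open>
  The space of functions from \<open>I\<close> to \<open>2\<close>, with basic open sets given by the partial functions of
  size less than \<open>\<kappa>\<close>. For regular \<open>\<kappa>\<close> (in particular if \<open>\<kappa>\<close> to the power \<open><\<kappa>\<close> is \<open>\<kappa>\<close>) and \<open>I\<close> of
  size \<open>\<kappa>\<close>, the subsets of \<open>I\<close> of size less than \<open>\<kappa>\<close> are those bounded with respect to any given
  bijection of \<open>I\<close> with \<open>\<kappa>\<close>, so this is the topology transported from the bounded topology of the
  space of functions from \<open>\<kappa>\<close> to \<open>2\<close>.
\<close>

definition bounded_topology :: "'k rel \<Rightarrow> 'i set \<Rightarrow> ('i \<Rightarrow> bool) topology" where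
  "bounded_topology \<kappa> I = topology_generated_by
     {{x \<in> I \<rightarrow>\<^sub>E UNIV. \<forall>i\<in>D. x i = s i} | D s. D \<subseteq> I \<and> |D| <o \<kappa>}"

text \<open>
  A structure is identified with the family of the characteristic functions of its relations and
  of the graphs of its functions, so an \<open>n\<close>-ary function symbol contributes a factor of arity
  \<open>n + 1\<close>.
\<close>

definition symbols :: "('p, 'f) language \<Rightarrow> ('p + 'f) set" where
  "symbols L = rel_syms L <+> fun_syms L"

definition graph_arity :: "('p, 'f) language \<Rightarrow> 'p + 'f \<Rightarrow> nat" where
  "graph_arity L = case_sum (rel_arity L) (\<lambda>f. Suc (fun_arity L f))"

definition code ::
  "'k rel \<Rightarrow> ('p, 'f) language \<Rightarrow> ('p, 'f, 'k) struct \<Rightarrow> 'p + 'f \<Rightarrow> 'k list \<Rightarrow> bool" where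
  "code \<kappa> L A = (\<lambda>i\<in>symbols L. \<lambda>xs\<in>tuples \<kappa> (graph_arity L i).
     case i of Inl p \<Rightarrow> rel_interp A p xs
             | Inr f \<Rightarrow> fun_interp A f (butlast xs) = last xs)"

definition structure_space :: "'k rel \<Rightarrow> ('p, 'f) language \<Rightarrow> ('p, 'f, 'k) struct topology" where
  "structure_space \<kappa> L = pullback_topology (structures \<kappa> L) (code \<kappa> L)
     (product_topology (\<lambda>i. bounded_topology \<kappa> (tuples \<kappa> (graph_arity L i))) (symbols L))"

text \<open>
  \<open>x\<close> is an isomorphism of \<open>A\<close> onto the substructure of \<open>B\<close> on the image of \<open>x\<close>; that this image is
  closed under the functions of \<open>B\<close> is part of the last conjunct.
\<close>

definition embedding ::
  "'k rel \<Rightarrow> ('p, 'f) language \<Rightarrow> ('p, 'f, 'k) struct \<Rightarrow> ('p, 'f, 'k) struct \<Rightarrow> ('k \<Rightarrow> 'k) \<Rightarrow> bool"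
  where
  "embedding \<kappa> L A B x \<longleftrightarrow> x \<in> Field \<kappa> \<rightarrow> Field \<kappa> \<and> inj_on x (Field \<kappa>)
     \<and> (\<forall>p\<in>rel_syms L. \<forall>as\<in>tuples \<kappa> (rel_arity L p).
          rel_interp A p as \<longleftrightarrow> rel_interp B p (map x as))
     \<and> (\<forall>f\<in>fun_syms L. \<forall>as\<in>tuples \<kappa> (fun_arity L f).
          x (fun_interp A f as) = fun_interp B f (map x as))"

definition embeddable ::
  "'k rel \<Rightarrow> ('p, 'f) language \<Rightarrow> ('p, 'f, 'k) struct \<Rightarrow> ('p, 'f, 'k) struct \<Rightarrow> bool" where
  "embeddable \<kappa> L A B \<longleftrightarrow> (\<exists>x. embedding \<kappa> L A B x)"

section \<open>Borel reductions\<close>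

inductive_set kappa_borel :: "'k rel \<Rightarrow> 'x topology \<Rightarrow> 'x set set"
  for \<kappa> :: "'k rel" and X :: "'x topology" where
  "openin X U \<Longrightarrow> U \<in> kappa_borel \<kappa> X"
| "A \<in> kappa_borel \<kappa> X \<Longrightarrow> topspace X - A \<in> kappa_borel \<kappa> X"
| "(\<And>A. A \<in> F \<Longrightarrow> A \<in> kappa_borel \<kappa> X) \<Longrightarrow> |F| \<le>o \<kappa> \<Longrightarrow> \<Union>F \<in> kappa_borel \<kappa> X"

definition kappa_borel_map :: "'k rel \<Rightarrow> 'x topology \<Rightarrow> 'y topology \<Rightarrow> ('x \<Rightarrow> 'y) \<Rightarrow> bool" where
  "kappa_borel_map \<kappa> X Y f \<longleftrightarrow> f \<in> topspace X \<rightarrow> topspace Y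
     \<and> (\<forall>U. openin Y U \<longrightarrow> {x \<in> topspace X. f x \<in> U} \<in> kappa_borel \<kappa> X)"

definition borel_reduction ::
  "'k rel \<Rightarrow> 'x topology \<Rightarrow> ('x \<Rightarrow> 'x \<Rightarrow> bool) \<Rightarrow> 'y topology \<Rightarrow> ('y \<Rightarrow> 'y \<Rightarrow> bool) \<Rightarrow> ('x \<Rightarrow> 'y) \<Rightarrow> bool"
  where
  "borel_reduction \<kappa> X P Y Q f \<longleftrightarrow> kappa_borel_map \<kappa> X Y f
     \<and> (\<forall>x\<in>topspace X. \<forall>y\<in>topspace X. P x y \<longleftrightarrow> Q (f x) (f y))"

section \<open>Graphs and modules\<close>

definition graph_lang :: "(unit, unit) language" where
  "graph_lang = \<lparr>rel_syms = {()}, fun_syms = {}, rel_arity = (\<lambda>_. 2), fun_arity = (\<lambda>_. 0)\<rparr>"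

definition graph_models :: "'k rel \<Rightarrow> (unit, unit, 'k) struct set" where
  "graph_models \<kappa> = {A \<in> structures \<kappa> graph_lang.
     (\<forall>a\<in>Field \<kappa>. \<not> rel_interp A () [a, a]) \<and>
     (\<forall>a\<in>Field \<kappa>. \<forall>b\<in>Field \<kappa>. rel_interp A () [a, b] \<longrightarrow> rel_interp A () [b, a])}"

definition graph_space :: "'k rel \<Rightarrow> (unit, unit, 'k) struct topology" where
  "graph_space \<kappa> = subtopology (structure_space \<kappa> graph_lang) (graph_models \<kappa>)"

datatype 'a module_symbol = Plus | Scalar 'a

definition module_lang :: "('a, 'b) ring_scheme \<Rightarrow> (unit, 'a module_symbol) language" where
  "module_lang R = \<lparr>rel_syms = {}, fun_syms = insert Plus (Scalar ` carrier R),
     rel_arity = (\<lambda>_. 0), fun_arity = case_module_symbol 2 (\<lambda>_. 1)\<rparr>"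

text \<open>
  The zero element is not named by the language, so it is supplied separately; it is determined by
  the addition. The fields \<open>mult\<close> and \<open>one\<close> are irrelevant to the \<open>module\<close> axioms.
\<close>

definition struct_module ::
  "'k rel \<Rightarrow> 'k \<Rightarrow> (unit, 'a module_symbol, 'k) struct \<Rightarrow> ('a, 'k) module" where
  "struct_module \<kappa> z A = \<lparr>carrier = Field \<kappa>, mult = undefined, one = undefined, zero = z,
     add = (\<lambda>a b. fun_interp A Plus [a, b]),
     smult = (\<lambda>r a. fun_interp A (Scalar r) [a])\<rparr>"

definition module_models ::
  "'k rel \<Rightarrow> ('a, 'b) ring_scheme \<Rightarrow> (unit, 'a module_symbol, 'k) struct set" where
  "module_models \<kappa> R = {A \<in> structures \<kappa> (module_lang R). \<exists>z. module R (struct_module \<kappa> z A)}"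

definition module_space ::
  "'k rel \<Rightarrow> ('a, 'b) ring_scheme \<Rightarrow> (unit, 'a module_symbol, 'k) struct topology" where
  "module_space \<kappa> R = subtopology (structure_space \<kappa> (module_lang R)) (module_models \<kappa> R)"

end

theory Submission
  imports Defs "HOL-Algebra.Divisibility"
begin

text \<open>
  Enumerate \<open>S\<close> and let \<open>q n\<close> be a cofinal sequence of products of its elements. Since \<open>R\<close> has
  fewer than \<open>2\<close> to the \<open>\<aleph>\<^sub>0\<close> elements, a pigeonhole argument on the branches of the binary tree, with
  a Vandermonde determinant, gives an element \<open>\<pi>\<close> of the completion that is transcendental over \<open>R\<close>.

  Let \<open>X\<close> be the set of \<open>\<omega>\<close>-sequences in \<open>\<kappa>\<close> and \<open>F\<close> the free module on \<open>X\<close>. A graph \<open>T\<close> is coded by the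
  set of all vectors over the completion some \<open>S\<close>-multiple of which is a polynomial in \<open>\<pi>\<close> with
  coefficients \<open>a\<^sub>0, \<dots>, a\<^sub>7\<close> in \<open>F\<close> such that \<open>a\<^sub>2, a\<^sub>3, a\<^sub>4\<close> are the images of \<open>a\<^sub>1\<close> under three operators
  on sequences and \<open>a\<^sub>5\<close>, \<open>a\<^sub>6\<close> are supported on the sequences that begin with an edge and with two
  distinct non-adjacent vertices. By transcendence, a homomorphism between two such
  modules comes from an endomorphism of \<open>F\<close> that commutes with the operators and respects edges and
  non-edges. If it is injective, then following the supports of the images of the sequences yields
  an embedding of graphs.

  The universe of the module is identified with \<open>\<kappa>\<close> by a Cantor--Bernstein bijection, each value of
  which depends on countably many edges of \<open>T\<close>, so the coding is even continuous.
\<close>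


section \<open>Divisibility and polynomials in commutative rings\<close>

text \<open>A homomorphism is only linear over \<open>R\<close>, yet it has to respect coefficients
  of polynomials in \<pi>. Purity makes this work: vectors congruent modulo \<open>q n\<close> have
  congruent images, and \<pi> is congruent modulo \<open>q n\<close> to an element of the ring, so
  homomorphisms commute with powers of \<pi> as far as these act. The top degree 7 then singles out
  the constants: a vector and its multiple by \<pi>^7 can both have degree at most 7 only if the
  vector is constant. The other obstacle is that a basis element goes to a linear combination
  without a distinguished term. If the vertices themselves were the basis, nothing would relate the
  terms chosen for different vertices. With sequences, one can put two vertices \<open>x\<close>,
  \<open>y\<close> in front of a common sequence; the operators that delete one of them link a
  choice for the pair to the choices for \<open>x\<close> and for \<open>y\<close>. The third
  operator, passing to even positions, serves to bound the supports, without which the choices would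
  not be forced. Torsion-freeness, by which all multipliers from \<open>S\<close> are cancelled, is
  derived from cotorsion-freeness.\<close>

lemma (in abelian_group) minus_eq_zero_iff:
  assumes "x \<in> carrier G" "y \<in> carrier G"
  shows "x \<ominus> y = \<zero> \<longleftrightarrow> x = y"
  using assms by (metis a_inv_closed local.minus_minus minus_equality minus_eq r_neg a_comm)

lemma (in abelian_group) minus_self: "x \<in> carrier G \<Longrightarrow> x \<ominus> x = \<zero>"
  by (simp add: minus_eq_zero_iff)

context cring begin

lemma divides_add: "a \<in> carrier R \<Longrightarrow> b \<in> carrier R \<Longrightarrow> c \<in> carrier R \<Longrightarrow> a divides b \<Longrightarrow> a divides c \<Longrightarrow> a divides (b \<oplus> c)"
  unfolding factor_def by (metis add.m_closed r_distr)

lemma divides_a_inv: "a \<in> carrier R \<Longrightarrow> a divides b \<Longrightarrow> a divides (\<ominus> b)"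
  unfolding factor_def by (metis a_inv_closed r_minus)

lemma divides_diff: "a \<in> carrier R \<Longrightarrow> b \<in> carrier R \<Longrightarrow> c \<in> carrier R \<Longrightarrow> a divides b \<Longrightarrow> a divides c \<Longrightarrow> a divides (b \<ominus> c)"
  by (simp add: a_minus_def divides_add divides_a_inv)

lemma divides_zero: "a \<in> carrier R \<Longrightarrow> a divides \<zero>"
  unfolding factor_def by (metis r_null zero_closed)

lemma divides_mult_left: "a \<in> carrier R \<Longrightarrow> b \<in> carrier R \<Longrightarrow> c \<in> carrier R \<Longrightarrow> a divides b \<Longrightarrow> a divides (c \<otimes> b)"
  using divides_prod_l[of a b c] by simp

lemma divides_mult_right: "a \<in> carrier R \<Longrightarrow> b \<in> carrier R \<Longrightarrow> c \<in> carrier R \<Longrightarrow> a divides b \<Longrightarrow> a divides (b \<otimes> c)"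
  using divides_prod_r[of a b c] by simp

lemma divides_minus_commute:
  "a \<in> carrier R \<Longrightarrow> b \<in> carrier R \<Longrightarrow> c \<in> carrier R \<Longrightarrow> a divides (b \<ominus> c) \<Longrightarrow> a divides (c \<ominus> b)"
  using divides_a_inv[of a "b \<ominus> c"] by (simp add: minus_add minus_eq a_comm)

lemma divides_minus_trans:
  assumes "a \<in> carrier R" "b \<in> carrier R" "c \<in> carrier R" "d \<in> carrier R"
    and "a divides (b \<ominus> c)" "a divides (c \<ominus> d)"
  shows "a divides (b \<ominus> d)"
proof -
  have "b \<ominus> d = (b \<ominus> c) \<oplus> (c \<ominus> d)" using assms(1-4) by algebra
  then show ?thesis using assms by (simp add: divides_add)
qed

section \<open>Synthetic division and a Vandermonde argument\<close>

primrec horner :: "'a list \<Rightarrow> 'a \<Rightarrow> 'a" where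
  "horner [] x = \<zero>"
| "horner (c # cs) x = c \<oplus> x \<otimes> horner cs x"

text \<open>Synthetic division by the linear factor with root \<open>a\<close>; coefficients are
  listed from the constant term upwards.\<close>

primrec horner_quotient :: "'a \<Rightarrow> 'a list \<Rightarrow> 'a list" where
  "horner_quotient a [] = []"
| "horner_quotient a (c # cs) = (if cs = [] then [] else horner cs a # horner_quotient a cs)"

lemma horner_closed [simp]: "set cs \<subseteq> carrier R \<Longrightarrow> x \<in> carrier R \<Longrightarrow> horner cs x \<in> carrier R"
  by (induction cs) auto

lemma horner_quotient_closed [simp]:
  "set cs \<subseteq> carrier R \<Longrightarrow> a \<in> carrier R \<Longrightarrow> set (horner_quotient a cs) \<subseteq> carrier R"
  by (induction cs) auto

lemma length_horner_quotient [simp]: "length (horner_quotient a cs) = length cs - 1"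
  by (induction cs) auto

lemma last_horner_quotient:
  "set cs \<subseteq> carrier R \<Longrightarrow> a \<in> carrier R \<Longrightarrow> 2 \<le> length cs \<Longrightarrow> last (horner_quotient a cs) = last cs"
proof (induction cs)
  case (Cons c cs)
  show ?case
  proof (cases "2 \<le> length cs")
    case True
    then have "horner_quotient a cs \<noteq> []" "cs \<noteq> []"
      using length_horner_quotient[of a cs] by (fastforce simp del: length_horner_quotient)+
    then show ?thesis using Cons True by simp
  next
    case False
    then obtain d where "cs = [d]" using Cons.prems
      by (cases cs; cases "tl cs") auto
    then show ?thesis using Cons.prems by simp
  qed
qed simp

lemma horner_diff:
  assumes "set cs \<subseteq> carrier R" "x \<in> carrier R" "a \<in> carrier R"
  shows "horner cs x \<ominus> horner cs a = (x \<ominus> a) \<otimes> horner (horner_quotient a cs) x"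
  using assms(1)
proof (induction cs)
  case Nil
  then show ?case using assms by (simp add: minus_eq)
next
  case (Cons c cs)
  show ?case
  proof (cases "cs = []")
    case True
    then show ?thesis using Cons assms by (simp add: minus_eq_zero_iff)
  next
    case False
    have 1: "horner cs x \<ominus> horner cs a = (x \<ominus> a) \<otimes> horner (horner_quotient a cs) x"
      using Cons by simp
    define F G H where "F = horner cs x" and "G = horner cs a" and "H = horner (horner_quotient a cs) x"
    have c: "F \<in> carrier R" "G \<in> carrier R" "H \<in> carrier R" "c \<in> carrier R"
      using Cons.prems assms by (auto simp: F_def G_def H_def)
    have "(c \<oplus> x \<otimes> F) \<ominus> (c \<oplus> a \<otimes> G) = (x \<ominus> a) \<otimes> G \<oplus> x \<otimes> (F \<ominus> G)"
      using c assms by algebra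
    also have "\<dots> = (x \<ominus> a) \<otimes> (G \<oplus> x \<otimes> H)"
      unfolding 1[folded F_def G_def H_def] using c assms by algebra
    finally show ?thesis using False by (simp add: F_def G_def H_def)
  qed
qed

lemma horner_smult:
  assumes "set cs \<subseteq> carrier R" "x \<in> carrier R" "k \<in> carrier R"
  shows "horner (map ((\<otimes>) k) cs) x = k \<otimes> horner cs x"
  using assms(1)
proof (induction cs)
  case (Cons c cs)
  define F where "F = horner cs x"
  have c: "F \<in> carrier R" "c \<in> carrier R" using Cons.prems assms by (auto simp: F_def)
  have "k \<otimes> c \<oplus> x \<otimes> (k \<otimes> F) = k \<otimes> (c \<oplus> x \<otimes> F)" using c assms by algebra
  then show ?case using Cons by (simp add: F_def)
qed (use assms in simp)

lemma one_mod_mult: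
  assumes "s \<in> carrier R" "u \<in> carrier R" "v \<in> carrier R"
    and "s divides (u \<ominus> \<one>)" "s divides (v \<ominus> \<one>)"
  shows "s divides (u \<otimes> v \<ominus> \<one>)"
proof -
  have "u \<otimes> v \<ominus> \<one> = u \<otimes> (v \<ominus> \<one>) \<oplus> (u \<ominus> \<one>)" using assms(1-3) by algebra
  then show ?thesis using assms by (simp add: divides_add divides_mult_left)
qed

text \<open>Repeatedly splitting off a root: the point differences divide \<open>L\<close> up to factors
  congruent to \<open>1\<close> modulo \<open>s\<close>, and the leading coefficient survives every division.\<close>

lemma vandermonde_modulo:
  assumes "finite I" "card I = length cs" "cs \<noteq> []" "set cs \<subseteq> carrier R"
    and "x \<in> I \<rightarrow> carrier R" "g \<in> carrier R" "L \<in> carrier R" "s \<in> carrier R"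
    and "\<And>i j. i \<in> I \<Longrightarrow> j \<in> I \<Longrightarrow> i \<noteq> j \<Longrightarrow>
      \<exists>u\<in>carrier R. \<exists>t\<in>carrier R. s divides (u \<ominus> \<one>) \<and> L \<otimes> u = t \<otimes> (x i \<ominus> x j)"
    and "\<And>i. i \<in> I \<Longrightarrow> g divides horner cs (x i)"
  shows "\<exists>c\<in>carrier R. s divides (c \<ominus> \<one>) \<and> g divides (L [^] (length cs - 1) \<otimes> c \<otimes> last cs)"
  using assms
proof (induction "length cs" arbitrary: cs I)
  case 0
  then show ?case by simp
next
  case (Suc n)
  show ?case
  proof (cases "n = 0")
    case True
    then obtain c where cs: "cs = [c]" using Suc by (cases cs) auto
    then obtain i where "I = {i}" using Suc.prems(2) card_1_singletonE[of I] by auto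
    then have "g divides c" using Suc.prems(10)[of i] Suc.prems cs by simp
    then show ?thesis using cs Suc.prems
      by (intro bexI[of _ \<one>]) (auto simp: divides_zero minus_self)
  next
    case False
    then have len: "2 \<le> length cs" using Suc by simp
    obtain a where a: "a \<in> I" using Suc.prems(2,3) by (cases "I = {}") auto
    define hq where "hq = horner_quotient (x a) cs"
    have xa: "x a \<in> carrier R" using a Suc.prems(5) by auto
    have hqc: "set hq \<subseteq> carrier R" unfolding hq_def using xa Suc.prems by simp
    have one: "\<exists>u\<in>carrier R. s divides (u \<ominus> \<one>) \<and> g divides (L \<otimes> u \<otimes> horner hq (x i))"
      if i: "i \<in> I - {a}" for i
    proof -
      have xi: "x i \<in> carrier R" using i Suc.prems(5) by auto
      obtain u t where ut: "u \<in> carrier R" "t \<in> carrier R" "s divides (u \<ominus> \<one>)"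
        "L \<otimes> u = t \<otimes> (x i \<ominus> x a)" using Suc.prems(9)[of i a] i a by blast
      have "g divides (horner cs (x i) \<ominus> horner cs (x a))"
        using Suc.prems i a xi xa by (intro divides_diff) auto
      then have "g divides ((x i \<ominus> x a) \<otimes> horner hq (x i))"
        using horner_diff Suc.prems(4) xi xa hq_def by simp
      then have "g divides (t \<otimes> ((x i \<ominus> x a) \<otimes> horner hq (x i)))"
        using divides_mult_left ut xi xa hqc Suc.prems by simp
      then have "g divides (L \<otimes> u \<otimes> horner hq (x i))"
        using ut xi xa hqc by (simp add: m_assoc)
      then show ?thesis using ut by blast
    qed
    \<comment> \<open>The multipliers found for the single points are combined into one: their
      product is still 1 modulo \<open>s\<close>.\<close>
    have "\<exists>c\<in>carrier R. s divides (c \<ominus> \<one>) \<and> (\<forall>i\<in>J. g divides (L \<otimes> c \<otimes> horner hq (x i)))"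
      if "finite J" "J \<subseteq> I - {a}" for J
      using that
    proof (induction J rule: finite_induct)
      case empty
      show ?case using Suc.prems by (intro bexI[of _ \<one>]) (auto simp: divides_zero minus_self)
    next
      case (insert j J)
      then obtain c where c: "c \<in> carrier R" "s divides (c \<ominus> \<one>)"
        "\<And>i. i \<in> J \<Longrightarrow> g divides (L \<otimes> c \<otimes> horner hq (x i))" by auto
      obtain u where u: "u \<in> carrier R" "s divides (u \<ominus> \<one>)" "g divides (L \<otimes> u \<otimes> horner hq (x j))"
        using one[of j] insert by auto
      show ?case
      proof (rule bexI[of _ "u \<otimes> c"], intro conjI ballI)
        show "u \<otimes> c \<in> carrier R" using u c by simp
        show "s divides (u \<otimes> c \<ominus> \<one>)" using one_mod_mult u c Suc.prems by simp
        fix i assume i: "i \<in> insert j J"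
        have xi: "x i \<in> carrier R" using i insert Suc.prems(5) by auto
        have h: "horner hq (x i) \<in> carrier R" using hqc xi by simp
        have e1: "L \<otimes> (u \<otimes> c) \<otimes> horner hq (x i) = c \<otimes> (L \<otimes> u \<otimes> horner hq (x i))"
          and e2: "L \<otimes> (u \<otimes> c) \<otimes> horner hq (x i) = u \<otimes> (L \<otimes> c \<otimes> horner hq (x i))"
          using u c h Suc.prems(7) by algebra+
        show "g divides (L \<otimes> (u \<otimes> c) \<otimes> horner hq (x i))"
        proof (cases "i = j")
          case True
          then have "g divides (L \<otimes> u \<otimes> horner hq (x i))" using u by simp
          then show ?thesis unfolding e1
            using u(1) c(1) h Suc.prems(6,7) by (simp add: divides_mult_left)
        next
          case False
          then have "g divides (L \<otimes> c \<otimes> horner hq (x i))" using c i by simp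
          then show ?thesis unfolding e2
            using u(1) c(1) h Suc.prems(6,7) by (simp add: divides_mult_left)
        qed
      qed
    qed
    from this[of "I - {a}"] obtain c where c: "c \<in> carrier R" "s divides (c \<ominus> \<one>)"
      "\<And>i. i \<in> I - {a} \<Longrightarrow> g divides (L \<otimes> c \<otimes> horner hq (x i))" using Suc.prems(1) by auto
    \<comment> \<open>With \<open>L \<otimes> c\<close> absorbed into the coefficients, the values
      of the quotient at the remaining points are divisible by \<open>g\<close>, and the induction
      hypothesis applies to a polynomial with one coefficient less.\<close>
    define cs' where "cs' = map ((\<otimes>) (L \<otimes> c)) hq"
    have lenhq: "length hq = n" using Suc(2) hq_def by simp
    have ne: "hq \<noteq> []" using lenhq False by auto
    have "\<exists>d\<in>carrier R. s divides (d \<ominus> \<one>) \<and> g divides (L [^] (length cs' - 1) \<otimes> d \<otimes> last cs')"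
    proof (rule Suc.hyps(1)[of cs' "I - {a}"])
      show "n = length cs'" using lenhq cs'_def by simp
      show "card (I - {a}) = length cs'" using a Suc.prems(1,2) Suc(2) lenhq cs'_def by simp
      show "set cs' \<subseteq> carrier R" using hqc c Suc.prems(7) cs'_def by auto
      show "g divides horner cs' (x i)" if "i \<in> I - {a}" for i
        using c(3)[OF that] horner_smult[OF hqc, of "x i" "L \<otimes> c"] that funcset_mem[OF Suc.prems(5), of i] Suc.prems(7) c(1)
        by (simp add: cs'_def)
    qed (use Suc.prems ne cs'_def in auto)
    then obtain d where d: "d \<in> carrier R" "s divides (d \<ominus> \<one>)"
      "g divides (L [^] (length cs' - 1) \<otimes> d \<otimes> last cs')" by blast
    define P r where "P = L [^] (n - 1)" and "r = last cs"
    have r: "r \<in> carrier R" using Suc.prems(3,4) r_def last_in_set by blast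
    have P: "P \<in> carrier R" using Suc.prems(7) P_def by simp
    have PL: "L [^] (length cs - 1) = P \<otimes> L"
      using Suc(2) False Suc.prems(7) P_def by (metis Suc_pred diff_Suc_1 nat_pow_Suc not_gr_zero)
    have "last cs' = L \<otimes> c \<otimes> r"
      using ne last_horner_quotient[OF Suc.prems(4) xa len] by (simp add: cs'_def last_map hq_def r_def)
    moreover have "length cs' = n" using lenhq cs'_def by simp
    ultimately have "g divides (P \<otimes> d \<otimes> (L \<otimes> c \<otimes> r))" using d(3) P_def by simp
    moreover have "P \<otimes> d \<otimes> (L \<otimes> c \<otimes> r) = P \<otimes> L \<otimes> (c \<otimes> d) \<otimes> r"
      using P r c d Suc.prems(7) by algebra
    ultimately show ?thesis
      using PL c d one_mod_mult Suc.prems(8) r_def by (metis m_closed)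
  qed
qed

end

section \<open>Transcendental elements of the completion\<close>

locale S_ring = cring R for R :: "('a, 'b) ring_scheme" (structure) +
  fixes S :: "'a set"
  assumes S_countable: "countable S"
    and S_subset: "S \<subseteq> carrier R - {\<zero>}"
    and S_one: "\<one> \<in> S"
    and S_mult: "s \<in> S \<Longrightarrow> t \<in> S \<Longrightarrow> s \<otimes> t \<in> S"
    and torsion_free: "s \<in> S \<Longrightarrow> r \<in> carrier R \<Longrightarrow> s \<otimes> r = \<zero> \<Longrightarrow> r = \<zero>"
    and reduced: "r \<in> carrier R \<Longrightarrow> (\<And>s. s \<in> S \<Longrightarrow> s divides r) \<Longrightarrow> r = \<zero>"
begin

lemma S_closed [simp]: "s \<in> S \<Longrightarrow> s \<in> carrier R" using S_subset by auto

lemma S_pow: "s \<in> S \<Longrightarrow> s [^] (n :: nat) \<in> S"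
  by (induction n) (auto simp: S_one S_mult)

lemma S_cancel:
  assumes "s \<in> S" "a \<in> carrier R" "b \<in> carrier R" "s \<otimes> a = s \<otimes> b"
  shows "a = b"
proof -
  have "s \<otimes> (a \<ominus> b) = s \<otimes> a \<ominus> s \<otimes> b" using assms(1-3) by (simp add: minus_eq r_distr r_minus)
  also have "\<dots> = \<zero>" using assms by (simp add: minus_eq_zero_iff)
  finally have "a \<ominus> b = \<zero>" using torsion_free assms by simp
  then show ?thesis using minus_eq_zero_iff assms(2,3) by blast
qed

lemma S_cancel_divides:
  assumes "s \<in> S" "a \<in> carrier R" "b \<in> carrier R" "(s \<otimes> a) divides (s \<otimes> b)"
  shows "a divides b"
proof -
  obtain c where c: "c \<in> carrier R" "s \<otimes> b = s \<otimes> a \<otimes> c" using assms unfolding factor_def by blast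
  then have "b = a \<otimes> c" using assms S_cancel[of s b "a \<otimes> c"] by (simp add: m_assoc)
  then show ?thesis using c unfolding factor_def by blast
qed

section \<open>A cofinal sequence in \<open>S\<close> and the branches of the binary tree\<close>

primrec sc :: "nat \<Rightarrow> 'a" where
  "sc 0 = from_nat_into S 0"
| "sc (Suc n) = sc n \<otimes> from_nat_into S (Suc n)"

text \<open>Taking products once more makes the successive quotients \<open>sc n\<close> of
  \<open>q\<close> cofinal as well. For an arbitrary cofinal sequence the cofactor in
  \<open>branch_diff\<close> need not be a unit modulo a prescribed element of
  \<open>S\<close>.\<close>

primrec q :: "nat \<Rightarrow> 'a" where
  "q 0 = \<one>"
| "q (Suc n) = q n \<otimes> sc n"

lemma sc_S: "sc n \<in> S"
proof -
  have "from_nat_into S m \<in> S" for m using S_one from_nat_into[of S m] by blast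
  then show ?thesis by (induction n) (simp_all add: S_mult)
qed

lemma q_S: "q n \<in> S" by (induction n) (auto simp: S_one S_mult sc_S)

lemma sc_closed [simp]: "sc n \<in> carrier R" using sc_S by simp
lemma q_closed [simp]: "q n \<in> carrier R" using q_S by simp

lemma sc_mono: "m \<le> n \<Longrightarrow> sc m divides sc n"
proof (induction n rule: dec_induct)
  case (step n)
  have "from_nat_into S (Suc n) \<in> carrier R" using from_nat_into[of S "Suc n"] S_one S_closed by blast
  with step show ?case by (auto intro!: divides_mult_right)
qed simp

lemma q_mono: "m \<le> n \<Longrightarrow> q m divides q n"
  by (induction n rule: dec_induct) (auto intro!: divides_mult_right)

lemma divides_sc: assumes "s \<in> S" shows "\<exists>n. s divides sc n"
proof -
  obtain n where n: "from_nat_into S n = s" using from_nat_into_surj[OF S_countable assms] by blast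
  then have "s divides sc n" using assms by (cases n) (auto intro!: divides_mult_left)
  then show ?thesis ..
qed

lemma divides_q: assumes "s \<in> S" shows "\<exists>n. s divides q n"
proof -
  obtain n where "s divides sc n" using divides_sc assms by blast
  then have "s divides q (Suc n)" using assms by (auto intro!: divides_mult_left)
  then show ?thesis ..
qed

text \<open>The series of the \<open>q k\<close> with \<open>\<eta> k\<close>, given by its partial
  sums: since \<open>q n\<close> divides all terms from \<open>q n\<close> on, the entry
  \<open>n\<close> is the value of the series modulo \<open>q n\<close>.\<close>

primrec branch :: "(nat \<Rightarrow> bool) \<Rightarrow> nat \<Rightarrow> 'a" where
  "branch \<eta> 0 = \<zero>"
| "branch \<eta> (Suc n) = branch \<eta> n \<oplus> (if \<eta> n then q n else \<zero>)"

lemma branch_closed [simp]: "branch \<eta> n \<in> carrier R" by (induction n) auto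

lemma branch_coherent: "m \<le> n \<Longrightarrow> q m divides (branch \<eta> n \<ominus> branch \<eta> m)"
proof (induction n rule: dec_induct)
  case base
  then show ?case by (simp add: minus_self divides_zero)
next
  case (step n)
  have "branch \<eta> (Suc n) \<ominus> branch \<eta> n = (if \<eta> n then q n else \<zero>)"
    by (simp add: minus_eq a_ac r_neg)
  then have "q m divides (branch \<eta> (Suc n) \<ominus> branch \<eta> n)" using q_mono[OF step(1)] by (simp add: divides_zero)
  then show ?case using step divides_minus_trans by (meson branch_closed q_closed)
qed

text \<open>Every later term is a multiple of \<open>q (Suc k)\<close>, which is
  \<open>q k \<otimes> sc k\<close>, so only the term \<open>q k\<close> counts modulo this
  product.\<close>

lemma branch_diff:
  assumes "\<eta> k" "\<not> \<eta>' k" "\<And>l. l < k \<Longrightarrow> \<eta> l = \<eta>' l" "k < n"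
  shows "\<exists>w\<in>carrier R. branch \<eta> n \<ominus> branch \<eta>' n = q k \<otimes> (\<one> \<oplus> sc k \<otimes> w)"
proof -
  have eq: "branch \<eta> l = branch \<eta>' l" if "l \<le> k" for l
    using that by (induction l) (auto simp: assms(3))
  have "Suc k \<le> n" using assms by simp
  then show ?thesis
  proof (induction n rule: dec_induct)
    case base
    have "branch \<eta> (Suc k) \<ominus> branch \<eta>' (Suc k) = q k"
      using assms eq[of k] by (simp add: minus_eq a_ac r_neg)
    then show ?case by (intro bexI[of _ \<zero>]) auto
  next
    case (step n)
    then obtain w where w: "w \<in> carrier R"
      "branch \<eta> n \<ominus> branch \<eta>' n = q k \<otimes> (\<one> \<oplus> sc k \<otimes> w)" by blast
    obtain v where v: "v \<in> carrier R" "q n = q k \<otimes> sc k \<otimes> v"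
      using q_mono[OF step(1)] unfolding factor_def by auto
    define d where "d = (if \<eta> n then v else \<zero>) \<ominus> (if \<eta>' n then v else \<zero>)"
    have "branch \<eta> (Suc n) \<ominus> branch \<eta>' (Suc n) = (branch \<eta> n \<ominus> branch \<eta>' n)
      \<oplus> ((if \<eta> n then q n else \<zero>) \<ominus> (if \<eta>' n then q n else \<zero>))"
    proof -
      define a b where "a = (if \<eta> n then q n else \<zero>)" and "b = (if \<eta>' n then q n else \<zero>)"
      have "a \<in> carrier R" "b \<in> carrier R" by (auto simp: a_def b_def)
      then have "(branch \<eta> n \<oplus> a) \<ominus> (branch \<eta>' n \<oplus> b) = (branch \<eta> n \<ominus> branch \<eta>' n) \<oplus> (a \<ominus> b)"
        using branch_closed[of \<eta> n] branch_closed[of \<eta>' n] by algebra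
      then show ?thesis by (simp add: a_def b_def)
    qed
    also have "(if \<eta> n then q n else \<zero>) = q k \<otimes> sc k \<otimes> (if \<eta> n then v else \<zero>)" using v by simp
    also have "(if \<eta>' n then q n else \<zero>) = q k \<otimes> sc k \<otimes> (if \<eta>' n then v else \<zero>)" using v by simp
    also have "q k \<otimes> sc k \<otimes> (if \<eta> n then v else \<zero>) \<ominus> q k \<otimes> sc k \<otimes> (if \<eta>' n then v else \<zero>) = q k \<otimes> sc k \<otimes> d"
      unfolding d_def using v by (auto simp: minus_eq r_distr r_minus)
    also have "(branch \<eta> n \<ominus> branch \<eta>' n) \<oplus> q k \<otimes> sc k \<otimes> d = q k \<otimes> (\<one> \<oplus> sc k \<otimes> w) \<oplus> q k \<otimes> sc k \<otimes> d"
      using w by simp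
    also have "q k \<otimes> (\<one> \<oplus> sc k \<otimes> w) \<oplus> q k \<otimes> sc k \<otimes> d = q k \<otimes> (\<one> \<oplus> sc k \<otimes> (w \<oplus> d))"
    proof -
      have "d \<in> carrier R" using v d_def by simp
      then show ?thesis using w(1) q_closed[of k] sc_closed[of k] by algebra
    qed
    finally show ?case using w v d_def
      by (intro bexI[of _ "w \<oplus> d"]) auto
  qed
qed

text \<open>Branches that agree below \<open>K\<close> split at some \<open>k\<close> with
  \<open>K \<le> k\<close> and \<open>k < m\<close>. The cofactor of \<open>branch_diff\<close> is
  then 1 modulo \<open>sc K\<close>, and \<open>q k\<close> divides \<open>q m\<close>. This
  supplies the hypothesis on point differences in \<open>vandermonde_modulo\<close>.\<close>

lemma branch_diff_unit:
  assumes "\<eta> \<noteq> \<eta>'" "\<And>l. l < K \<Longrightarrow> \<eta> l = \<eta>' l" "\<exists>k<m. \<eta> k \<noteq> \<eta>' k" "m \<le> n"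
  shows "\<exists>u\<in>carrier R. \<exists>t\<in>carrier R. sc K divides (u \<ominus> \<one>) \<and> q m \<otimes> u = t \<otimes> (branch \<eta> n \<ominus> branch \<eta>' n)"
proof -
  define k where "k = (LEAST k. \<eta> k \<noteq> \<eta>' k)"
  obtain k0 where "k0 < m" "\<eta> k0 \<noteq> \<eta>' k0" using assms by blast
  then have k: "\<eta> k \<noteq> \<eta>' k" "k < m" unfolding k_def
    using LeastI[of "\<lambda>k. \<eta> k \<noteq> \<eta>' k" k0] Least_le[of "\<lambda>k. \<eta> k \<noteq> \<eta>' k" k0] by auto
  have lt: "\<eta> l = \<eta>' l" if "l < k" for l using that not_less_Least k_def by blast
  have Kk: "K \<le> k" using k assms(2) by (meson leI)
  have "k < n" using k assms by simp
  obtain t0 where t0: "t0 \<in> carrier R" "q m = t0 \<otimes> q k"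
    using q_mono[of k m] k unfolding factor_def by (metis less_imp_le m_comm q_closed)
  obtain e w where e: "e \<in> carrier R" "w \<in> carrier R"
    "e \<otimes> (branch \<eta> n \<ominus> branch \<eta>' n) = q k \<otimes> (\<one> \<oplus> sc k \<otimes> w)"
  proof (cases "\<eta> k")
    case True
    then obtain w where "w \<in> carrier R" "branch \<eta> n \<ominus> branch \<eta>' n = q k \<otimes> (\<one> \<oplus> sc k \<otimes> w)"
      using branch_diff[of \<eta> k \<eta>' n] k lt \<open>k < n\<close> by blast
    then show ?thesis using that[of \<one> w] by simp
  next
    case False
    then obtain w where w: "w \<in> carrier R" "branch \<eta>' n \<ominus> branch \<eta> n = q k \<otimes> (\<one> \<oplus> sc k \<otimes> w)"
      using branch_diff[of \<eta>' k \<eta> n] k lt \<open>k < n\<close> by metis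
    have "\<ominus> \<one> \<otimes> (branch \<eta> n \<ominus> branch \<eta>' n) = branch \<eta>' n \<ominus> branch \<eta> n"
      using branch_closed[of \<eta> n] branch_closed[of \<eta>' n] by algebra
    then show ?thesis using that[of "\<ominus> \<one>" w] w by simp
  qed
  define u where "u = \<one> \<oplus> sc k \<otimes> w"
  have u: "u \<in> carrier R" using e u_def by simp
  have "u \<ominus> \<one> = sc k \<otimes> w" unfolding u_def using e sc_closed[of k] by algebra
  then have "sc K divides (u \<ominus> \<one>)" using sc_mono[OF Kk] e by (auto intro!: divides_mult_right)
  moreover have "q m \<otimes> u = (t0 \<otimes> e) \<otimes> (branch \<eta> n \<ominus> branch \<eta>' n)"
    using t0 e u u_def by (simp add: m_assoc)
  ultimately show ?thesis using u t0 e by blast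
qed

text \<open>An infinite set of branches has infinitely many members in a common cone, so that all their
  differences are units modulo a given \<open>sc K\<close>, up to factors from \<open>S\<close>.\<close>

lemma no_common_polynomial:
  assumes H: "infinite H" and cs: "set cs \<subseteq> carrier R" "cs \<noteq> []" "last cs \<noteq> \<zero>"
  shows "\<exists>\<eta>\<in>H. \<exists>n. \<not> q n divides horner cs (branch \<eta> n)"
proof (rule ccontr)
  assume "\<not> ?thesis"
  then have div: "q n divides horner cs (branch \<eta> n)" if "\<eta> \<in> H" for \<eta> n using that by blast
  define r where "r = last cs"
  have r: "r \<in> carrier R" "r \<noteq> \<zero>" using cs last_in_set[of cs] by (auto simp: r_def)
  obtain s where s: "s \<in> S" "\<not> s divides r" using reduced[OF r(1)] r(2) by (metis (full_types))
  obtain K where K: "s divides sc K" using divides_sc s by blast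
  have nK: "\<not> sc K divides r" using divides_trans[OF K] s S_closed by blast
  have "finite ((\<lambda>\<eta>. {l. l < K \<and> \<eta> l}) ` H)" by (rule finite_subset[of _ "Pow {..<K}"]) auto
  then obtain a where a: "infinite {\<eta> \<in> H. {l. l < K \<and> \<eta> l} = {l. l < K \<and> a l}}"
    using pigeonhole_infinite[OF H, of "\<lambda>\<eta>. {l. l < K \<and> \<eta> l}"] by auto
  obtain I where I: "finite I" "card I = length cs" "I \<subseteq> {\<eta> \<in> H. {l. l < K \<and> \<eta> l} = {l. l < K \<and> a l}}"
    using infinite_arbitrarily_large[OF a, of "length cs"] by auto
  have cone: "\<eta> l = \<eta>' l" if "\<eta> \<in> I" "\<eta>' \<in> I" "l < K" for \<eta> \<eta>' l
  proof -
    have "{l. l < K \<and> \<eta> l} = {l. l < K \<and> \<eta>' l}" using that I by auto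
    then show ?thesis using that by (auto simp: set_eq_iff)
  qed
  define d where "d = (\<lambda>\<eta> \<eta>' :: nat \<Rightarrow> bool. LEAST k. \<eta> k \<noteq> \<eta>' k)"
  have d: "\<eta> (d \<eta> \<eta>') \<noteq> \<eta>' (d \<eta> \<eta>')" if "\<eta> \<noteq> \<eta>'" for \<eta> \<eta>'
  proof -
    have "\<exists>k. \<eta> k \<noteq> \<eta>' k" using that by auto
    then show ?thesis unfolding d_def by (rule LeastI_ex)
  qed
  obtain m where m: "\<And>\<eta> \<eta>'. \<eta> \<in> I \<Longrightarrow> \<eta>' \<in> I \<Longrightarrow> d \<eta> \<eta>' < m"
  proof -
    have "finite ((\<lambda>(\<eta>, \<eta>'). d \<eta> \<eta>') ` (I \<times> I))" using I by simp
    then obtain m where "\<forall>k\<in>(\<lambda>(\<eta>, \<eta>'). d \<eta> \<eta>') ` (I \<times> I). k < m"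
      using finite_nat_set_iff_bounded by blast
    then show ?thesis using that[of m] by blast
  qed
  \<comment> \<open>\<open>Q\<close> is the power of \<open>L\<close> left over by
    \<open>vandermonde_modulo\<close>. The level \<open>n\<close> is taken so large that
    \<open>q n\<close> is divisible by \<open>Q\<close> and a further factor \<open>sc K\<close>,
    which survives the cancellation of \<open>Q\<close>.\<close>
  define Q where "Q = q m [^] (length cs - 1)"
  have Q: "Q \<in> S" "Q \<in> carrier R" using S_pow[OF q_S] Q_def by simp_all
  obtain n0 where n0: "(Q \<otimes> sc K) divides q n0" using divides_q[of "Q \<otimes> sc K"] S_mult Q sc_S by blast
  define n where "n = max n0 m"
  have n: "(Q \<otimes> sc K) divides q n" "m \<le> n"
    using divides_trans[OF n0 q_mono[of n0 n]] Q n_def by simp_all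
  have "\<exists>c\<in>carrier R. sc K divides (c \<ominus> \<one>) \<and> q n divides (q m [^] (length cs - 1) \<otimes> c \<otimes> last cs)"
  proof (rule vandermonde_modulo[OF I(1,2) cs(2,1), where x = "\<lambda>\<eta>. branch \<eta> n"])
    fix \<eta> \<eta>' assume e: "\<eta> \<in> I" "\<eta>' \<in> I" "\<eta> \<noteq> \<eta>'"
    show "\<exists>u\<in>carrier R. \<exists>t\<in>carrier R. sc K divides (u \<ominus> \<one>) \<and> q m \<otimes> u = t \<otimes> (branch \<eta> n \<ominus> branch \<eta>' n)"
    proof (rule branch_diff_unit[OF e(3) _ _ n(2)])
      show "\<exists>k<m. \<eta> k \<noteq> \<eta>' k" using m[OF e(1,2)] d[OF e(3)] by blast
    qed (rule cone[OF e(1,2)])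
  qed (use I div in auto)
  then obtain c where c: "c \<in> carrier R" "sc K divides (c \<ominus> \<one>)" "q n divides (Q \<otimes> c \<otimes> r)"
    by (auto simp: Q_def r_def)
  have "(Q \<otimes> sc K) divides (Q \<otimes> (c \<otimes> r))"
    using divides_trans[OF n(1) c(3)] c(1) Q r by (simp add: m_assoc)
  then have 1: "sc K divides (c \<otimes> r)" using S_cancel_divides[OF Q(1)] c(1) r(1) by simp
  \<comment> \<open>As \<open>c\<close> is 1 modulo \<open>sc K\<close>, divisibility of
    \<open>c \<otimes> r\<close> passes to \<open>r\<close>, against the choice of
    \<open>K\<close>.\<close>
  have "sc K divides ((c \<ominus> \<one>) \<otimes> r)" using c(1,2) r(1) by (simp add: divides_mult_right)
  then have "sc K divides (c \<otimes> r \<ominus> (c \<ominus> \<one>) \<otimes> r)" using 1 c(1) r(1) by (simp add: divides_diff)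
  moreover have "c \<otimes> r \<ominus> (c \<ominus> \<one>) \<otimes> r = r" using c(1) r(1) by algebra
  ultimately show False using nK by simp
qed

end

section \<open>Cardinalities of sequences, lists and finitely supported functions\<close>

lemma card_of_sequences_Pow_nat:
  fixes A :: "'a set" assumes "|A| \<le>o |Pow (UNIV :: nat set)|"
  shows "|{a :: nat \<Rightarrow> 'a. range a \<subseteq> A}| \<le>o |Pow (UNIV :: nat set)|" (is "|?F| \<le>o _")
proof -
  obtain f where f: "inj_on f A" "f ` A \<subseteq> Pow (UNIV :: nat set)"
    using assms by (subst (asm) card_of_ordLeq[symmetric]) blast
  \<comment> \<open>Pairing turns a sequence of sets of naturals into a single set, whose sections
    give the sequence back.\<close>
  define g where "g = (\<lambda>a :: nat \<Rightarrow> 'a. {prod_encode (n, m) | n m. m \<in> f (a n)})"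
  have "inj_on g ?F"
  proof (rule inj_onI)
    fix a b assume ab: "a \<in> ?F" "b \<in> ?F" "g a = g b"
    have "f (a n) = {m. prod_encode (n, m) \<in> g a}" for a n
      by (auto simp: g_def)
    then have "f (a n) = f (b n)" for n using ab(3) by simp
    then show "a = b" using inj_onD[OF f(1)] ab(1,2) by (intro ext) (simp add: image_subset_iff)
  qed
  then show ?thesis by (rule card_of_ordLeqI) simp
qed

lemma card_of_lists_ordLeq:
  assumes "infinite B" "|A| \<le>o |B|"
  shows "|lists A| \<le>o |B|"
proof -
  have 1: "|{xs \<in> lists A. length xs = n}| \<le>o |B|" for n
  proof (induction n)
    case 0
    have "{xs \<in> lists A. length xs = 0} = {[]}" by auto
    moreover have "B \<noteq> {}" using assms(1) by auto
    ultimately show ?case using card_of_singl_ordLeq by simp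
  next
    case (Suc n)
    have "{xs \<in> lists A. length xs = Suc n} \<subseteq> (\<lambda>(x, xs). x # xs) ` (A \<times> {xs \<in> lists A. length xs = n})"
      by (auto simp: length_Suc_conv image_iff)
    then have "|{xs \<in> lists A. length xs = Suc n}| \<le>o |A \<times> {xs \<in> lists A. length xs = n}|"
      by (meson card_of_image card_of_mono1 ordLeq_transitive)
    also have "|A \<times> {xs \<in> lists A. length xs = n}| \<le>o |B|"
      using Suc by (intro card_of_Sigma_ordLeq_infinite[OF assms]) simp
    finally show ?case .
  qed
  have "lists A = (\<Union>n. {xs \<in> lists A. length xs = n})" by auto
  moreover have "|\<Union>n. {xs \<in> lists A. length xs = n}| \<le>o |B|"
    using 1 assms(1) by (intro card_of_UNION_ordLeq_infinite) (simp_all add: infinite_iff_card_of_nat)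
  ultimately show ?thesis by simp
qed

text \<open>A finitely supported function is recovered from any list that enumerates its graph over
  the support, and such lists are no more numerous than the elements of \<open>B\<close>.\<close>

lemma card_of_finite_support:
  fixes A :: "'x set" and C :: "'y set" and z :: 'y
  assumes "infinite B" "|A| \<le>o |B|" "|C| \<le>o |B|"
  shows "|{f :: 'x \<Rightarrow> 'y. finite {x. f x \<noteq> z} \<and> {x. f x \<noteq> z} \<subseteq> A \<and> range f \<subseteq> C}| \<le>o |B|" (is "|?F| \<le>o _")
proof -
  have 1: "|A \<times> C| \<le>o |B|" using assms by (intro card_of_Sigma_ordLeq_infinite) simp_all
  define g :: "('x \<Rightarrow> 'y) \<Rightarrow> ('x \<times> 'y) list" where "g = (\<lambda>f. SOME xs. set xs = {(x, f x) | x. f x \<noteq> z})"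
  have g: "set (g f) = {(x, f x) | x. f x \<noteq> z}" if "f \<in> ?F" for f
  proof -
    have "\<exists>xs. set xs = {(x, f x) | x. f x \<noteq> z}" using that by (intro finite_list) simp
    then show ?thesis unfolding g_def by (rule someI_ex)
  qed
  have "inj_on g ?F"
  proof (rule inj_onI, rule ext)
    fix f h x assume fh: "f \<in> ?F" "h \<in> ?F" "g f = g h"
    have "(f x \<noteq> z \<longrightarrow> (x, f x) \<in> set (g f)) \<and> (h x \<noteq> z \<longrightarrow> (x, h x) \<in> set (g h))"
      using g[OF fh(1)] g[OF fh(2)] by auto
    moreover have "(x, y) \<in> set (g f) \<Longrightarrow> f x = y" "(x, y) \<in> set (g h) \<Longrightarrow> h x = y" for y
      using g[OF fh(1)] g[OF fh(2)] by auto
    ultimately show "f x = h x" using fh(3) by metis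
  qed
  moreover have "g ` ?F \<subseteq> lists (A \<times> C)" using g by fastforce
  ultimately have "|?F| \<le>o |lists (A \<times> C)|"
    by (intro card_of_ordLeq[THEN iffD1] exI[of _ g] conjI)
  then show ?thesis using card_of_lists_ordLeq[OF assms(1) 1] ordLeq_transitive by blast
qed

context S_ring begin

lemma exists_transcendental:
  assumes "|carrier R| <o |Pow (UNIV :: nat set)|"
  shows "\<exists>\<eta>. \<forall>cs. set cs \<subseteq> carrier R \<longrightarrow> cs \<noteq> [] \<longrightarrow> last cs \<noteq> \<zero>
    \<longrightarrow> (\<exists>n. \<not> q n divides horner cs (branch \<eta> n))"
proof (rule ccontr)
  assume "\<not> ?thesis"
  then obtain C where C: "\<And>\<eta>. set (C \<eta>) \<subseteq> carrier R" "\<And>\<eta>. C \<eta> \<noteq> []" "\<And>\<eta>. last (C \<eta>) \<noteq> \<zero>"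
    "\<And>\<eta> n. q n divides horner (C \<eta>) (branch \<eta> n)" by metis
  \<comment> \<open>The summand of naturals makes the bounding set visibly infinite, while it stays
    below the continuum.\<close>
  define B where "B = Sum_Type.Plus (carrier R) (UNIV :: nat set)"
  have B: "infinite B" "|carrier R| \<le>o |B|" "|UNIV :: nat set| \<le>o |B|" by (simp_all add: B_def card_of_Plus1 card_of_Plus2)
  have inf: "infinite (Pow (UNIV :: nat set))" by (metis Pow_UNIV Finite_Set.finite_set infinite_UNIV_nat)
  have "|B| <o |Pow (UNIV :: nat set)|" unfolding B_def
    using card_of_Plus_ordLess_infinite[OF inf assms card_of_Pow] .
  moreover have "|UNIV :: (nat \<Rightarrow> bool) set| =o |Pow (UNIV :: nat set)|"
  proof (rule card_of_ordIsoI)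
    show "bij_betw Collect (UNIV :: (nat \<Rightarrow> bool) set) (Pow UNIV)"
      by (rule bij_betwI[where g = "\<lambda>X x. x \<in> X"]) auto
  qed
  \<comment> \<open>Finite fibres of \<open>C\<close> would bound the continuum by the number of
    polynomials; hence some polynomial vanishes on infinitely many branches.\<close>
  moreover have "|UNIV :: (nat \<Rightarrow> bool) set| \<le>o |B|" if fin: "\<And>cs. finite {\<eta>. C \<eta> = cs}"
  proof -
    have "|\<Union>cs\<in>lists (carrier R). {\<eta>. C \<eta> = cs}| \<le>o |B|"
    proof (rule card_of_UNION_ordLeq_infinite[OF B(1) card_of_lists_ordLeq[OF B(1,2)]], rule ballI)
      fix cs
      have "|{\<eta>. C \<eta> = cs}| \<le>o |UNIV :: nat set|" using fin[of cs]
        by (meson card_of_Well_order card_of_ordLeq_infinite infinite_UNIV_nat ordLeq_total)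
      then show "|{\<eta>. C \<eta> = cs}| \<le>o |B|" using B(3) ordLeq_transitive by blast
    qed
    moreover have "(\<Union>cs\<in>lists (carrier R). {\<eta>. C \<eta> = cs}) = UNIV" using C(1) by auto
    ultimately show ?thesis by simp
  qed
  ultimately obtain cs where cs: "infinite {\<eta>. C \<eta> = cs}"
    by (meson not_ordLess_ordLeq ordIso_iff_ordLeq ordLess_ordLeq_trans ordLeq_transitive)
  then obtain \<eta>0 where "C \<eta>0 = cs" using infinite_imp_nonempty by blast
  then have "\<exists>\<eta>\<in>{\<eta>. C \<eta> = cs}. \<exists>n. \<not> q n divides horner cs (branch \<eta> n)"
    using no_common_polynomial[OF cs] C by metis
  then show False using C(4) by auto
qed

section \<open>The completion as a module of coherent sequences\<close>

definition coherent :: "(nat \<Rightarrow> 'a) \<Rightarrow> bool" where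
  "coherent u \<longleftrightarrow> range u \<subseteq> carrier R \<and> (\<forall>m n. m \<le> n \<longrightarrow> q m divides (u n \<ominus> u m))"

text \<open>The choice depends only on the coset of \<open>u n\<close>, so congruent sequences get
  the same representatives and equality in the completion is equality of functions.\<close>

definition cl :: "(nat \<Rightarrow> 'a) \<Rightarrow> nat \<Rightarrow> 'a" where
  "cl u n = (SOME r. r \<in> carrier R \<and> q n divides (r \<ominus> u n))"

text \<open>The completion of \<open>R\<close>, with each coset of \<open>q n R\<close> replaced by a chosen representative.\<close>

definition completion :: "('a, nat \<Rightarrow> 'a) module" where
  "completion = \<lparr>carrier = cl ` Collect coherent, monoid.mult = undefined, one = undefined,
     zero = cl (\<lambda>_. \<zero>), add = (\<lambda>a b. cl (\<lambda>n. a n \<oplus> b n)), smult = (\<lambda>r a. cl (\<lambda>n. r \<otimes> a n))\<rparr>"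

lemma coherent_closed [simp]: "coherent u \<Longrightarrow> u n \<in> carrier R"
  by (auto simp: coherent_def)

lemma coherent_divides: "coherent u \<Longrightarrow> m \<le> n \<Longrightarrow> q m divides (u n \<ominus> u m)"
  by (auto simp: coherent_def)

lemma coherent_const: "r \<in> carrier R \<Longrightarrow> coherent (\<lambda>_. r)"
  by (auto simp: coherent_def divides_zero minus_self)

lemma coherent_add: assumes "coherent u" "coherent v" shows "coherent (\<lambda>n. u n \<oplus> v n)"
  unfolding coherent_def
proof (intro conjI allI impI)
  fix m n :: nat assume "m \<le> n"
  have "(u n \<oplus> v n) \<ominus> (u m \<oplus> v m) = (u n \<ominus> u m) \<oplus> (v n \<ominus> v m)"
    using coherent_closed[OF assms(1)] coherent_closed[OF assms(2)] by algebra
  then show "q m divides (u n \<oplus> v n \<ominus> (u m \<oplus> v m))"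
    using assms coherent_divides \<open>m \<le> n\<close> by (simp add: divides_add)
qed (use assms in auto)

lemma coherent_mult: assumes "coherent u" "coherent v" shows "coherent (\<lambda>n. u n \<otimes> v n)"
  unfolding coherent_def
proof (intro conjI allI impI)
  fix m n :: nat assume "m \<le> n"
  have "(u n \<otimes> v n) \<ominus> (u m \<otimes> v m) = u n \<otimes> (v n \<ominus> v m) \<oplus> v m \<otimes> (u n \<ominus> u m)"
    using coherent_closed[OF assms(1), of n] coherent_closed[OF assms(1), of m]
      coherent_closed[OF assms(2), of n] coherent_closed[OF assms(2), of m] by algebra
  then show "q m divides (u n \<otimes> v n \<ominus> u m \<otimes> v m)"
    using assms coherent_divides \<open>m \<le> n\<close> by (simp add: divides_add divides_mult_left)
qed (use assms in auto)

lemma coherent_pow: "coherent u \<Longrightarrow> coherent (\<lambda>n. u n [^] (i :: nat))"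
  by (induction i) (auto simp: coherent_const coherent_mult)

lemma cl_rep:
  assumes "coherent u" shows "cl u n \<in> carrier R" "q n divides (cl u n \<ominus> u n)"
proof -
  have "\<exists>r. r \<in> carrier R \<and> q n divides (r \<ominus> u n)"
    using assms by (intro exI[of _ "u n"]) (simp add: divides_zero minus_self)
  from someI_ex[OF this] show "cl u n \<in> carrier R" "q n divides (cl u n \<ominus> u n)"
    unfolding cl_def by auto
qed

lemma cl_eq_iff:
  assumes "coherent u" "coherent v"
  shows "cl u = cl v \<longleftrightarrow> (\<forall>n. q n divides (u n \<ominus> v n))"
proof
  assume eq: "cl u = cl v"
  show "\<forall>n. q n divides (u n \<ominus> v n)"
  proof
    fix n
    show "q n divides (u n \<ominus> v n)"
      using cl_rep[OF assms(1), of n] cl_rep[OF assms(2), of n] assms eq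
        divides_minus_trans[of "q n" "u n" "cl u n" "v n"] divides_minus_commute[of "q n" "cl u n" "u n"]
      by simp
  qed
next
  assume div: "\<forall>n. q n divides (u n \<ominus> v n)"
  have "q n divides (r \<ominus> u n) \<longleftrightarrow> q n divides (r \<ominus> v n)" if "r \<in> carrier R" for r n
    using div[rule_format, of n] that assms divides_minus_trans[of "q n" r "u n" "v n"]
      divides_minus_trans[of "q n" r "v n" "u n"] divides_minus_commute[of "q n" "u n" "v n"]
    by auto
  then show "cl u = cl v" unfolding cl_def by (intro ext) (metis (lifting))
qed

lemma coherent_cl: assumes "coherent u" shows "coherent (cl u)"
  unfolding coherent_def
proof (intro conjI allI impI)
  fix m n :: nat assume mn: "m \<le> n"
  note c = cl_rep[OF assms]
  have "q m divides (cl u n \<ominus> u n)" using c[of n] q_mono[OF mn] divides_trans by (meson q_closed)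
  then have "q m divides (cl u n \<ominus> u m)"
    using divides_minus_trans[of "q m" "cl u n" "u n" "u m"] coherent_divides[OF assms mn] c assms by simp
  moreover have "q m divides (u m \<ominus> cl u m)"
    using divides_minus_commute[of "q m" "cl u m" "u m"] c[of m] assms by simp
  ultimately show "q m divides (cl u n \<ominus> cl u m)"
    using divides_minus_trans[of "q m" "cl u n" "u m" "cl u m"] c assms by simp
qed (use cl_rep[OF assms] in auto)

lemma cl_add:
  assumes "coherent u" "coherent v"
  shows "cl u \<oplus>\<^bsub>completion\<^esub> cl v = cl (\<lambda>n. u n \<oplus> v n)"
proof -
  have "q n divides ((cl u n \<oplus> cl v n) \<ominus> (u n \<oplus> v n))" for n
  proof -
    have "(cl u n \<oplus> cl v n) \<ominus> (u n \<oplus> v n) = (cl u n \<ominus> u n) \<oplus> (cl v n \<ominus> v n)"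
      using coherent_closed[OF assms(1)] coherent_closed[OF assms(2)] cl_rep(1)[OF assms(1)] cl_rep(1)[OF assms(2)]
      by algebra
    then show ?thesis using cl_rep assms by (simp add: divides_add)
  qed
  then have "cl (\<lambda>n. cl u n \<oplus> cl v n) = cl (\<lambda>n. u n \<oplus> v n)"
    using cl_eq_iff coherent_add coherent_cl assms by simp
  then show ?thesis by (simp add: completion_def)
qed

lemma cl_smult:
  assumes "coherent u" "r \<in> carrier R"
  shows "r \<odot>\<^bsub>completion\<^esub> cl u = cl (\<lambda>n. r \<otimes> u n)"
proof -
  have "q n divides (r \<otimes> cl u n \<ominus> r \<otimes> u n)" for n
  proof -
    have "r \<otimes> cl u n \<ominus> r \<otimes> u n = r \<otimes> (cl u n \<ominus> u n)"
      using coherent_closed[OF assms(1)] cl_rep(1)[OF assms(1)] assms(2) by algebra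
    then show ?thesis using cl_rep assms by (simp add: divides_mult_left)
  qed
  then have "cl (\<lambda>n. r \<otimes> cl u n) = cl (\<lambda>n. r \<otimes> u n)"
    using cl_eq_iff coherent_mult[OF coherent_const] coherent_cl assms by simp
  then show ?thesis by (simp add: completion_def)
qed

lemma coherent_smult: "coherent u \<Longrightarrow> r \<in> carrier R \<Longrightarrow> coherent (\<lambda>n. r \<otimes> u n)"
  using coherent_mult[OF coherent_const] by blast

lemma coherent_minus: "coherent u \<Longrightarrow> coherent (\<lambda>n. \<ominus> u n)"
  using coherent_smult[of u "\<ominus> \<one>"] by (simp add: l_minus coherent_closed)

lemma completion_carrierE:
  assumes "a \<in> carrier completion" obtains u where "coherent u" "a = cl u"
  using assms by (auto simp: completion_def)

lemma cl_carrier: "coherent u \<Longrightarrow> cl u \<in> carrier completion"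
  by (auto simp: completion_def)

lemma completion_zero: "\<zero>\<^bsub>completion\<^esub> = cl (\<lambda>_. \<zero>)" by (simp add: completion_def)

lemma module_completion: "module R completion"
proof (rule moduleI)
  note [simp] = cl_add cl_smult completion_zero coherent_add coherent_smult coherent_const cl_carrier
  show "cring R" by (rule is_cring)
  show "abelian_group completion"
  proof (rule abelian_groupI)
    fix x assume "x \<in> carrier completion"
    then obtain u where u: "coherent u" "x = cl u" by (rule completion_carrierE)
    show "\<exists>y\<in>carrier completion. y \<oplus>\<^bsub>completion\<^esub> x = \<zero>\<^bsub>completion\<^esub>"
      using u by (intro bexI[of _ "cl (\<lambda>n. \<ominus> u n)"]) (simp_all add: coherent_minus l_neg)
  qed (auto elim!: completion_carrierE simp: a_ac)
qed (auto elim!: completion_carrierE simp: cl_add cl_smult coherent_add coherent_smult cl_carrier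
      l_distr r_distr m_assoc)

lemma cl_eq_zero_iff:
  assumes "coherent u"
  shows "cl u = \<zero>\<^bsub>completion\<^esub> \<longleftrightarrow> (\<forall>n. q n divides u n)"
  using cl_eq_iff[OF assms coherent_const[of \<zero>]] assms by (simp add: completion_zero minus_eq)

text \<open>One passes to an entry \<open>m\<close> so late that \<open>s \<otimes> q n\<close>
  divides \<open>q m\<close>: there \<open>s\<close> can be cancelled in the ring, and coherence
  leads back to \<open>n\<close>.\<close>

lemma coherent_divides_mult_cancel:
  assumes "s \<in> S" "coherent u" "coherent v" "\<forall>n. q n divides (s \<otimes> u n \<ominus> s \<otimes> v n)"
  shows "q n divides (u n \<ominus> v n)"
proof -
  obtain m0 where m0: "(s \<otimes> q n) divides q m0" using divides_q S_mult assms q_S by blast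
  define m where "m = max m0 n"
  have "(s \<otimes> q n) divides q m"
    using m0 q_mono[of m0 m] divides_trans assms m_def by (meson max.cobounded1 m_closed S_closed q_closed)
  then have "(s \<otimes> q n) divides (s \<otimes> u m \<ominus> s \<otimes> v m)"
    using assms divides_trans by (meson S_closed m_closed q_closed)
  moreover have "s \<otimes> u m \<ominus> s \<otimes> v m = s \<otimes> (u m \<ominus> v m)"
    using coherent_closed[OF assms(2), of m] coherent_closed[OF assms(3), of m] S_closed[OF assms(1)] by algebra
  ultimately have "q n divides (u m \<ominus> v m)" using S_cancel_divides assms by simp
  moreover have "n \<le> m" by (simp add: m_def)
  then have "q n divides (u m \<ominus> u n)" "q n divides (v m \<ominus> v n)"
    using coherent_divides assms by blast+
  moreover have "u n \<ominus> v n = (u m \<ominus> v m) \<ominus> (u m \<ominus> u n) \<oplus> (v m \<ominus> v n)"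
    using coherent_closed[OF assms(2), of m] coherent_closed[OF assms(3), of m]
      coherent_closed[OF assms(2), of n] coherent_closed[OF assms(3), of n] by algebra
  ultimately show ?thesis using assms(2,3) by (simp add: divides_add divides_diff)
qed

lemma completion_torsion_free:
  assumes "s \<in> S" "a \<in> carrier completion" "b \<in> carrier completion"
    "s \<odot>\<^bsub>completion\<^esub> a = s \<odot>\<^bsub>completion\<^esub> b"
  shows "a = b"
proof -
  obtain u v where uv: "coherent u" "a = cl u" "coherent v" "b = cl v"
    using assms by (metis completion_carrierE)
  then have "\<forall>n. q n divides (s \<otimes> u n \<ominus> s \<otimes> v n)"
    using assms by (simp add: cl_smult cl_eq_iff coherent_smult)
  then show ?thesis using coherent_divides_mult_cancel assms(1) uv by (simp add: cl_eq_iff)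
qed

lemma completion_reduced:
  assumes "a \<in> carrier completion" "\<And>n. \<exists>c\<in>carrier completion. a = q n \<odot>\<^bsub>completion\<^esub> c"
  shows "a = \<zero>\<^bsub>completion\<^esub>"
proof -
  obtain u where u: "coherent u" "a = cl u" using assms by (metis completion_carrierE)
  have "q n divides u n" for n
  proof -
    obtain v where v: "coherent v" "a = q n \<odot>\<^bsub>completion\<^esub> cl v"
      using assms(2)[of n] by (metis completion_carrierE)
    then have "q n divides (u n \<ominus> q n \<otimes> v n)" using u by (simp add: cl_smult cl_eq_iff coherent_smult)
    moreover have "q n divides (q n \<otimes> v n)" using v by (simp add: divides_mult_right)
    ultimately have "q n divides ((u n \<ominus> q n \<otimes> v n) \<oplus> q n \<otimes> v n)"
      using u v by (intro divides_add) auto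
    moreover have "(u n \<ominus> q n \<otimes> v n) \<oplus> q n \<otimes> v n = u n"
      using coherent_closed[OF u(1), of n] coherent_closed[OF v(1), of n] q_closed[of n] by algebra
    ultimately show ?thesis by simp
  qed
  then show ?thesis using u cl_eq_zero_iff by simp
qed

text \<open>Division by \<open>q m\<close> loses precision, so the entry \<open>n\<close> of the
  quotient is read off from an entry \<open>k n\<close> of \<open>u\<close> for which
  \<open>q m \<otimes> q n\<close> divides \<open>q (k n)\<close>. This identifies the kernel of the
  projection modulo \<open>q m\<close>.\<close>

lemma completion_divisible:
  assumes "coherent u" "q m divides u m"
  shows "\<exists>c\<in>carrier completion. cl u = q m \<odot>\<^bsub>completion\<^esub> c"
proof -
  have "\<exists>k\<ge>m. (q m \<otimes> q n) divides q k" for n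
  proof -
    obtain k where "(q m \<otimes> q n) divides q k" using divides_q S_mult q_S by blast
    then have "(q m \<otimes> q n) divides q (max k m)"
      using q_mono[of k "max k m"] divides_trans by (meson max.cobounded1 m_closed q_closed)
    then show ?thesis by (intro exI[of _ "max k m"]) simp
  qed
  then obtain k where k: "\<And>n. m \<le> k n" "\<And>n. (q m \<otimes> q n) divides q (k n)" by metis
  have "q m divides u l" if "m \<le> l" for l
  proof -
    have "q m divides ((u l \<ominus> u m) \<oplus> u m)"
      using coherent_divides[OF assms(1) that] assms by (intro divides_add) auto
    moreover have "(u l \<ominus> u m) \<oplus> u m = u l"
      using coherent_closed[OF assms(1), of l] coherent_closed[OF assms(1), of m] by algebra
    ultimately show ?thesis by simp
  qed
  then have "\<exists>r\<in>carrier R. u (k n) = q m \<otimes> r" for n using k unfolding factor_def by blast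
  then obtain v where v: "\<And>n. v n \<in> carrier R" "\<And>n. u (k n) = q m \<otimes> v n" by metis
  have cong: "q n divides (v n' \<ominus> v n)" if "n \<le> n'" for n n'
  proof -
    have 1: "(q m \<otimes> q n) divides (u l \<ominus> u (k n))" if "k n \<le> l" for l
      using coherent_divides[OF assms(1) that] k(2)[of n] divides_trans by (meson m_closed q_closed)
    have "(q m \<otimes> q n) divides (q m \<otimes> q n')"
      using q_mono[OF that] by (auto simp: factor_def m_assoc)
    then have "(q m \<otimes> q n) divides q (k n')" using k(2)[of n'] divides_trans by (meson m_closed q_closed)
    then have 2: "(q m \<otimes> q n) divides (u l \<ominus> u (k n'))" if "k n' \<le> l" for l
      using coherent_divides[OF assms(1) that] divides_trans by (meson m_closed q_closed)
    have "(q m \<otimes> q n) divides (u (k n') \<ominus> u (k n))"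
      using 1[of "max (k n) (k n')"] divides_minus_commute[OF _ _ _ 2[of "max (k n) (k n')"]] assms(1)
      by (intro divides_minus_trans[of "q m \<otimes> q n" "u (k n')" "u (max (k n) (k n'))" "u (k n)"]) auto
    moreover have "u (k n') \<ominus> u (k n) = q m \<otimes> (v n' \<ominus> v n)"
      unfolding v(2) using v(1)[of n] v(1)[of n'] q_closed[of m] by algebra
    ultimately show ?thesis using S_cancel_divides[OF q_S, of "q n" "v n' \<ominus> v n" m] v(1) by simp
  qed
  have vc: "coherent v" using v cong by (auto simp: coherent_def)
  have "q n divides (u n \<ominus> q m \<otimes> v n)" for n
  proof -
    have "q n divides q (k n)"
      using k(2)[of n] divides_trans[of "q n" "q m \<otimes> q n" "q (k n)"] divides_mult_left[of "q n" "q n" "q m"] by simp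
    then have 1: "q n divides (u l \<ominus> u (k n))" if "k n \<le> l" for l
      using coherent_divides[OF assms(1) that] divides_trans by (meson m_closed q_closed)
    have "q n divides (u (max (k n) n) \<ominus> u n)" using coherent_divides[OF assms(1)] by simp
    then have "q n divides ((u (max (k n) n) \<ominus> u (k n)) \<ominus> (u (max (k n) n) \<ominus> u n))"
      using 1[of "max (k n) n"] assms(1) by (simp add: divides_diff)
    moreover have "(u (max (k n) n) \<ominus> u (k n)) \<ominus> (u (max (k n) n) \<ominus> u n) = u n \<ominus> u (k n)"
      using coherent_closed[OF assms(1), of n] coherent_closed[OF assms(1), of "k n"]
        coherent_closed[OF assms(1), of "max (k n) n"] by algebra
    ultimately have "q n divides (u n \<ominus> u (k n))" by simp
    then show ?thesis using v by simp
  qed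
  then have "cl u = q m \<odot>\<^bsub>completion\<^esub> cl v"
    using assms vc by (simp add: cl_smult cl_eq_iff coherent_smult)
  then show ?thesis using vc cl_carrier by blast
qed

lemma card_of_completion:
  assumes "|carrier R| <o |Pow (UNIV :: nat set)|"
  shows "|carrier completion| \<le>o |Pow (UNIV :: nat set)|"
proof -
  have "carrier completion \<subseteq> {a. range a \<subseteq> carrier R}"
    using coherent_cl by (auto simp: completion_def)
  then have "|carrier completion| \<le>o |{a :: nat \<Rightarrow> 'a. range a \<subseteq> carrier R}|" by (rule card_of_mono1)
  then show ?thesis
    using card_of_sequences_Pow_nat[OF ordLess_imp_ordLeq[OF assms]] ordLeq_transitive by blast
qed

end

section \<open>Powers of the transcendental element\<close>

locale transcendental_branch = S_ring +
  fixes \<eta> :: "nat \<Rightarrow> bool"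
  assumes transcendental: "set cs \<subseteq> carrier R \<Longrightarrow> cs \<noteq> [] \<Longrightarrow> last cs \<noteq> \<zero>
    \<Longrightarrow> \<exists>n. \<not> q n divides horner cs (branch \<eta> n)"
begin

abbreviation p :: "nat \<Rightarrow> 'a" where "p \<equiv> branch \<eta>"

abbreviation A :: "('a, nat \<Rightarrow> 'a) module" where "A \<equiv> completion"

sublocale A: module R completion by (rule module_completion)

text \<open>This is \<pi>^i. Multiplication by a power of \<pi> is expressed by the congruences
  \<open>e_shift\<close> instead of a product on the completion.\<close>

definition e :: "nat \<Rightarrow> nat \<Rightarrow> 'a" where "e i = cl (\<lambda>n. p n [^] i)"

lemma coherent_p: "coherent p"
  by (auto simp: coherent_def branch_coherent)

lemma e_closed [simp]: "e i \<in> carrier A"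
  unfolding e_def by (intro cl_carrier coherent_pow coherent_p)

text \<open>\<open>horner\<close> recurs on the constant term, whereas \<open>comb\<close> and the
  descent in \<open>e_independent\<close> split off the leading one.\<close>

lemma horner_append: "set cs \<subseteq> carrier R \<Longrightarrow> d \<in> carrier R \<Longrightarrow> x \<in> carrier R
    \<Longrightarrow> horner (cs @ [d]) x = d \<otimes> x [^] length cs \<oplus> horner cs x"
proof (induction cs)
  case (Cons c cs)
  define P F where "P = x [^] length cs" and "F = horner cs x"
  have "P \<in> carrier R" "F \<in> carrier R" "c \<in> carrier R" using Cons.prems by (simp_all add: P_def F_def)
  then have "c \<oplus> x \<otimes> (d \<otimes> P \<oplus> F) = d \<otimes> (P \<otimes> x) \<oplus> (c \<oplus> x \<otimes> F)"
    using Cons.prems(2,3) by algebra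
  then show ?case using Cons by (simp add: P_def F_def)
qed simp

primrec comb :: "nat \<Rightarrow> (nat \<Rightarrow> 'a) \<Rightarrow> (nat \<Rightarrow> nat \<Rightarrow> 'a) \<Rightarrow> nat \<Rightarrow> 'a" where
  "comb 0 c f = \<zero>\<^bsub>A\<^esub>"
| "comb (Suc k) c f = c k \<odot>\<^bsub>A\<^esub> f k \<oplus>\<^bsub>A\<^esub> comb k c f"

lemma comb_e:
  assumes "\<And>i. i < k \<Longrightarrow> c i \<in> carrier R"
  shows "coherent (\<lambda>n. horner (map c [0..<k]) (p n)) \<and> comb k c e = cl (\<lambda>n. horner (map c [0..<k]) (p n))"
  using assms
proof (induction k)
  case 0
  then show ?case by (simp add: coherent_const completion_zero)
next
  case (Suc k)
  have h: "horner (map c [0..<Suc k]) (p n) = c k \<otimes> p n [^] k \<oplus> horner (map c [0..<k]) (p n)" for n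
    using horner_append[of "map c [0..<k]" "c k" "p n"] Suc.prems by (simp add: image_subset_iff less_SucI)
  have k: "coherent (\<lambda>n. c k \<otimes> p n [^] k)"
    using coherent_smult coherent_pow coherent_p Suc.prems by simp
  have IH: "coherent (\<lambda>n. horner (map c [0..<k]) (p n))"
    "comb k c e = cl (\<lambda>n. horner (map c [0..<k]) (p n))"
    using Suc by auto
  have "c k \<odot>\<^bsub>A\<^esub> e k = cl (\<lambda>n. c k \<otimes> p n [^] k)"
    unfolding e_def by (rule cl_smult[OF coherent_pow[OF coherent_p]]) (simp add: Suc.prems)
  then show ?case using coherent_add[OF k IH(1)] cl_add[OF k IH(1)] h IH(2) by simp
qed

lemma e_independent:
  assumes "\<And>i. i < k \<Longrightarrow> c i \<in> carrier R" "comb k c e = \<zero>\<^bsub>A\<^esub>" "i < k"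
  shows "c i = \<zero>"
proof -
  have "\<forall>n. q n divides horner (map c [0..<k]) (p n)"
    using comb_e[OF assms(1)] assms(2) cl_eq_zero_iff by simp
  with assms(1) have "\<forall>i<k. c i = \<zero>"
  proof (induction k)
    case (Suc k)
    have k: "c k = \<zero>"
    proof (rule ccontr)
      assume "c k \<noteq> \<zero>"
      then have "\<exists>n. \<not> q n divides horner (map c [0..<Suc k]) (p n)"
        using Suc.prems(1) by (intro transcendental) auto
      then show False using Suc.prems(2) by blast
    qed
    have "horner (map c [0..<Suc k]) (p n) = horner (map c [0..<k]) (p n)" for n
      using horner_append[of "map c [0..<k]" "c k" "p n"] Suc.prems(1) k
      by (simp add: image_subset_iff less_SucI)
    then show ?case using Suc k less_Suc_eq by simp
  qed simp
  then show ?thesis using assms(3) by simp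
qed

text \<open>The entry \<open>n\<close> of the difference is zero, so the difference is a multiple of
  \<open>q n\<close> by \<open>completion_divisible\<close>.\<close>

lemma e_shift: "\<exists>c\<in>carrier A. e (i + j) = (p n [^] j) \<odot>\<^bsub>A\<^esub> e i \<oplus>\<^bsub>A\<^esub> q n \<odot>\<^bsub>A\<^esub> c"
proof -
  define u where "u = (\<lambda>m. p m [^] (i + j) \<oplus> \<ominus> (p n [^] j \<otimes> p m [^] i))"
  have u: "coherent u" unfolding u_def
    by (intro coherent_add coherent_minus coherent_smult coherent_pow coherent_p) simp
  have "u n = \<zero>" by (simp add: u_def nat_pow_mult[symmetric] m_comm r_neg)
  then obtain c where c: "c \<in> carrier A" "cl u = q n \<odot>\<^bsub>A\<^esub> c"
    using completion_divisible[OF u, of n] by (auto simp: divides_zero)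
  have "(p n [^] j) \<odot>\<^bsub>A\<^esub> e i \<oplus>\<^bsub>A\<^esub> cl u = cl (\<lambda>m. p n [^] j \<otimes> p m [^] i \<oplus> u m)"
    unfolding e_def using u by (simp add: cl_smult cl_add coherent_pow coherent_p coherent_smult)
  also have "\<dots> = e (i + j)" unfolding e_def
    by (intro arg_cong[of _ _ cl] ext) (simp add: u_def a_lcomm r_neg)
  finally show ?thesis using c by (intro bexI[of _ c]) simp_all
qed

text \<open>Since \<open>s\<close> divides some \<open>q n\<close>, the entry \<open>n\<close> of
  the equation shows that \<open>s\<close> divides \<open>r\<close> already in the ring, and
  \<open>s\<close> can be cancelled. This purity of \<open>R\<close> in its completion removes the
  multiplier at the end of \<open>h_const\<close>.\<close>

lemma e_pure:
  assumes "s \<in> S" "a \<in> carrier A" "r \<in> carrier R" "s \<odot>\<^bsub>A\<^esub> a = r \<odot>\<^bsub>A\<^esub> e 0"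
  shows "\<exists>t\<in>carrier R. a = t \<odot>\<^bsub>A\<^esub> e 0"
proof -
  obtain u where u: "coherent u" "a = cl u" using assms by (metis completion_carrierE)
  obtain n where n: "s divides q n" using divides_q assms by blast
  have "cl (\<lambda>n. s \<otimes> u n) = cl (\<lambda>n. r)"
    using assms u by (simp add: cl_smult e_def coherent_const)
  then have "q n divides (s \<otimes> u n \<ominus> r)"
    using u assms cl_eq_iff coherent_smult coherent_const by simp
  then have "s divides (s \<otimes> u n \<ominus> r)" using divides_trans[OF n] assms by simp
  moreover have "s divides (s \<otimes> u n)" using u assms by (auto simp: factor_def)
  moreover have "s \<otimes> u n \<ominus> (s \<otimes> u n \<ominus> r) = r"
    using coherent_closed[OF u(1), of n] S_closed[OF assms(1)] assms(3) by algebra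
  ultimately have "s divides r" using divides_diff[of s "s \<otimes> u n" "s \<otimes> u n \<ominus> r"] u assms by simp
  then obtain t where t: "t \<in> carrier R" "r = s \<otimes> t" by (auto simp: factor_def)
  then have "s \<odot>\<^bsub>A\<^esub> a = s \<odot>\<^bsub>A\<^esub> (t \<odot>\<^bsub>A\<^esub> e 0)" using assms A.smult_assoc1 by simp
  then have "a = t \<odot>\<^bsub>A\<^esub> e 0" by (intro completion_torsion_free[OF assms(1,2)]) (simp_all add: t)
  then show ?thesis using t(1) by blast
qed

end

section \<open>Finitely supported functions\<close>

text \<open>Functions are total and take the default value \<open>z\<close> outside
  \<open>X\<close>, so that equality of vectors is equality of functions.\<close>

definition finsupp :: "'y set \<Rightarrow> 'y \<Rightarrow> 'x set \<Rightarrow> ('x \<Rightarrow> 'y) set" where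
  "finsupp C z X = {f. range f \<subseteq> C \<and> finite {x. f x \<noteq> z} \<and> {x. f x \<noteq> z} \<subseteq> X}"

lemma finsuppI:
  assumes "\<And>x. f x \<in> C" "finite F" "F \<subseteq> X" "\<And>x. x \<notin> F \<Longrightarrow> f x = z" shows "f \<in> finsupp C z X"
proof -
  have "{x. f x \<noteq> z} \<subseteq> F" using assms(4) by auto
  then show ?thesis using assms(1-3) finite_subset by (auto simp: finsupp_def)
qed

lemma finsuppE:
  assumes "f \<in> finsupp C z X" obtains F where "finite F" "F \<subseteq> X" "\<And>x. x \<notin> F \<Longrightarrow> f x = z"
proof -
  have "finite {x. f x \<noteq> z}" "{x. f x \<noteq> z} \<subseteq> X" using assms by (auto simp: finsupp_def)
  then show ?thesis using that by blast
qed

lemma finsupp_binary: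
  assumes "f \<in> finsupp C z X" "g \<in> finsupp C' z' X"
    and "\<And>x y. x \<in> C \<Longrightarrow> y \<in> C' \<Longrightarrow> H x y \<in> C''" "H z z' = z''"
  shows "(\<lambda>x. H (f x) (g x)) \<in> finsupp C'' z'' X"
proof -
  obtain F where "finite F" "F \<subseteq> X" "\<And>x. x \<notin> F \<Longrightarrow> f x = z" by (rule finsuppE[OF assms(1)]) blast
  moreover obtain G where "finite G" "G \<subseteq> X" "\<And>x. x \<notin> G \<Longrightarrow> g x = z'" by (rule finsuppE[OF assms(2)]) blast
  moreover have "f x \<in> C" "g x \<in> C'" for x using assms(1,2) by (auto simp: finsupp_def)
  ultimately show ?thesis using assms(3,4) by (intro finsuppI[of _ _ "F \<union> G"]) auto
qed

context transcendental_branch begin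

lemma comb_closed [simp]:
  "(\<And>i. i < k \<Longrightarrow> c i \<in> carrier R) \<Longrightarrow> (\<And>i. i < k \<Longrightarrow> f i \<in> carrier A) \<Longrightarrow> comb k c f \<in> carrier A"
  by (induction k) auto

lemma comb_cong:
  "(\<And>i. i < k \<Longrightarrow> c i = d i) \<Longrightarrow> (\<And>i. i < k \<Longrightarrow> f i = g i) \<Longrightarrow> comb k c f = comb k d g"
  by (induction k) auto

lemma comb_zero:
  "(\<And>i. i < k \<Longrightarrow> c i = \<zero>) \<Longrightarrow> (\<And>i. i < k \<Longrightarrow> f i \<in> carrier A) \<Longrightarrow> comb k c f = \<zero>\<^bsub>A\<^esub>"
  by (induction k) auto

lemma comb_add:
  "(\<And>i. i < k \<Longrightarrow> c i \<in> carrier R) \<Longrightarrow> (\<And>i. i < k \<Longrightarrow> d i \<in> carrier R) \<Longrightarrow> (\<And>i. i < k \<Longrightarrow> f i \<in> carrier A)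
    \<Longrightarrow> comb k (\<lambda>i. c i \<oplus> d i) f = comb k c f \<oplus>\<^bsub>A\<^esub> comb k d f"
  by (induction k) (auto simp: A.smult_l_distr A.M.add.m_ac)

lemma comb_smult:
  "(\<And>i. i < k \<Longrightarrow> c i \<in> carrier R) \<Longrightarrow> r \<in> carrier R \<Longrightarrow> (\<And>i. i < k \<Longrightarrow> f i \<in> carrier A)
    \<Longrightarrow> comb k (\<lambda>i. r \<otimes> c i) f = r \<odot>\<^bsub>A\<^esub> comb k c f"
  by (induction k) (auto simp: A.smult_r_distr A.smult_assoc1)

lemma comb_extend:
  assumes "j \<le> k" "\<And>i. i < j \<Longrightarrow> c i \<in> carrier R" "\<And>i. j \<le> i \<Longrightarrow> i < k \<Longrightarrow> c i = \<zero>" "\<And>i. i < k \<Longrightarrow> f i \<in> carrier A"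
  shows "comb k c f = comb j c f"
  using assms by (induction k rule: dec_induct) auto

lemma comb_shift:
  assumes "\<And>i. i < k \<Longrightarrow> c i \<in> carrier R"
  shows "comb k c (\<lambda>i. e (i + j)) = comb (k + j) (\<lambda>i. if i < j then \<zero> else c (i - j)) e"
  using assms
proof (induction k)
  case 0
  show ?case using comb_zero[of j "\<lambda>i. if i < j then \<zero> else c (i - j)" e] by simp
qed simp

lemma comb_e_inj:
  assumes "\<And>i. i < k \<Longrightarrow> c i \<in> carrier R" "\<And>i. i < k \<Longrightarrow> d i \<in> carrier R" "comb k c e = comb k d e" "i < k"
  shows "c i = d i"
proof -
  have "comb k (\<lambda>i. c i \<oplus> (\<ominus> \<one>) \<otimes> d i) e = comb k c e \<oplus>\<^bsub>A\<^esub> (\<ominus> \<one>) \<odot>\<^bsub>A\<^esub> comb k d e"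
    using assms(1,2) comb_smult[of k d "\<ominus> \<one>" e] by (subst comb_add) auto
  also have "\<dots> = \<zero>\<^bsub>A\<^esub>"
    using assms(1-3) A.smult_l_minus[of \<one> "comb k d e"] by (simp add: A.M.r_neg)
  finally have "c i \<oplus> (\<ominus> \<one>) \<otimes> d i = \<zero>"
    using assms by (intro e_independent[of k "\<lambda>i. c i \<oplus> (\<ominus> \<one>) \<otimes> d i"]) auto
  then have "c i \<ominus> d i = \<zero>" using assms by (simp add: l_minus minus_eq)
  then show ?thesis using minus_eq_zero_iff assms by blast
qed

section \<open>Congruences modulo \<open>q n\<close> in the completion\<close>

definition qcong :: "nat \<Rightarrow> (nat \<Rightarrow> 'a) \<Rightarrow> (nat \<Rightarrow> 'a) \<Rightarrow> bool" where
  "qcong n x y \<longleftrightarrow> x \<in> carrier A \<and> y \<in> carrier A \<and> (\<exists>d\<in>carrier A. x = y \<oplus>\<^bsub>A\<^esub> q n \<odot>\<^bsub>A\<^esub> d)"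

lemma qcong_refl: "x \<in> carrier A \<Longrightarrow> qcong n x x"
  by (auto simp: qcong_def intro!: bexI[of _ "\<zero>\<^bsub>A\<^esub>"])

lemma qcong_sym: assumes "qcong n x y" shows "qcong n y x"
proof -
  obtain d where d: "d \<in> carrier A" "x = y \<oplus>\<^bsub>A\<^esub> q n \<odot>\<^bsub>A\<^esub> d" using assms by (auto simp: qcong_def)
  have "y \<in> carrier A" using assms by (simp add: qcong_def)
  then have "y = x \<oplus>\<^bsub>A\<^esub> q n \<odot>\<^bsub>A\<^esub> (\<ominus>\<^bsub>A\<^esub> d)"
    using d by (simp add: A.smult_r_minus A.M.a_assoc A.M.r_neg)
  then show ?thesis using assms d by (auto simp: qcong_def intro!: bexI[of _ "\<ominus>\<^bsub>A\<^esub> d"])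
qed

lemma qcong_trans: assumes "qcong n x y" "qcong n y z" shows "qcong n x z"
proof -
  obtain d d' where d: "d \<in> carrier A" "x = y \<oplus>\<^bsub>A\<^esub> q n \<odot>\<^bsub>A\<^esub> d" "d' \<in> carrier A" "y = z \<oplus>\<^bsub>A\<^esub> q n \<odot>\<^bsub>A\<^esub> d'"
    using assms by (auto simp: qcong_def)
  have "z \<in> carrier A" using assms by (simp add: qcong_def)
  then have "x = z \<oplus>\<^bsub>A\<^esub> q n \<odot>\<^bsub>A\<^esub> (d' \<oplus>\<^bsub>A\<^esub> d)"
    using d by (simp add: A.smult_r_distr A.M.a_assoc)
  then show ?thesis using assms d by (auto simp: qcong_def intro!: bexI[of _ "d' \<oplus>\<^bsub>A\<^esub> d"])
qed

lemma qcong_add: assumes "qcong n x y" "qcong n x' y'" shows "qcong n (x \<oplus>\<^bsub>A\<^esub> x') (y \<oplus>\<^bsub>A\<^esub> y')"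
proof -
  obtain d d' where d: "d \<in> carrier A" "x = y \<oplus>\<^bsub>A\<^esub> q n \<odot>\<^bsub>A\<^esub> d" "d' \<in> carrier A" "x' = y' \<oplus>\<^bsub>A\<^esub> q n \<odot>\<^bsub>A\<^esub> d'"
    using assms by (auto simp: qcong_def)
  have "y \<in> carrier A" "y' \<in> carrier A" using assms by (simp_all add: qcong_def)
  then have "x \<oplus>\<^bsub>A\<^esub> x' = (y \<oplus>\<^bsub>A\<^esub> y') \<oplus>\<^bsub>A\<^esub> q n \<odot>\<^bsub>A\<^esub> (d \<oplus>\<^bsub>A\<^esub> d')"
    using d by (simp add: A.smult_r_distr A.M.add.m_ac)
  then show ?thesis using assms d by (auto simp: qcong_def intro!: bexI[of _ "d \<oplus>\<^bsub>A\<^esub> d'"])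
qed

lemma qcong_smult: assumes "qcong n x y" "r \<in> carrier R" shows "qcong n (r \<odot>\<^bsub>A\<^esub> x) (r \<odot>\<^bsub>A\<^esub> y)"
proof -
  obtain d where d: "d \<in> carrier A" "x = y \<oplus>\<^bsub>A\<^esub> q n \<odot>\<^bsub>A\<^esub> d" using assms by (auto simp: qcong_def)
  have y: "y \<in> carrier A" using assms by (simp add: qcong_def)
  have "r \<odot>\<^bsub>A\<^esub> (q n \<odot>\<^bsub>A\<^esub> d) = q n \<odot>\<^bsub>A\<^esub> (r \<odot>\<^bsub>A\<^esub> d)"
    using d assms(2) by (simp add: A.smult_assoc1[symmetric] m_comm)
  then have "r \<odot>\<^bsub>A\<^esub> x = r \<odot>\<^bsub>A\<^esub> y \<oplus>\<^bsub>A\<^esub> q n \<odot>\<^bsub>A\<^esub> (r \<odot>\<^bsub>A\<^esub> d)"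
    using d y assms(2) by (simp add: A.smult_r_distr)
  then show ?thesis using assms d by (auto simp: qcong_def intro!: bexI[of _ "r \<odot>\<^bsub>A\<^esub> d"])
qed

lemma qcong_eq:
  assumes "\<And>n. qcong n x y" shows "x = y"
proof -
  have xy: "x \<in> carrier A" "y \<in> carrier A" using assms by (auto simp: qcong_def)
  have "x \<ominus>\<^bsub>A\<^esub> y = \<zero>\<^bsub>A\<^esub>"
  proof (rule completion_reduced)
    fix n
    obtain d where d: "d \<in> carrier A" "x = y \<oplus>\<^bsub>A\<^esub> q n \<odot>\<^bsub>A\<^esub> d" using assms[of n] by (auto simp: qcong_def)
    then have "x \<ominus>\<^bsub>A\<^esub> y = q n \<odot>\<^bsub>A\<^esub> d"
      using xy(2) by (simp add: A.M.minus_eq A.M.a_ac A.M.r_neg A.M.r_neg1 A.M.r_neg2)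
    then show "\<exists>c\<in>carrier A. x \<ominus>\<^bsub>A\<^esub> y = q n \<odot>\<^bsub>A\<^esub> c" using d(1) by blast
  qed (simp add: xy)
  then show ?thesis using A.M.minus_eq_zero_iff xy by blast
qed

lemma qcong_comb:
  "(\<And>i. i < k \<Longrightarrow> c i \<in> carrier R) \<Longrightarrow> (\<And>i. i < k \<Longrightarrow> qcong n (f i) (g i)) \<Longrightarrow> qcong n (comb k c f) (comb k c g)"
  by (induction k) (auto simp: qcong_refl intro!: qcong_add qcong_smult)

lemma qcong_e: "qcong n (e (i + j)) ((p n [^] j) \<odot>\<^bsub>A\<^esub> e i)"
  using e_shift[of i j n] by (auto simp: qcong_def)

lemma comb_smult_right:
  "(\<And>i. i < k \<Longrightarrow> c i \<in> carrier R) \<Longrightarrow> r \<in> carrier R \<Longrightarrow> (\<And>i. i < k \<Longrightarrow> f i \<in> carrier A)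
    \<Longrightarrow> comb k c (\<lambda>i. r \<odot>\<^bsub>A\<^esub> f i) = r \<odot>\<^bsub>A\<^esub> comb k c f"
  by (induction k) (auto simp: A.smult_r_distr A.smult_assoc1[symmetric] m_comm)

lemma qcong_comb_shift:
  assumes "\<And>i. i < k \<Longrightarrow> c i \<in> carrier R"
  shows "qcong n (comb k c (\<lambda>i. e (i + j))) ((p n [^] j) \<odot>\<^bsub>A\<^esub> comb k c e)"
proof -
  have "qcong n (comb k c (\<lambda>i. e (i + j))) (comb k c (\<lambda>i. (p n [^] j) \<odot>\<^bsub>A\<^esub> e i))"
    using assms qcong_e by (intro qcong_comb) auto
  then show ?thesis using comb_smult_right[of k c "p n [^] j" e] assms by simp
qed

text \<open>The congruences say that \<open>y\<close> is \<open>x\<close> times the \<open>k\<close>-th power of the transcendental element.\<close>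

lemma constant_if_shift_bounded:
  assumes c: "\<And>i. i < Suc k \<Longrightarrow> c i \<in> carrier R" and d: "\<And>i. i < Suc k \<Longrightarrow> d i \<in> carrier R"
    and s: "s \<in> S" "t \<in> S" and xy: "x \<in> carrier A" "y \<in> carrier A"
    and eq: "s \<odot>\<^bsub>A\<^esub> x = comb (Suc k) c e" "t \<odot>\<^bsub>A\<^esub> y = comb (Suc k) d e"
    and shift: "\<And>n. qcong n y ((p n [^] k) \<odot>\<^bsub>A\<^esub> x)" and i: "0 < i" "i < Suc k"
  shows "c i = \<zero>"
proof -
  \<comment> \<open>\<open>C\<close> and \<open>D\<close> are the coefficients of the same element
    \<open>s t\<close> \<pi>^k \<open>x\<close>, computed from \<open>s x\<close> and from
    \<open>t y\<close>. The first list is shifted by \<open>k\<close>, the second ends at degree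
    \<open>k\<close>, so comparison in degree \<open>i + k\<close> kills \<open>c i\<close> for
    positive \<open>i\<close>.\<close>
  define C where "C = (\<lambda>i. if i < k then \<zero> else t \<otimes> c (i - k))"
  define D where "D = (\<lambda>i. if i < Suc k then s \<otimes> d i else \<zero>)"
  have st: "s \<in> carrier R" "t \<in> carrier R" using s by auto
  have C: "C i \<in> carrier R" if "i < Suc k + k" for i using that c[of "i - k"] st by (auto simp: C_def)
  have D: "D i \<in> carrier R" for i using d st by (auto simp: D_def)
  have "comb (Suc k + k) D e = comb (Suc k) D e" by (rule comb_extend) (auto simp: D_def d st)
  also have "\<dots> = comb (Suc k) (\<lambda>i. s \<otimes> d i) e" by (rule comb_cong) (auto simp: D_def)
  also have "\<dots> = s \<odot>\<^bsub>A\<^esub> (t \<odot>\<^bsub>A\<^esub> y)" using d st by (subst comb_smult) (simp_all del: comb.simps add: eq)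
  finally have cD: "comb (Suc k + k) D e = s \<odot>\<^bsub>A\<^esub> (t \<odot>\<^bsub>A\<^esub> y)" .
  have cC: "comb (Suc k + k) C e = t \<odot>\<^bsub>A\<^esub> comb (Suc k) c (\<lambda>i. e (i + k))"
    unfolding C_def using comb_shift[of "Suc k" "\<lambda>i. t \<otimes> c i" k] comb_smult[of "Suc k" c t "\<lambda>i. e (i + k)"] c st
    by (simp del: comb.simps)
  have "qcong n (comb (Suc k + k) C e) (comb (Suc k + k) D e)" for n
  proof -
    define P where "P = p n [^] k"
    have P: "P \<in> carrier R" by (simp add: P_def)
    have "qcong n (comb (Suc k + k) C e) (t \<odot>\<^bsub>A\<^esub> (P \<odot>\<^bsub>A\<^esub> (s \<odot>\<^bsub>A\<^esub> x)))"
      unfolding cC eq P_def using c st by (intro qcong_smult qcong_comb_shift)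
    moreover have "qcong n (s \<odot>\<^bsub>A\<^esub> (t \<odot>\<^bsub>A\<^esub> y)) (s \<odot>\<^bsub>A\<^esub> (t \<odot>\<^bsub>A\<^esub> (P \<odot>\<^bsub>A\<^esub> x)))"
      using shift st unfolding P_def by (intro qcong_smult)
    moreover have "s \<odot>\<^bsub>A\<^esub> (t \<odot>\<^bsub>A\<^esub> (P \<odot>\<^bsub>A\<^esub> x)) = t \<odot>\<^bsub>A\<^esub> (P \<odot>\<^bsub>A\<^esub> (s \<odot>\<^bsub>A\<^esub> x))"
      using st P xy by (simp add: A.smult_assoc1[symmetric] m_ac)
    ultimately show ?thesis unfolding cD using qcong_trans qcong_sym by metis
  qed
  then have eq2: "comb (Suc k + k) C e = comb (Suc k + k) D e" by (rule qcong_eq)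
  have "C (i + k) = D (i + k)" by (rule comb_e_inj[OF C D eq2]) (use i in auto)
  then have "t \<otimes> c i = \<zero>" using i by (simp add: C_def D_def)
  then show ?thesis using torsion_free s c i by blast
qed

section \<open>The free module and vectors over the completion\<close>

abbreviation coeffs :: "'x set \<Rightarrow> ('x \<Rightarrow> 'a) set" where
  "coeffs X \<equiv> finsupp (carrier R) \<zero> X"

abbreviation vecs :: "'x set \<Rightarrow> ('x \<Rightarrow> nat \<Rightarrow> 'a) set" where
  "vecs X \<equiv> finsupp (carrier A) \<zero>\<^bsub>A\<^esub> X"

definition vadd :: "('x \<Rightarrow> nat \<Rightarrow> 'a) \<Rightarrow> ('x \<Rightarrow> nat \<Rightarrow> 'a) \<Rightarrow> 'x \<Rightarrow> nat \<Rightarrow> 'a" where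
  "vadd v w = (\<lambda>x. v x \<oplus>\<^bsub>A\<^esub> w x)"

definition vsmult :: "'a \<Rightarrow> ('x \<Rightarrow> nat \<Rightarrow> 'a) \<Rightarrow> 'x \<Rightarrow> nat \<Rightarrow> 'a" where
  "vsmult r v = (\<lambda>x. r \<odot>\<^bsub>A\<^esub> v x)"

lemma coeffs_closed [simp]: "a \<in> coeffs X \<Longrightarrow> a x \<in> carrier R" by (auto simp: finsupp_def)
lemma vecs_closed [simp]: "v \<in> vecs X \<Longrightarrow> v x \<in> carrier A" by (auto simp: finsupp_def)

lemma coeffs_zero: "(\<lambda>_. \<zero>) \<in> coeffs X" by (rule finsuppI[of _ _ "{}"]) auto

lemma coeffs_add: "a \<in> coeffs X \<Longrightarrow> b \<in> coeffs X \<Longrightarrow> (\<lambda>x. a x \<oplus> b x) \<in> coeffs X"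
  by (rule finsupp_binary[where H = "(\<oplus>)"]) auto

lemma vecs_add: "v \<in> vecs X \<Longrightarrow> w \<in> vecs X \<Longrightarrow> vadd v w \<in> vecs X"
  unfolding vadd_def by (rule finsupp_binary[where H = "(\<oplus>\<^bsub>A\<^esub>)"]) auto

lemma coeffs_smult: "a \<in> coeffs X \<Longrightarrow> r \<in> carrier R \<Longrightarrow> (\<lambda>x. r \<otimes> a x) \<in> coeffs X"
  using finsupp_binary[of a "carrier R" \<zero> X a "carrier R" \<zero> "\<lambda>x y. r \<otimes> x" "carrier R" \<zero>] by auto

lemma vecs_smult: "v \<in> vecs X \<Longrightarrow> r \<in> carrier R \<Longrightarrow> vsmult r v \<in> vecs X"
  unfolding vsmult_def
  using finsupp_binary[of v "carrier A" "\<zero>\<^bsub>A\<^esub>" X v "carrier A" "\<zero>\<^bsub>A\<^esub>" "\<lambda>x y. r \<odot>\<^bsub>A\<^esub> x" "carrier A" "\<zero>\<^bsub>A\<^esub>"] by auto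

definition delta :: "'x \<Rightarrow> 'x \<Rightarrow> 'a" where "delta x = (\<lambda>y. if y = x then \<one> else \<zero>)"

lemma delta_coeffs: "x \<in> X \<Longrightarrow> delta x \<in> coeffs X"
  by (rule finsuppI[of _ _ "{x}"]) (auto simp: delta_def)

text \<open>The linear extension of \<open>f\<close> to the free module. Restricting the fibre to
  the support keeps the index set finite; over an infinite set \<open>finsum\<close> would be zero
  by default.\<close>

definition push :: "('x \<Rightarrow> 'x) \<Rightarrow> ('x \<Rightarrow> 'a) \<Rightarrow> 'x \<Rightarrow> 'a" where
  "push f a y = finsum R a {x. a x \<noteq> \<zero> \<and> f x = y}"

lemma push_eq:
  assumes "a \<in> coeffs X" "finite F" "\<And>x. x \<notin> F \<Longrightarrow> a x = \<zero>"
  shows "push f a y = finsum R a {x \<in> F. f x = y}"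
  unfolding push_def by (rule add.finprod_mono_neutral_cong_left) (use assms in auto)

lemma push_support: "push f a y \<noteq> \<zero> \<Longrightarrow> \<exists>x. a x \<noteq> \<zero> \<and> f x = y"
proof (rule ccontr)
  assume "push f a y \<noteq> \<zero>" "\<not> (\<exists>x. a x \<noteq> \<zero> \<and> f x = y)"
  moreover from this(2) have "{x. a x \<noteq> \<zero> \<and> f x = y} = {}" by blast
  ultimately show False by (simp add: push_def)
qed

lemma push_coeffs:
  assumes "a \<in> coeffs X" "f ` X \<subseteq> X" shows "push f a \<in> coeffs X"
proof -
  obtain F where F: "finite F" "F \<subseteq> X" "\<And>x. x \<notin> F \<Longrightarrow> a x = \<zero>" by (rule finsuppE[OF assms(1)]) blast
  show ?thesis
  proof (rule finsuppI[of _ _ "f ` F"])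
    show "push f a x \<in> carrier R" for x unfolding push_def using assms by (intro finsum_closed) auto
    show "push f a x = \<zero>" if "x \<notin> f ` F" for x using push_support[of f a x] F(3) that by blast
  qed (use F assms in auto)
qed

lemma push_add:
  assumes "a \<in> coeffs X" "b \<in> coeffs X"
  shows "push f (\<lambda>x. a x \<oplus> b x) = (\<lambda>y. push f a y \<oplus> push f b y)"
proof
  fix y
  obtain F where F: "finite F" "F \<subseteq> X" "\<And>x. x \<notin> F \<Longrightarrow> a x = \<zero>" by (rule finsuppE[OF assms(1)]) blast
  obtain G where G: "finite G" "G \<subseteq> X" "\<And>x. x \<notin> G \<Longrightarrow> b x = \<zero>" by (rule finsuppE[OF assms(2)]) blast
  have "push f (\<lambda>x. a x \<oplus> b x) y = finsum R (\<lambda>x. a x \<oplus> b x) {x \<in> F \<union> G. f x = y}"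
    using F G assms by (intro push_eq[OF coeffs_add[OF assms]]) auto
  also have "\<dots> = finsum R a {x \<in> F \<union> G. f x = y} \<oplus> finsum R b {x \<in> F \<union> G. f x = y}"
    using assms by (intro finsum_addf) auto
  also have "finsum R a {x \<in> F \<union> G. f x = y} = push f a y"
    using F G assms by (intro push_eq[symmetric, OF assms(1)]) auto
  also have "finsum R b {x \<in> F \<union> G. f x = y} = push f b y"
    using F G assms by (intro push_eq[symmetric, OF assms(2)]) auto
  finally show "push f (\<lambda>x. a x \<oplus> b x) y = push f a y \<oplus> push f b y" .
qed

lemma push_smult:
  assumes "a \<in> coeffs X" "r \<in> carrier R"
  shows "push f (\<lambda>x. r \<otimes> a x) = (\<lambda>y. r \<otimes> push f a y)"
proof
  fix y
  obtain F where F: "finite F" "F \<subseteq> X" "\<And>x. x \<notin> F \<Longrightarrow> a x = \<zero>" by (rule finsuppE[OF assms(1)]) blast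
  have "push f (\<lambda>x. r \<otimes> a x) y = finsum R (\<lambda>x. r \<otimes> a x) {x \<in> F. f x = y}"
    using F assms by (intro push_eq[OF coeffs_smult[OF assms]]) auto
  also have "\<dots> = r \<otimes> finsum R a {x \<in> F. f x = y}"
    using F assms by (intro finsum_rdistr[symmetric]) auto
  also have "finsum R a {x \<in> F. f x = y} = push f a y"
    using F by (intro push_eq[symmetric, OF assms(1)]) auto
  finally show "push f (\<lambda>x. r \<otimes> a x) y = r \<otimes> push f a y" .
qed

lemma push_delta: "push f (delta x) = delta (f x)"
proof
  fix y
  have "delta x \<in> coeffs UNIV" by (rule delta_coeffs) simp
  then have "push f (delta x) y = finsum R (delta x) {z \<in> {x}. f z = y}"
    by (rule push_eq) (auto simp: delta_def)
  also have "{z \<in> {x}. f z = y} = (if f x = y then {x} else {})" by auto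
  also have "finsum R (delta x) \<dots> = delta (f x) y" by (auto simp: delta_def finsum_singleton)
  finally show "push f (delta x) y = delta (f x) y" .
qed

end

context transcendental_branch begin

lemma vadd_assoc: "u \<in> vecs X \<Longrightarrow> v \<in> vecs X \<Longrightarrow> w \<in> vecs X \<Longrightarrow> vadd (vadd u v) w = vadd u (vadd v w)"
  by (simp add: vadd_def A.M.a_assoc)

lemma vadd_commute: "u \<in> vecs X \<Longrightarrow> v \<in> vecs X \<Longrightarrow> vadd u v = vadd v u"
  by (simp add: vadd_def A.M.a_comm)

lemma vadd_zero: "v \<in> vecs X \<Longrightarrow> vadd (\<lambda>_. \<zero>\<^bsub>A\<^esub>) v = v"
  by (simp add: vadd_def)

lemma vadd_minus: "v \<in> vecs X \<Longrightarrow> vadd (vsmult (\<ominus> \<one>) v) v = (\<lambda>_. \<zero>\<^bsub>A\<^esub>)"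
  by (simp add: vadd_def vsmult_def A.smult_l_minus A.M.l_neg)

lemma vsmult_one: "v \<in> vecs X \<Longrightarrow> vsmult \<one> v = v"
  by (simp add: vsmult_def)

lemma vsmult_assoc: "r \<in> carrier R \<Longrightarrow> s \<in> carrier R \<Longrightarrow> v \<in> vecs X \<Longrightarrow> vsmult (r \<otimes> s) v = vsmult r (vsmult s v)"
  by (simp add: vsmult_def A.smult_assoc1)

lemma vsmult_l_distr: "r \<in> carrier R \<Longrightarrow> s \<in> carrier R \<Longrightarrow> v \<in> vecs X
    \<Longrightarrow> vsmult (r \<oplus> s) v = vadd (vsmult r v) (vsmult s v)"
  by (simp add: vsmult_def vadd_def A.smult_l_distr)

lemma vsmult_r_distr: "r \<in> carrier R \<Longrightarrow> v \<in> vecs X \<Longrightarrow> w \<in> vecs X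
    \<Longrightarrow> vsmult r (vadd v w) = vadd (vsmult r v) (vsmult r w)"
  by (simp add: vsmult_def vadd_def A.smult_r_distr)

lemma vecs_divisible:
  assumes "v \<in> vecs X" "w \<in> vecs X" "\<And>x. qcong n (v x) (w x)"
  shows "\<exists>u\<in>vecs X. v = vadd w (vsmult (q n) u)"
proof -
  have "\<exists>d. d \<in> carrier A \<and> v x = w x \<oplus>\<^bsub>A\<^esub> q n \<odot>\<^bsub>A\<^esub> d" for x using assms(3)[of x] by (auto simp: qcong_def)
  then obtain d where d: "\<And>x. d x \<in> carrier A" "\<And>x. v x = w x \<oplus>\<^bsub>A\<^esub> q n \<odot>\<^bsub>A\<^esub> d x" by metis
  \<comment> \<open>The chosen quotients are reset to zero where both vectors vanish, so that the
    support stays finite.\<close>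
  define u where "u = (\<lambda>x. if v x = \<zero>\<^bsub>A\<^esub> \<and> w x = \<zero>\<^bsub>A\<^esub> then \<zero>\<^bsub>A\<^esub> else d x)"
  obtain F where F: "finite F" "F \<subseteq> X" "\<And>x. x \<notin> F \<Longrightarrow> v x = \<zero>\<^bsub>A\<^esub>" by (rule finsuppE[OF assms(1)]) blast
  obtain G where G: "finite G" "G \<subseteq> X" "\<And>x. x \<notin> G \<Longrightarrow> w x = \<zero>\<^bsub>A\<^esub>" by (rule finsuppE[OF assms(2)]) blast
  have "u x = \<zero>\<^bsub>A\<^esub>" if "x \<notin> F \<union> G" for x using that F(3) G(3) by (simp add: u_def)
  then have "u \<in> vecs X" using F G by (intro finsuppI[of _ _ "F \<union> G"]) (simp_all add: u_def d(1))
  moreover have "v = vadd w (vsmult (q n) u)"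
    unfolding vadd_def vsmult_def u_def
  proof (rule ext)
    fix x
    show "v x = w x \<oplus>\<^bsub>A\<^esub> q n \<odot>\<^bsub>A\<^esub> (if v x = \<zero>\<^bsub>A\<^esub> \<and> w x = \<zero>\<^bsub>A\<^esub> then \<zero>\<^bsub>A\<^esub> else d x)"
      by (cases "v x = \<zero>\<^bsub>A\<^esub> \<and> w x = \<zero>\<^bsub>A\<^esub>") (auto intro: d(2))
  qed
  ultimately show ?thesis by blast
qed

lemma comb_single:
  assumes "i < k" "r \<in> carrier R" "\<And>j. j < k \<Longrightarrow> f j \<in> carrier A"
  shows "comb k (\<lambda>j. if j = i then r else \<zero>) f = r \<odot>\<^bsub>A\<^esub> f i"
  using assms
proof (induction k)
  case (Suc k)
  show ?case
  proof (cases "i = k")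
    case True
    have "comb k (\<lambda>j. if j = i then r else \<zero>) f = \<zero>\<^bsub>A\<^esub>" by (rule comb_zero) (use True Suc in auto)
    then show ?thesis using True Suc by simp
  next
    case False
    then show ?thesis using Suc by simp
  qed
qed simp

section \<open>Constants and polynomial vectors\<close>

definition const :: "('x \<Rightarrow> 'a) \<Rightarrow> 'x \<Rightarrow> nat \<Rightarrow> 'a" where
  "const c = (\<lambda>x. c x \<odot>\<^bsub>A\<^esub> e 0)"

definition polyvec :: "(nat \<Rightarrow> 'x \<Rightarrow> 'a) \<Rightarrow> 'x \<Rightarrow> nat \<Rightarrow> 'a" where
  "polyvec a = (\<lambda>x. comb 8 (\<lambda>i. a i x) e)"

lemma const_inj: assumes "c \<in> coeffs X" "d \<in> coeffs X" "const c = const d" shows "c = d"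
proof
  fix x
  have "comb 1 (\<lambda>i. c x) e = comb 1 (\<lambda>i. d x) e"
    using fun_cong[OF assms(3), of x] assms(1,2) by (simp add: const_def)
  then show "c x = d x" using comb_e_inj[of 1 "\<lambda>i. c x" "\<lambda>i. d x" 0] assms(1,2) by simp
qed

lemma const_add: "c \<in> coeffs X \<Longrightarrow> d \<in> coeffs X \<Longrightarrow> const (\<lambda>x. c x \<oplus> d x) = vadd (const c) (const d)"
  by (simp add: const_def vadd_def A.smult_l_distr)

lemma const_smult: "c \<in> coeffs X \<Longrightarrow> r \<in> carrier R \<Longrightarrow> const (\<lambda>x. r \<otimes> c x) = vsmult r (const c)"
  by (simp add: const_def vsmult_def A.smult_assoc1)

lemma polyvec_vecs:
  assumes "\<And>i. a i \<in> coeffs X" shows "polyvec a \<in> vecs X"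
proof (rule finsuppI[of _ _ "\<Union>i<8. {x. a i x \<noteq> \<zero>}"])
  show "polyvec a x \<in> carrier A" for x unfolding polyvec_def using coeffs_closed[OF assms] by (intro comb_closed) auto
  show "finite (\<Union>i<8. {x. a i x \<noteq> \<zero>})" using assms by (auto simp: finsupp_def)
  show "(\<Union>i<8. {x. a i x \<noteq> \<zero>}) \<subseteq> X" using assms by (auto simp: finsupp_def)
  show "polyvec a x = \<zero>\<^bsub>A\<^esub>" if "x \<notin> (\<Union>i<8. {x. a i x \<noteq> \<zero>})" for x
    unfolding polyvec_def using that by (intro comb_zero) auto
qed

lemma polyvec_add:
  assumes "\<And>i. a i \<in> coeffs X" "\<And>i. b i \<in> coeffs X"
  shows "polyvec (\<lambda>i x. a i x \<oplus> b i x) = vadd (polyvec a) (polyvec b)"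
  unfolding polyvec_def vadd_def using coeffs_closed[OF assms(1)] coeffs_closed[OF assms(2)]
  by (intro ext comb_add[THEN fun_cong]) auto

lemma polyvec_smult:
  assumes "\<And>i. a i \<in> coeffs X" "r \<in> carrier R"
  shows "polyvec (\<lambda>i x. r \<otimes> a i x) = vsmult r (polyvec a)"
  unfolding polyvec_def vsmult_def using coeffs_closed[OF assms(1)] assms(2)
  by (intro ext comb_smult[THEN fun_cong]) auto

lemma polyvec_inj:
  assumes "\<And>i. a i \<in> coeffs X" "\<And>i. b i \<in> coeffs X" "polyvec a = polyvec b" "i < 8"
  shows "a i = b i"
proof
  fix x
  show "a i x = b i x"
    using comb_e_inj[of 8 "\<lambda>i. a i x" "\<lambda>i. b i x" i] coeffs_closed[OF assms(1)] coeffs_closed[OF assms(2)]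
      fun_cong[OF assms(3), of x] assms(4) by (simp add: polyvec_def)
qed

primrec eval_at :: "nat \<Rightarrow> nat \<Rightarrow> (nat \<Rightarrow> 'x \<Rightarrow> 'a) \<Rightarrow> 'x \<Rightarrow> 'a" where
  "eval_at 0 n a = (\<lambda>x. \<zero>)"
| "eval_at (Suc k) n a = (\<lambda>x. p n [^] k \<otimes> a k x \<oplus> eval_at k n a x)"

lemma eval_at_coeffs: "(\<And>i. a i \<in> coeffs X) \<Longrightarrow> eval_at k n a \<in> coeffs X"
  by (induction k) (auto simp: coeffs_zero intro!: coeffs_add coeffs_smult)

text \<open>Replacing \<pi> by its approximation \<open>p n\<close> changes a polynomial vector only
  by multiples of \<open>q n\<close>. Polynomial vectors are thus limits of constants, which is how
  \<open>phi\<close> comes to determine \<open>h\<close> on them.\<close>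

lemma qcong_polyvec:
  assumes "\<And>i. a i \<in> coeffs X"
  shows "qcong n (polyvec a x) (const (eval_at 8 n a) x)"
proof -
  have "qcong n (comb k (\<lambda>i. a i x) e) (eval_at k n a x \<odot>\<^bsub>A\<^esub> e 0)" for k
  proof (induction k)
    case 0
    then show ?case by (simp add: qcong_refl)
  next
    case (Suc k)
    have a: "a k x \<in> carrier R" by (rule coeffs_closed[OF assms])
    have E: "eval_at k n a x \<in> carrier R" using coeffs_closed[OF eval_at_coeffs[OF assms]] .
    have "qcong n (a k x \<odot>\<^bsub>A\<^esub> e k) (a k x \<odot>\<^bsub>A\<^esub> ((p n [^] k) \<odot>\<^bsub>A\<^esub> e 0))"
      using qcong_e[of n 0 k] a by (intro qcong_smult) auto
    moreover have "a k x \<odot>\<^bsub>A\<^esub> ((p n [^] k) \<odot>\<^bsub>A\<^esub> e 0) = (p n [^] k \<otimes> a k x) \<odot>\<^bsub>A\<^esub> e 0"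
      using a by (simp add: A.smult_assoc1[symmetric] m_comm)
    ultimately have "qcong n (a k x \<odot>\<^bsub>A\<^esub> e k \<oplus>\<^bsub>A\<^esub> comb k (\<lambda>i. a i x) e)
      ((p n [^] k \<otimes> a k x) \<odot>\<^bsub>A\<^esub> e 0 \<oplus>\<^bsub>A\<^esub> eval_at k n a x \<odot>\<^bsub>A\<^esub> e 0)"
      using qcong_add Suc by simp
    then show ?case using a E by (simp add: A.smult_l_distr)
  qed
  then show ?thesis by (simp add: polyvec_def const_def)
qed

definition single :: "nat \<Rightarrow> ('x \<Rightarrow> 'a) \<Rightarrow> nat \<Rightarrow> 'x \<Rightarrow> 'a" where
  "single i c = (\<lambda>j x. if j = i then c x else \<zero>)"

lemma single_coeffs: "c \<in> coeffs X \<Longrightarrow> single i c j \<in> coeffs X"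
  by (cases "j = i") (auto simp: single_def coeffs_zero)

lemma polyvec_single: "c \<in> coeffs X \<Longrightarrow> i < 8 \<Longrightarrow> polyvec (single i c) = (\<lambda>x. c x \<odot>\<^bsub>A\<^esub> e i)"
  unfolding polyvec_def single_def by (intro ext comb_single[THEN fun_cong]) auto

lemma push_zero: "push f (\<lambda>_. \<zero>) = (\<lambda>_. \<zero>)"
  by (rule ext) (simp add: push_def)

end

section \<open>The module of a labelled set with operators\<close>

locale operators = transcendental_branch R S \<eta> for R :: "('a, 'b) ring_scheme" (structure) and S \<eta> +
  fixes X :: "'x set" and op :: "nat \<Rightarrow> 'x \<Rightarrow> 'x"
  assumes op_closed: "op i ` X \<subseteq> X"
begin

definition admissible :: "(nat \<Rightarrow> 'x \<Rightarrow> bool) \<Rightarrow> (nat \<Rightarrow> 'x \<Rightarrow> 'a) \<Rightarrow> bool" where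
  "admissible L a \<longleftrightarrow> (\<forall>i. a i \<in> coeffs X) \<and> (\<forall>i\<in>{2,3,4}. a i = push (op i) (a 1)) \<and>
     (\<forall>i x. a i x \<noteq> \<zero> \<longrightarrow> L i x)"

text \<open>Degrees 1 to 4 are tied together by the operators, degrees 5 and 6 carry the labels, and
  the unrestricted degrees 0 and 7 are there to recognise the vectors of degree 0. Taking all
  vectors with an \<open>S\<close>-multiple of this form makes the module pure in \<open>vecs X\<close>.\<close>

definition gmod :: "(nat \<Rightarrow> 'x \<Rightarrow> bool) \<Rightarrow> ('x \<Rightarrow> nat \<Rightarrow> 'a) set" where
  "gmod L = {v \<in> vecs X. \<exists>s\<in>S. \<exists>a. admissible L a \<and> vsmult s v = polyvec a}"

lemma admissible_coeffs: "admissible L a \<Longrightarrow> a i \<in> coeffs X"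
  by (simp add: admissible_def)

lemma admissible_add:
  assumes "admissible L a" "admissible L b" shows "admissible L (\<lambda>i x. a i x \<oplus> b i x)"
  unfolding admissible_def
proof (intro conjI allI ballI impI)
  show "(\<lambda>x. a i x \<oplus> b i x) \<in> coeffs X" for i using assms by (simp add: admissible_def coeffs_add)
  show "(\<lambda>x. a i x \<oplus> b i x) = push (op i) (\<lambda>x. a 1 x \<oplus> b 1 x)" if "i \<in> {2,3,4}" for i
    using assms that push_add[of "a 1" X "b 1" "op i"] by (auto simp: admissible_def)
  show "L i x" if "a i x \<oplus> b i x \<noteq> \<zero>" for i x
    using assms that by (cases "a i x = \<zero>"; cases "b i x = \<zero>") (auto simp: admissible_def)
qed

lemma admissible_smult:
  assumes "admissible L a" "r \<in> carrier R" shows "admissible L (\<lambda>i x. r \<otimes> a i x)"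
  unfolding admissible_def
proof (intro conjI allI ballI impI)
  show "(\<lambda>x. r \<otimes> a i x) \<in> coeffs X" for i using assms by (simp add: admissible_def coeffs_smult)
  show "(\<lambda>x. r \<otimes> a i x) = push (op i) (\<lambda>x. r \<otimes> a 1 x)" if "i \<in> {2,3,4}" for i
    using assms that push_smult[of "a 1" X r "op i"] by (auto simp: admissible_def)
  show "L i x" if "r \<otimes> a i x \<noteq> \<zero>" for i x
    using assms that by (cases "a i x = \<zero>") (auto simp: admissible_def)
qed

lemma gmod_vecs: "v \<in> gmod L \<Longrightarrow> v \<in> vecs X" by (simp add: gmod_def)

lemma gmodE:
  assumes "v \<in> gmod L" obtains s a where "s \<in> S" "admissible L a" "vsmult s v = polyvec a"
  using assms by (auto simp: gmod_def)

lemma gmodI: "v \<in> vecs X \<Longrightarrow> s \<in> S \<Longrightarrow> admissible L a \<Longrightarrow> vsmult s v = polyvec a \<Longrightarrow> v \<in> gmod L"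
  by (auto simp: gmod_def)

lemma polyvec_gmod: "admissible L a \<Longrightarrow> polyvec a \<in> gmod L"
  by (rule gmodI[OF _ S_one]) (auto intro: polyvec_vecs vsmult_one admissible_coeffs)

lemma gmod_smult: assumes "v \<in> gmod L" "r \<in> carrier R" shows "vsmult r v \<in> gmod L"
proof -
  obtain s a where sa: "s \<in> S" "admissible L a" "vsmult s v = polyvec a" by (rule gmodE[OF assms(1)])
  note v = gmod_vecs[OF assms(1)]
  have "vsmult s (vsmult r v) = vsmult r (vsmult s v)"
    using v assms(2) sa(1) by (simp add: vsmult_assoc[symmetric] m_comm)
  also have "\<dots> = polyvec (\<lambda>i x. r \<otimes> a i x)"
    unfolding sa(3) using admissible_coeffs[OF sa(2)] assms(2) by (intro polyvec_smult[symmetric])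
  finally show ?thesis by (intro gmodI[OF vecs_smult[OF v assms(2)] sa(1) admissible_smult[OF sa(2) assms(2)]])
qed

lemma gmod_add: assumes "v \<in> gmod L" "w \<in> gmod L" shows "vadd v w \<in> gmod L"
proof -
  obtain s a where sa: "s \<in> S" "admissible L a" "vsmult s v = polyvec a" by (rule gmodE[OF assms(1)])
  obtain t b where tb: "t \<in> S" "admissible L b" "vsmult t w = polyvec b" by (rule gmodE[OF assms(2)])
  note v = gmod_vecs[OF assms(1)] and w = gmod_vecs[OF assms(2)]
  have "vsmult (s \<otimes> t) (vadd v w) = vadd (vsmult t (vsmult s v)) (vsmult s (vsmult t w))"
    using v w sa(1) tb(1) by (simp add: vsmult_r_distr vsmult_assoc[symmetric] m_comm)
  also have "\<dots> = polyvec (\<lambda>i x. t \<otimes> a i x \<oplus> s \<otimes> b i x)"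
    unfolding sa(3) tb(3) using admissible_coeffs[OF sa(2)] admissible_coeffs[OF tb(2)] sa(1) tb(1)
    by (subst polyvec_add[of _ X]) (auto intro: coeffs_smult simp: polyvec_smult[of _ X])
  finally show ?thesis
    using sa(1) tb(1) by (intro gmodI[OF vecs_add[OF v w] S_mult[OF sa(1) tb(1)]
      admissible_add[OF admissible_smult[OF sa(2)] admissible_smult[OF tb(2)]]]) simp_all
qed

text \<open>The factor \<open>q n\<close> simply joins the multiplier from \<open>S\<close> by which
  membership in \<open>gmod\<close> is tested.\<close>

lemma gmod_divides:
  assumes "v \<in> gmod L" "w \<in> gmod L" "u \<in> vecs X" "v = vadd w (vsmult (q n) u)"
  shows "u \<in> gmod L"
proof -
  note vw = gmod_vecs[OF assms(1)] gmod_vecs[OF assms(2)]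
  have "vsmult (q n) u = vadd (vadd (vsmult (\<ominus> \<one>) w) w) (vsmult (q n) u)"
    using vw(2) vecs_smult[OF assms(3), of "q n"] by (simp add: vadd_minus vadd_zero)
  also have "\<dots> = vadd (vsmult (\<ominus> \<one>) w) v"
    unfolding assms(4) using vw(2) vecs_smult[OF assms(3), of "q n"] vecs_smult[OF vw(2), of "\<ominus> \<one>"]
    by (simp add: vadd_assoc)
  finally have "vsmult (q n) u \<in> gmod L" using gmod_add[OF gmod_smult[OF assms(2), of "\<ominus> \<one>"] assms(1)] by simp
  then obtain s a where sa: "s \<in> S" "admissible L a" "vsmult s (vsmult (q n) u) = polyvec a" by (rule gmodE)
  then have "vsmult (s \<otimes> q n) u = polyvec a" using assms(3) by (simp add: vsmult_assoc)
  then show ?thesis using sa S_mult q_S gmodI[OF assms(3)] by blast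
qed

lemma admissible_single:
  assumes "c \<in> coeffs X" "i \<in> {0, 5, 6, 7}" "\<And>x. c x \<noteq> \<zero> \<Longrightarrow> L i x"
  shows "admissible L (single i c)"
  unfolding admissible_def
proof (intro conjI allI ballI impI)
  show "single i c j \<in> coeffs X" for j using single_coeffs assms by blast
  show "single i c j = push (op j) (single i c 1)" if "j \<in> {2,3,4}" for j
    using that assms(2) by (auto simp: single_def push_zero)
  show "L j x" if "single i c j x \<noteq> \<zero>" for j x
    using that assms(3) by (auto simp: single_def split: if_splits)
qed

text \<open>By independence of the powers of \<pi>, all coefficients below degree 8 vanish where
  \<open>v\<close> does, so labels matter only on the support of \<open>v\<close>. Polynomial
  vectors do not see the degrees from 8 on, hence the separate hypothesis about them.\<close>

lemma gmod_cong:
  assumes "v \<in> gmod L" "\<And>i x. v x \<noteq> \<zero>\<^bsub>A\<^esub> \<Longrightarrow> L i x \<Longrightarrow> L' i x" "\<And>i x. 8 \<le> i \<Longrightarrow> L' i x"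
  shows "v \<in> gmod L'"
proof -
  obtain s a where sa: "s \<in> S" "admissible L a" "vsmult s v = polyvec a" by (rule gmodE[OF assms(1)])
  note a = coeffs_closed[OF admissible_coeffs[OF sa(2)]]
  have "L' i x" if nz: "a i x \<noteq> \<zero>" for i x
  proof (cases "i < 8")
    case True
    have "v x \<noteq> \<zero>\<^bsub>A\<^esub>"
    proof
      assume "v x = \<zero>\<^bsub>A\<^esub>"
      then have "comb 8 (\<lambda>i. a i x) e = \<zero>\<^bsub>A\<^esub>"
        using fun_cong[OF sa(3), of x] sa(1) by (simp add: vsmult_def polyvec_def)
      then show False using e_independent[of 8 "\<lambda>i. a i x" i] a True nz by simp
    qed
    moreover have "L i x" using sa(2) nz by (simp add: admissible_def)
    ultimately show ?thesis by (rule assms(2))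
  next
    case False
    then show ?thesis by (intro assms(3)) simp
  qed
  then have "admissible L' a" using sa(2) by (simp add: admissible_def)
  then show ?thesis using gmodI[OF gmod_vecs[OF assms(1)] sa(1) _ sa(3)] by simp
qed

text \<open>The test vector for the operators: degree 1 is arbitrary and determines degrees 2 to
  4.\<close>

definition chain :: "('x \<Rightarrow> 'a) \<Rightarrow> nat \<Rightarrow> 'x \<Rightarrow> 'a" where
  "chain c = (\<lambda>i. if i = 1 then c else if i \<in> {2,3,4} then push (op i) c else (\<lambda>_. \<zero>))"

lemma admissible_chain:
  assumes "c \<in> coeffs X" "\<And>i x. i \<in> {1,2,3,4} \<Longrightarrow> L i x"
  shows "admissible L (chain c)"
  unfolding admissible_def
proof (intro conjI allI ballI impI)
  show "chain c i \<in> coeffs X" for i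
    using assms(1) push_coeffs[OF assms(1) op_closed] by (simp add: chain_def coeffs_zero)
  show "chain c i = push (op i) (chain c 1)" if "i \<in> {2,3,4}" for i
    using that by (auto simp: chain_def)
  show "L i x" if "chain c i x \<noteq> \<zero>" for i x
    using that assms(2) by (auto simp: chain_def split: if_splits)
qed

end

section \<open>Homomorphisms between the modules of two labellings\<close>

locale gmod_hom = operators R S \<eta> X op
  for R :: "('a, 'b) ring_scheme" (structure) and S \<eta> and X :: "'x set" and op +
  fixes L L' :: "nat \<Rightarrow> 'x \<Rightarrow> bool" and h :: "('x \<Rightarrow> nat \<Rightarrow> 'a) \<Rightarrow> 'x \<Rightarrow> nat \<Rightarrow> 'a"
  assumes L_free: "i \<notin> {5, 6} \<Longrightarrow> L i x"
    and h_closed: "v \<in> gmod L \<Longrightarrow> h v \<in> gmod L'"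
    and h_add: "v \<in> gmod L \<Longrightarrow> w \<in> gmod L \<Longrightarrow> h (vadd v w) = vadd (h v) (h w)"
    and h_smult: "r \<in> carrier R \<Longrightarrow> v \<in> gmod L \<Longrightarrow> h (vsmult r v) = vsmult r (h v)"
begin

text \<open>Purity turns the congruence into \<open>v = w + q n u\<close> with \<open>u\<close> in
  the module itself, where \<open>h\<close> can be applied. In other words, \<open>h\<close> is
  continuous for the \<open>S\<close>-topology.\<close>

lemma h_qcong:
  assumes "v \<in> gmod L" "w \<in> gmod L" "\<And>x. qcong n (v x) (w x)"
  shows "qcong n (h v x) (h w x)"
proof -
  obtain u where u: "u \<in> vecs X" "v = vadd w (vsmult (q n) u)"
    using vecs_divisible[OF gmod_vecs[OF assms(1)] gmod_vecs[OF assms(2)] assms(3)] by blast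
  have ug: "u \<in> gmod L" by (rule gmod_divides[OF assms(1,2) u])
  have "h v = vadd (h w) (vsmult (q n) (h u))"
    unfolding u(2) using assms ug by (simp add: h_add h_smult gmod_smult)
  then have "h v x = h w x \<oplus>\<^bsub>A\<^esub> q n \<odot>\<^bsub>A\<^esub> h u x" by (simp add: vadd_def vsmult_def)
  moreover have "h v x \<in> carrier A" "h w x \<in> carrier A" "h u x \<in> carrier A"
    using assms(1,2) ug by (auto intro!: vecs_closed[of _ X] gmod_vecs[of _ L'] h_closed)
  ultimately show ?thesis by (auto simp: qcong_def)
qed

lemma const_gmod: assumes "c \<in> coeffs X" shows "const c \<in> gmod L"
proof -
  have "const c = polyvec (single 0 c)" using assms by (simp add: polyvec_single const_def)
  then show ?thesis using polyvec_gmod[OF admissible_single[of c 0 L]] assms L_free by simp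
qed

text \<open>Both \<open>c\<close> and its multiple by \<pi>^7 lie in the module. By continuity their
  images again differ by the factor \<pi>^7, and up to multipliers from \<open>S\<close> both images
  have degree at most 7, so the image of the constant has degree 0.\<close>

lemma h_const: assumes "c \<in> coeffs X" shows "\<exists>d\<in>coeffs X. h (const c) = const d"
proof -
  define v w where "v = h (const c)" and "w = h (polyvec (single 7 c))"
  have 7: "polyvec (single 7 c) \<in> gmod L" using polyvec_gmod admissible_single[of c 7 L] assms L_free by simp
  have v: "v \<in> gmod L'" and w: "w \<in> gmod L'" unfolding v_def w_def by (intro h_closed const_gmod assms 7)+
  have shift: "qcong n (w x) ((p n [^] (7::nat)) \<odot>\<^bsub>A\<^esub> v x)" for n x
  proof -
    have "qcong n (polyvec (single 7 c) y) (vsmult (p n [^] (7::nat)) (const c) y)" for y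
    proof -
      have "c y \<odot>\<^bsub>A\<^esub> (p n [^] (7::nat) \<odot>\<^bsub>A\<^esub> e 0) = p n [^] (7::nat) \<odot>\<^bsub>A\<^esub> (c y \<odot>\<^bsub>A\<^esub> e 0)"
        using assms by (simp add: A.smult_assoc1[symmetric] m_comm)
      then show ?thesis using qcong_smult[OF qcong_e[of n 0 7], of "c y"] assms
        by (simp add: polyvec_single vsmult_def const_def)
    qed
    then have "qcong n (w x) (h (vsmult (p n [^] (7::nat)) (const c)) x)"
      unfolding w_def using 7 const_gmod assms by (intro h_qcong gmod_smult) auto
    then show ?thesis using h_smult const_gmod assms by (simp add: v_def vsmult_def)
  qed
  obtain s a where sa: "s \<in> S" "admissible L' a" "vsmult s v = polyvec a" by (rule gmodE[OF v])
  obtain t b where tb: "t \<in> S" "admissible L' b" "vsmult t w = polyvec b" by (rule gmodE[OF w])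
  have vx: "v x \<in> carrier A" "w x \<in> carrier A" for x
    using gmod_vecs[OF v] gmod_vecs[OF w] by auto
  have ab: "a i x \<in> carrier R" "b i x \<in> carrier R" for i x
    by (rule coeffs_closed[OF admissible_coeffs[OF sa(2)]], rule coeffs_closed[OF admissible_coeffs[OF tb(2)]])
  have sv: "s \<odot>\<^bsub>A\<^esub> v x = comb 8 (\<lambda>i. a i x) e" "t \<odot>\<^bsub>A\<^esub> w x = comb 8 (\<lambda>i. b i x) e" for x
    using fun_cong[OF sa(3), of x] fun_cong[OF tb(3), of x] by (simp_all add: vsmult_def polyvec_def)
  have "\<exists>r. r \<in> carrier R \<and> v x = r \<odot>\<^bsub>A\<^esub> e 0" for x
  proof -
    have "a i x = \<zero>" if "1 \<le> i" "i < 8" for i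
      using constant_if_shift_bounded[of 7 "\<lambda>i. a i x" "\<lambda>i. b i x" s t "v x" "w x" i] ab sa(1) tb(1) vx sv shift that
      by simp
    then have "s \<odot>\<^bsub>A\<^esub> v x = comb 1 (\<lambda>i. a i x) e"
      unfolding sv using ab by (intro comb_extend) auto
    then have "s \<odot>\<^bsub>A\<^esub> v x = a 0 x \<odot>\<^bsub>A\<^esub> e 0" using ab by simp
    then show ?thesis using e_pure[OF sa(1) vx(1) ab(1)] by blast
  qed
  then obtain d where d: "\<And>x. d x \<in> carrier R" "\<And>x. v x = d x \<odot>\<^bsub>A\<^esub> e 0" by metis
  \<comment> \<open>Resetting the coefficient where \<open>v\<close> vanishes makes the finiteness
    of its support immediate.\<close>
  define d' where "d' = (\<lambda>x. if v x = \<zero>\<^bsub>A\<^esub> then \<zero> else d x)"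
  obtain F where F: "finite F" "F \<subseteq> X" "\<And>x. x \<notin> F \<Longrightarrow> v x = \<zero>\<^bsub>A\<^esub>" by (rule finsuppE[OF gmod_vecs[OF v]]) blast
  have "d' \<in> coeffs X" by (rule finsuppI[OF _ F(1,2)]) (use d F(3) in \<open>auto simp: d'_def\<close>)
  moreover have "v x = d' x \<odot>\<^bsub>A\<^esub> e 0" for x
    using d(2)[of x] by (cases "v x = \<zero>\<^bsub>A\<^esub>") (simp_all add: d'_def)
  then have "v = const d'" by (auto simp: const_def)
  ultimately show ?thesis using v_def by (intro bexI[of _ d']) simp_all
qed

text \<open>The endomorphism of the free module that \<open>h\<close> induces on the constants;
  outside \<open>coeffs X\<close> its value is arbitrary.\<close>

definition phi :: "('x \<Rightarrow> 'a) \<Rightarrow> 'x \<Rightarrow> 'a" where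
  "phi c = (SOME d. d \<in> coeffs X \<and> h (const c) = const d)"

lemma phi: assumes "c \<in> coeffs X" shows "phi c \<in> coeffs X" "h (const c) = const (phi c)"
proof -
  have "\<exists>d. d \<in> coeffs X \<and> h (const c) = const d" using h_const[OF assms] by blast
  from someI_ex[OF this] show "phi c \<in> coeffs X" "h (const c) = const (phi c)" by (simp_all add: phi_def)
qed

lemma phi_add:
  assumes "c \<in> coeffs X" "d \<in> coeffs X" shows "phi (\<lambda>x. c x \<oplus> d x) = (\<lambda>x. phi c x \<oplus> phi d x)"
proof -
  have "const (phi (\<lambda>x. c x \<oplus> d x)) = const (\<lambda>x. phi c x \<oplus> phi d x)"
    using assms phi phi(2)[OF coeffs_add[OF assms], symmetric] const_gmod h_add
    by (simp add: const_add[of _ X])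
  then show ?thesis by (rule const_inj[of _ X, rotated 2]) (use assms in \<open>auto intro: phi coeffs_add\<close>)
qed

lemma phi_smult:
  assumes "c \<in> coeffs X" "r \<in> carrier R" shows "phi (\<lambda>x. r \<otimes> c x) = (\<lambda>x. r \<otimes> phi c x)"
proof -
  have "const (phi (\<lambda>x. r \<otimes> c x)) = const (\<lambda>x. r \<otimes> phi c x)"
    using assms phi phi(2)[OF coeffs_smult[OF assms], symmetric] const_gmod h_smult
    by (simp add: const_smult[of _ X])
  then show ?thesis by (rule const_inj[of _ X, rotated 2]) (use assms in \<open>auto intro: phi coeffs_smult\<close>)
qed

lemma phi_zero: "phi (\<lambda>_. \<zero>) = (\<lambda>_. \<zero>)"
  using phi_smult[OF coeffs_zero zero_closed] phi(1)[OF coeffs_zero] by (simp cong: if_cong)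

lemma phi_eval_at: "(\<And>i. a i \<in> coeffs X) \<Longrightarrow> phi (eval_at k n a) = eval_at k n (\<lambda>i. phi (a i))"
proof (induction k)
  case (Suc k)
  have "phi (eval_at (Suc k) n a) = (\<lambda>x. phi (\<lambda>x. p n [^] k \<otimes> a k x) x \<oplus> phi (eval_at k n a) x)"
    using Suc by (simp add: phi_add coeffs_smult eval_at_coeffs)
  then show ?case using Suc by (simp add: phi_smult)
qed (simp add: phi_zero)

text \<open>Modulo each \<open>q n\<close> a polynomial vector is a constant, on which
  \<open>h\<close> acts as \<open>phi\<close>. Continuity transfers the congruences to the images,
  and separatedness of the completion turns them into an equality.\<close>

lemma h_polyvec:
  assumes "admissible L a" shows "h (polyvec a) = polyvec (\<lambda>i. phi (a i))"
proof (rule ext, rule qcong_eq)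
  fix x n
  note a = admissible_coeffs[OF assms]
  have pa: "\<And>i. phi (a i) \<in> coeffs X" using phi a by blast
  have "qcong n (h (polyvec a) x) (h (const (eval_at 8 n a)) x)"
    using polyvec_gmod[OF assms] const_gmod eval_at_coeffs[OF a] qcong_polyvec[OF a] by (intro h_qcong) auto
  also have "h (const (eval_at 8 n a)) = const (eval_at 8 n (\<lambda>i. phi (a i)))"
    using phi(2)[OF eval_at_coeffs[OF a]] phi_eval_at[of a 8 n] a by simp
  finally show "qcong n (h (polyvec a) x) (polyvec (\<lambda>i. phi (a i)) x)"
    by (rule qcong_trans) (rule qcong_sym, rule qcong_polyvec, rule pa)
qed

text \<open>By transcendence the coefficients below degree 8 can be read off from the image; the
  multiplier \<open>s\<close> is the one allowed in the definition of \<open>gmod\<close>.\<close>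

lemma phi_admissible:
  assumes "admissible L a"
  shows "\<exists>s\<in>S. \<exists>b. admissible L' b \<and> (\<forall>i<8. b i = (\<lambda>x. s \<otimes> phi (a i) x))"
proof -
  have "polyvec (\<lambda>i. phi (a i)) \<in> gmod L'"
    using h_closed[OF polyvec_gmod[OF assms]] h_polyvec[OF assms] by simp
  then obtain s b where sb: "s \<in> S" "admissible L' b" "vsmult s (polyvec (\<lambda>i. phi (a i))) = polyvec b"
    by (rule gmodE)
  have pa: "\<And>i. phi (a i) \<in> coeffs X" using phi admissible_coeffs[OF assms] by blast
  have "polyvec b = polyvec (\<lambda>i x. s \<otimes> phi (a i) x)"
    using sb pa by (simp add: polyvec_smult[of _ X])
  then have "b i = (\<lambda>x. s \<otimes> phi (a i) x)" if "i < 8" for i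
    using polyvec_inj[of b X "\<lambda>i x. s \<otimes> phi (a i) x" i] admissible_coeffs[OF sb(2)] pa sb(1) that
    by (simp add: coeffs_smult)
  then show ?thesis using sb by blast
qed

text \<open>\<open>chain c\<close> carries \<open>c\<close> in degree 1 and its push-forward in
  degree \<open>i\<close>. The image has the same multiplier \<open>s\<close> in both degrees, so
  the relation valid in the target can be read off and \<open>s\<close> cancelled.\<close>

lemma phi_op:
  assumes "c \<in> coeffs X" "i \<in> {2, 3, 4}"
  shows "phi (push (op i) c) = push (op i) (phi c)"
proof -
  have adm: "admissible L (chain c)" by (rule admissible_chain[OF assms(1)]) (auto intro: L_free)
  obtain s b where sb: "s \<in> S" "admissible L' b" "\<And>i. i < 8 \<Longrightarrow> b i = (\<lambda>x. s \<otimes> phi (chain c i) x)"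
    using phi_admissible[OF adm] by blast
  have "b i = push (op i) (b 1)" using sb(2) assms(2) by (auto simp: admissible_def)
  moreover have "b 1 = (\<lambda>x. s \<otimes> phi c x)" using sb(3)[of 1] by (simp add: chain_def)
  moreover have "b i = (\<lambda>x. s \<otimes> phi (push (op i) c) x)" using sb(3)[of i] assms(2) by (auto simp: chain_def)
  ultimately have "(\<lambda>x. s \<otimes> phi (push (op i) c) x) = (\<lambda>y. s \<otimes> push (op i) (phi c) y)"
    using push_smult[OF phi(1)[OF assms(1)] S_closed[OF sb(1)]] by simp
  then have eq: "s \<otimes> phi (push (op i) c) x = s \<otimes> push (op i) (phi c) x" for x by metis
  have "phi (push (op i) c) \<in> coeffs X" "push (op i) (phi c) \<in> coeffs X"
    using phi push_coeffs op_closed assms(1) by blast+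
  then show ?thesis using S_cancel[OF sb(1) _ _ eq] by (intro ext) simp
qed

text \<open>The test vector has \<open>c\<close> as its only coefficient, in degree
  \<open>i\<close>, where the labels of the source admit it; torsion-freeness disposes of the
  multiplier.\<close>

lemma phi_label:
  assumes "c \<in> coeffs X" "i \<in> {5, 6}" "\<And>x. c x \<noteq> \<zero> \<Longrightarrow> L i x" "phi c x \<noteq> \<zero>"
  shows "L' i x"
proof -
  have adm: "admissible L (single i c)" by (rule admissible_single) (use assms in auto)
  obtain s b where sb: "s \<in> S" "admissible L' b" "\<And>i'. i' < 8 \<Longrightarrow> b i' = (\<lambda>x. s \<otimes> phi (single i c i') x)"
    using phi_admissible[OF adm] by blast
  have "b i = (\<lambda>x. s \<otimes> phi c x)" using sb(3)[of i] assms(2) by (auto simp: single_def)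
  then have "b i x \<noteq> \<zero>" using torsion_free[OF sb(1)] assms(4) phi(1)[OF assms(1)] by auto
  then show ?thesis using sb(2) by (auto simp: admissible_def)
qed

lemma phi_nonzero:
  assumes "inj_on h (gmod L)" "c \<in> coeffs X" "c x \<noteq> \<zero>"
  shows "phi c \<noteq> (\<lambda>_. \<zero>)"
proof
  assume "phi c = (\<lambda>_. \<zero>)"
  then have "h (const c) = h (const (\<lambda>_. \<zero>))"
    using phi(2)[OF assms(2)] phi(2)[OF coeffs_zero] phi_zero by simp
  then have "const c = const (\<lambda>_. \<zero>)"
    by (rule inj_onD[OF assms(1)]) (intro const_gmod assms(2) coeffs_zero)+
  then have "c = (\<lambda>_. \<zero>)" by (rule const_inj[OF assms(2) coeffs_zero])
  then show False using assms(3) by simp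
qed

end

section \<open>Embeddings of modules induced by label-preserving injections\<close>

locale label_embedding = operators R S \<eta> X op
  for R :: "('a, 'b) ring_scheme" (structure) and S \<eta> and X :: "'x set" and op +
  fixes L L' :: "nat \<Rightarrow> 'x \<Rightarrow> bool" and g :: "'x \<Rightarrow> 'x"
  assumes g_inj: "inj_on g X" and g_closed: "g ` X \<subseteq> X"
    and g_op: "i \<in> {2, 3, 4} \<Longrightarrow> x \<in> X \<Longrightarrow> op i (g x) = g (op i x)"
    and g_label: "x \<in> X \<Longrightarrow> L i x \<Longrightarrow> L' i (g x)"
begin

text \<open>Extension by zero along \<open>g\<close>. The default is a parameter because
  coefficients in the ring and vectors over the completion are both lifted.\<close>

definition lift :: "'y \<Rightarrow> ('x \<Rightarrow> 'y) \<Rightarrow> 'x \<Rightarrow> 'y" where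
  "lift z v = (\<lambda>y. if y \<in> g ` X then v (inv_into X g y) else z)"

lemma lift_g [simp]: "x \<in> X \<Longrightarrow> lift z v (g x) = v x"
  using g_inj by (simp add: lift_def)

lemma lift_outside: "y \<notin> g ` X \<Longrightarrow> lift z v y = z" by (simp add: lift_def)

lemma lift_eqI:
  "(\<And>x. x \<in> X \<Longrightarrow> f (g x) = v x) \<Longrightarrow> (\<And>y. y \<notin> g ` X \<Longrightarrow> f y = z) \<Longrightarrow> f = lift z v"
  using g_inj by (intro ext) (auto simp: lift_def)

lemma lift_finsupp: assumes "v \<in> finsupp C z X" "z \<in> C" shows "lift z v \<in> finsupp C z X"
proof -
  obtain F where F: "finite F" "F \<subseteq> X" "\<And>x. x \<notin> F \<Longrightarrow> v x = z" by (rule finsuppE[OF assms(1)]) blast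
  show ?thesis
  proof (rule finsuppI[of _ _ "g ` F"])
    show "lift z v y \<in> C" for y using assms by (auto simp: lift_def finsupp_def)
    show "lift z v y = z" if "y \<notin> g ` F" for y
    proof (cases "y \<in> g ` X")
      case True
      then obtain x where "x \<in> X" "y = g x" by blast
      then show ?thesis using that F(3) by auto
    qed (simp add: lift_def)
  qed (use F g_closed in auto)
qed

lemma lift_vadd: "v \<in> vecs X \<Longrightarrow> w \<in> vecs X \<Longrightarrow> lift \<zero>\<^bsub>A\<^esub> (vadd v w) = vadd (lift \<zero>\<^bsub>A\<^esub> v) (lift \<zero>\<^bsub>A\<^esub> w)"
  by (rule lift_eqI[symmetric]) (auto simp: vadd_def lift_outside)

lemma lift_vsmult: "r \<in> carrier R \<Longrightarrow> lift \<zero>\<^bsub>A\<^esub> (vsmult r v) = vsmult r (lift \<zero>\<^bsub>A\<^esub> v)"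
  by (rule lift_eqI[symmetric]) (auto simp: vsmult_def lift_outside)

lemma lift_polyvec: "lift \<zero>\<^bsub>A\<^esub> (polyvec a) = polyvec (\<lambda>i. lift \<zero> (a i))"
  by (rule lift_eqI[symmetric]) (auto simp: polyvec_def lift_outside intro: comb_zero)

text \<open>As \<open>g\<close> is injective and commutes with the operators, it maps the part of
  the support of \<open>c\<close> over \<open>z\<close> bijectively onto the part of the lifted
  support over \<open>g z\<close>; and no operator leads from the image of \<open>g\<close> to a
  point outside it.\<close>

lemma push_lift:
  assumes "c \<in> coeffs X" "i \<in> {2, 3, 4}"
  shows "push (op i) (lift \<zero> c) = lift \<zero> (push (op i) c)"
proof (rule lift_eqI)
  have supp: "\<exists>x\<in>X. y = g x \<and> c x \<noteq> \<zero>" if "lift \<zero> c y \<noteq> \<zero>" for y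
    using that by (cases "y \<in> g ` X") (auto simp: lift_outside)
  fix z assume z: "z \<in> X"
  have "{y. lift \<zero> c y \<noteq> \<zero> \<and> op i y = g z} = g ` {x. c x \<noteq> \<zero> \<and> op i x = z}"
  proof (intro equalityI subsetI)
    fix y assume "y \<in> {y. lift \<zero> c y \<noteq> \<zero> \<and> op i y = g z}"
    moreover then obtain x where x: "x \<in> X" "y = g x" "c x \<noteq> \<zero>" using supp by blast
    ultimately have "g (op i x) = g z" using g_op assms(2) by auto
    then have "op i x = z" using g_inj x(1) z op_closed[of i] by (auto dest: inj_onD)
    then show "y \<in> g ` {x. c x \<noteq> \<zero> \<and> op i x = z}" using x by blast
  next
    fix y assume "y \<in> g ` {x. c x \<noteq> \<zero> \<and> op i x = z}"
    then obtain x where x: "y = g x" "c x \<noteq> \<zero>" "op i x = z" by blast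
    moreover have "x \<in> X" using x(2) assms(1) by (auto simp: finsupp_def)
    ultimately show "y \<in> {y. lift \<zero> c y \<noteq> \<zero> \<and> op i y = g z}" using g_op assms(2) by auto
  qed
  moreover have sub: "{x. c x \<noteq> \<zero> \<and> op i x = z} \<subseteq> X" using assms(1) by (auto simp: finsupp_def)
  ultimately have "push (op i) (lift \<zero> c) (g z) = finsum R (lift \<zero> c) (g ` {x. c x \<noteq> \<zero> \<and> op i x = z})"
    by (simp add: push_def)
  also have "\<dots> = finsum R (\<lambda>x. lift \<zero> c (g x)) {x. c x \<noteq> \<zero> \<and> op i x = z}"
    using lift_finsupp[OF assms(1) zero_closed] inj_on_subset[OF g_inj sub] by (intro finsum_reindex) auto
  also have "\<dots> = finsum R c {x. c x \<noteq> \<zero> \<and> op i x = z}"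
    using sub assms(1) by (intro finsum_cong') auto
  finally show "push (op i) (lift \<zero> c) (g z) = push (op i) c z" by (simp add: push_def)
next
  fix y assume y: "y \<notin> g ` X"
  show "push (op i) (lift \<zero> c) y = \<zero>"
  proof (rule ccontr)
    assume "push (op i) (lift \<zero> c) y \<noteq> \<zero>"
    then obtain x where x: "lift \<zero> c x \<noteq> \<zero>" "op i x = y" using push_support[of "op i" "lift \<zero> c" y] by auto
    then obtain x' where x': "x' \<in> X" "x = g x'" by (cases "x \<in> g ` X") (auto simp: lift_outside)
    then have "y = g (op i x')" using x(2) g_op[OF assms(2)] by simp
    then show False using y x'(1) op_closed[of i] by blast
  qed
qed

lemma lift_admissible:
  assumes "admissible L a" shows "admissible L' (\<lambda>i. lift \<zero> (a i))"
  unfolding admissible_def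
proof (intro conjI allI ballI impI)
  show "lift \<zero> (a i) \<in> coeffs X" for i by (rule lift_finsupp[OF admissible_coeffs[OF assms] zero_closed])
  show "lift \<zero> (a i) = push (op i) (lift \<zero> (a 1))" if "i \<in> {2, 3, 4}" for i
    using push_lift[OF admissible_coeffs[OF assms] that] assms that by (auto simp: admissible_def)
  fix i x assume nz: "lift \<zero> (a i) x \<noteq> \<zero>"
  then obtain y where y: "y \<in> X" "x = g y" by (cases "x \<in> g ` X") (auto simp: lift_outside)
  then have "L i y" using nz assms by (simp add: admissible_def)
  then show "L' i x" using y g_label by simp
qed

lemma lift_gmod: assumes "v \<in> gmod L" shows "lift \<zero>\<^bsub>A\<^esub> v \<in> gmod L'"
proof -
  obtain s a where sa: "s \<in> S" "admissible L a" "vsmult s v = polyvec a" by (rule gmodE[OF assms])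
  have "vsmult s (lift \<zero>\<^bsub>A\<^esub> v) = polyvec (\<lambda>i. lift \<zero> (a i))"
    by (simp only: lift_vsmult[OF S_closed[OF sa(1)], symmetric] sa(3) lift_polyvec)
  then show ?thesis by (rule gmodI[OF lift_finsupp[OF gmod_vecs[OF assms] A.M.zero_closed] sa(1) lift_admissible[OF sa(2)]])
qed

lemma lift_inj: "inj_on (lift \<zero>\<^bsub>A\<^esub>) (vecs X)"
proof (rule inj_onI, rule ext)
  fix v w x assume vw: "v \<in> vecs X" "w \<in> vecs X" "lift \<zero>\<^bsub>A\<^esub> v = lift \<zero>\<^bsub>A\<^esub> w"
  show "v x = w x"
  proof (cases "x \<in> X")
    case True
    then show ?thesis using fun_cong[OF vw(3), of "g x"] by simp
  next
    case False
    then have "v x = \<zero>\<^bsub>A\<^esub>" "w x = \<zero>\<^bsub>A\<^esub>" using vw(1,2) by (auto simp: finsupp_def)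
    then show ?thesis by simp
  qed
qed

end

section \<open>Supports on sequences\<close>

definition tail_seq :: "(nat \<Rightarrow> 'k) \<Rightarrow> nat \<Rightarrow> 'k" where "tail_seq c = (\<lambda>n. c (Suc n))"
definition drop_second :: "(nat \<Rightarrow> 'k) \<Rightarrow> nat \<Rightarrow> 'k" where "drop_second c = (\<lambda>n. if n = 0 then c 0 else c (Suc n))"
definition evens :: "(nat \<Rightarrow> 'k) \<Rightarrow> nat \<Rightarrow> 'k" where "evens c = (\<lambda>n. c (2 * n))"

text \<open>Even positions hold the first sequence, odd positions the amalgam of the others. Hence
  \<open>n\<close> rounds of \<open>tail_seq\<close> followed by \<open>evens\<close>, and a final
  \<open>evens\<close>, return \<open>a n\<close>.\<close>

function amalgam :: "(nat \<Rightarrow> nat \<Rightarrow> 'k) \<Rightarrow> nat \<Rightarrow> 'k" where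
  "amalgam a n = (if even n then a 0 (n div 2) else amalgam (\<lambda>k. a (Suc k)) (n div 2))"
  by auto
termination by (relation "measure snd") (auto elim: oddE)

declare amalgam.simps [simp del]

lemma evens_amalgam: "evens (amalgam a) = a 0"
  by (rule ext) (simp add: evens_def amalgam.simps)

lemma evens_tail_amalgam: "evens (tail_seq (amalgam a)) = amalgam (\<lambda>k. a (Suc k))"
  by (rule ext) (simp add: evens_def tail_seq_def amalgam.simps[of a])

lemma range_amalgam: "(\<And>k. range (a k) \<subseteq> U) \<Longrightarrow> amalgam a n \<in> U"
proof (induction a n rule: amalgam.induct)
  case (1 a n)
  then show ?case by (subst amalgam.simps) (auto simp: image_subset_iff)
qed

text \<open>The supports \<open>F\<close> behave like those of a linear combination of maps commuting with the
  operators. Any countably many sequences are images of a single one, so their sizes are bounded;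
  above a sequence whose support has maximal size the operators are bijective on supports, and one
  can follow a fixed element of that support.\<close>

lemma map_from_supports:
  fixes F :: "(nat \<Rightarrow> 'k) \<Rightarrow> (nat \<Rightarrow> 'k) set"
  assumes U: "U \<noteq> {}"
    and F: "\<And>c. range c \<subseteq> U \<Longrightarrow> finite (F c) \<and> F c \<noteq> {} \<and> F c \<subseteq> {t. range t \<subseteq> U}"
    and ops: "\<And>c f. range c \<subseteq> U \<Longrightarrow> f \<in> {tail_seq, drop_second, evens} \<Longrightarrow> F (f c) \<subseteq> f ` F c"
    and P: "\<And>c t. range c \<subseteq> U \<Longrightarrow> P (c 0) (c 1) \<Longrightarrow> t \<in> F c \<Longrightarrow> P' (t 0) (t 1)"
    and Q: "\<And>c t. range c \<subseteq> U \<Longrightarrow> Q (c 0) (c 1) \<Longrightarrow> t \<in> F c \<Longrightarrow> Q' (t 0) (t 1)"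
  shows "\<exists>f\<in>U \<rightarrow> U. \<forall>x\<in>U. \<forall>y\<in>U. (P x y \<longrightarrow> P' (f x) (f y)) \<and> (Q x y \<longrightarrow> Q' (f x) (f y))"
proof -
  define X where "X = {c :: nat \<Rightarrow> 'k. range c \<subseteq> U}"
  have opX: "f c \<in> X" if "c \<in> X" "f \<in> {tail_seq, drop_second, evens}" for c f
    using that by (auto simp: X_def tail_seq_def drop_second_def evens_def)
  have FX: "finite (F c)" "F c \<noteq> {}" "F c \<subseteq> X" if "c \<in> X" for c
    using F[of c] that by (auto simp: X_def)
  have sub: "F (f c) \<subseteq> f ` F c" if "c \<in> X" "f \<in> {tail_seq, drop_second, evens}" for c f
    using ops[of c f] that by (simp add: X_def)
  have le: "card (F (f c)) \<le> card (F c)" if "c \<in> X" "f \<in> {tail_seq, drop_second, evens}" for c f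
    using sub[OF that] FX(1)[OF that(1)] card_mono[OF _ sub[OF that]] card_image_le[of "F c" f] by force
  \<comment> \<open>Each \<open>a n\<close> is reached from the amalgam by operators, none of which
    enlarges supports.\<close>
  have le_amalgam: "card (F (a n)) \<le> card (F (amalgam a))" if "\<And>k. a k \<in> X" for a n
    using that
  proof (induction n arbitrary: a)
    case 0
    have "amalgam a \<in> X" using range_amalgam[of a U] 0 by (auto simp: X_def)
    then show ?case using le[of "amalgam a" evens] evens_amalgam[of a] by simp
  next
    case (Suc n)
    have a: "amalgam a \<in> X" using range_amalgam[of a U] Suc.prems by (auto simp: X_def)
    have "card (F (a (Suc n))) \<le> card (F (amalgam (\<lambda>k. a (Suc k))))"
      by (rule Suc.IH) (rule Suc.prems)
    also have "\<dots> = card (F (evens (tail_seq (amalgam a))))" by (simp add: evens_tail_amalgam)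
    also have "\<dots> \<le> card (F (tail_seq (amalgam a)))" by (rule le[OF opX[OF a]]) simp_all
    also have "\<dots> \<le> card (F (amalgam a))" by (rule le[OF a]) simp
    finally show ?case .
  qed
  \<comment> \<open>Otherwise there are sequences with supports beyond every \<open>K\<close>, and
    the support of their amalgam would exceed its own size.\<close>
  have "\<exists>K. \<forall>c\<in>X. card (F c) \<le> K"
  proof (rule ccontr)
    assume "\<not> ?thesis"
    then have "\<forall>K. \<exists>c. c \<in> X \<and> K < card (F c)" by (auto simp: not_le)
    then obtain a where a: "\<And>K. a K \<in> X" "\<And>K. K < card (F (a K))" by metis
    have "card (F (a (card (F (amalgam a))))) \<le> card (F (amalgam a))" by (rule le_amalgam) (rule a(1))
    then show False using a(2)[of "card (F (amalgam a))"] by linarith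
  qed
  then obtain K where K: "\<And>c. c \<in> X \<Longrightarrow> card (F c) \<le> K" by blast
  obtain u where "u \<in> U" using U by blast
  then have "(\<lambda>_. u) \<in> X" by (auto simp: X_def)
  then obtain B where B: "B \<in> X" "\<And>c. c \<in> X \<Longrightarrow> card (F c) \<le> card (F B)"
    using ex_has_greatest_nat[of "\<lambda>c. c \<in> X" "\<lambda>_. u" "\<lambda>c. card (F c)" "Suc K"] K le_imp_less_Suc by auto
  define N where "N = card (F B)"
  \<comment> \<open>If the support of \<open>f c\<close> has the maximal size \<open>N\<close>, then
    the support of \<open>c\<close>, being at least as large, has size \<open>N\<close> too. The
    inclusion \<open>sub\<close> becomes an equality and the operator is injective on the
    support.\<close>
  have bij: "card (F c) = N \<and> f ` F c = F (f c) \<and> inj_on f (F c)"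
    if c: "c \<in> X" "f \<in> {tail_seq, drop_second, evens}" "card (F (f c)) = N" for c f
  proof -
    have N: "card (F c) = N" using le[OF c(1,2)] c(3) B(2)[OF c(1)] by (simp add: N_def)
    have "F (f c) = f ` F c"
      using FX(1)[OF c(1)] N c(3) card_image_le[of "F c" f] by (intro card_seteq sub c(1,2)) auto
    then show ?thesis using N c(3) FX(1)[OF c(1)] by (auto intro: eq_card_imp_inj_on)
  qed
  obtain t0 where t0: "t0 \<in> F B" using FX(2)[OF B(1)] by blast
  have cons: "case_nat x c \<in> X" if "x \<in> U" "c \<in> X" for x c
    using that by (auto simp: X_def image_subset_iff split: nat.splits)
  have tail_seq_cons: "tail_seq (case_nat x c) = c" for x and c :: "nat \<Rightarrow> 'k" by (simp add: tail_seq_def)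
  have drop_second_cons: "drop_second (case_nat x (case_nat y c)) = case_nat x c" for x y and c :: "nat \<Rightarrow> 'k"
    by (rule ext) (simp add: drop_second_def split: nat.splits)
  have b1: "card (F (case_nat x B)) = N" "tail_seq ` F (case_nat x B) = F B" "inj_on tail_seq (F (case_nat x B))"
    if "x \<in> U" for x
    using bij[of "case_nat x B" tail_seq] cons[OF that B(1)] by (auto simp: tail_seq_cons N_def)
  \<comment> \<open>The tail of \<open>x\<close> followed by \<open>B\<close> is \<open>B\<close>,
    so exactly one element of the support lies above \<open>t0\<close>; its first entry is the image
    of \<open>x\<close>.\<close>
  have "\<exists>t. t \<in> F (case_nat x B) \<and> tail_seq t = t0" if "x \<in> U" for x
    using b1(2)[OF that] t0 by (metis imageE)
  then obtain t where t: "\<And>x. x \<in> U \<Longrightarrow> t x \<in> F (case_nat x B)" "\<And>x. x \<in> U \<Longrightarrow> tail_seq (t x) = t0" by metis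
  have tU: "t x 0 \<in> U" if "x \<in> U" for x
    using t(1)[OF that] FX(3)[OF cons[OF that B(1)]] by (auto simp: X_def)
  have "(P x y \<longrightarrow> P' (t x 0) (t y 0)) \<and> (Q x y \<longrightarrow> Q' (t x 0) (t y 0))" if xy: "x \<in> U" "y \<in> U" for x y
  proof -
    \<comment> \<open>Deleting the first or the second entry of \<open>d\<close> leaves
      \<open>y\<close> or \<open>x\<close> in front of \<open>B\<close>. An element \<open>s\<close>
      of its support above \<open>t y\<close> is carried by \<open>drop_second\<close> to an element
      above \<open>t0\<close>, which can only be \<open>t x\<close>; so \<open>s\<close> begins with
      the images of \<open>x\<close> and \<open>y\<close>.\<close>
    define d where "d = case_nat x (case_nat y B)"
    have d: "d \<in> X" "tail_seq d = case_nat y B" "drop_second d = case_nat x B" "d 0 = x" "d 1 = y"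
      using cons xy B(1) by (simp_all add: d_def tail_seq_cons drop_second_cons)
    have "tail_seq ` F d = F (case_nat y B)" "drop_second ` F d = F (case_nat x B)"
      using bij[OF d(1), of tail_seq] bij[OF d(1), of drop_second] b1(1) xy d(2,3) by auto
    moreover then obtain s where s: "s \<in> F d" "tail_seq s = t y" using t(1)[OF xy(2)] by (metis imageE)
    ultimately have "drop_second s \<in> F (case_nat x B)" by blast
    moreover have "tail_seq (drop_second s) = t0"
      unfolding t(2)[OF xy(2), symmetric] s(2)[symmetric] by (simp add: tail_seq_def drop_second_def)
    ultimately have "drop_second s = t x" using inj_onD[OF b1(3)[OF xy(1)]] t xy(1) by metis
    then have "drop_second s 0 = t x 0" by simp
    then have "s 0 = t x 0" "s 1 = t y 0" using fun_cong[OF s(2), of 0] by (simp_all add: tail_seq_def drop_second_def)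
    then show ?thesis using P[of d s] Q[of d s] s(1) d by (auto simp: X_def)
  qed
  then show ?thesis using tU by (intro bexI[of _ "\<lambda>x. t x 0"]) auto
qed

section \<open>Cardinal arithmetic at \<kappa>\<close>

lemma card_of_sequences_ordLeq:
  assumes "natLeq <o \<kappa>" "|sequences_below \<kappa>| \<le>o \<kappa>"
  shows "|{c :: nat \<Rightarrow> 'k. range c \<subseteq> Field (\<kappa> :: 'k rel)}| \<le>o \<kappa>"
proof -
  have wo: "Well_order \<kappa>" "Well_order natLeq"
    using assms(1) natLeq_Well_order by (auto simp: ordLess_def)
  \<comment> \<open>As \<kappa> is uncountable, a proper initial segment has order type \<omega>, so
    countable sequences are among the sequences of length below \<kappa>.\<close>
  then obtain a where a: "a \<in> Field \<kappa>" "natLeq =o Restr \<kappa> (underS \<kappa> a)"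
    using assms(1) ordLess_iff_ordIso_Restr by blast
  obtain f where "BNF_Wellorder_Embedding.iso natLeq (Restr \<kappa> (underS \<kappa> a)) f" using a(2) by (auto simp: ordIso_def)
  then have "bij_betw f UNIV (Field (Restr \<kappa> (underS \<kappa> a)))" by (simp add: BNF_Wellorder_Embedding.iso_def Field_natLeq)
  then have f: "inj f" "range f \<subseteq> underS \<kappa> a" by (auto simp: bij_betw_def Field_def)
  \<comment> \<open>Sequences are re-indexed by the predecessors of \<open>a\<close>; elsewhere the
    value has to be \<open>undefined\<close>, as \<open>Func\<close> requires.\<close>
  define g where "g = (\<lambda>c :: nat \<Rightarrow> 'k. (a, \<lambda>k. if k \<in> underS \<kappa> a then c (inv_into UNIV f k) else undefined))"
  have "inj_on g {c. range c \<subseteq> Field \<kappa>}"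
  proof (rule inj_onI, rule ext)
    fix c d n assume "g c = g d"
    then have "(if f n \<in> underS \<kappa> a then c (inv_into UNIV f (f n)) else undefined)
      = (if f n \<in> underS \<kappa> a then d (inv_into UNIV f (f n)) else undefined)"
      unfolding g_def prod.inject by meson
    moreover have "f n \<in> underS \<kappa> a" using f(2) by blast
    ultimately show "c n = d n" using f(1) by simp
  qed
  moreover have "g ` {c. range c \<subseteq> Field \<kappa>} \<subseteq> sequences_below \<kappa>"
    using a(1) by (auto simp: g_def sequences_below_def Func_def)
  ultimately have "|{c :: nat \<Rightarrow> 'k. range c \<subseteq> Field \<kappa>}| \<le>o |sequences_below \<kappa>|"
    by (intro card_of_ordLeq[THEN iffD1] exI[of _ g] conjI)
  then show ?thesis using assms(2) by (rule ordLeq_transitive)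
qed

lemma infinite_Field: "natLeq <o \<kappa> \<Longrightarrow> infinite (Field \<kappa>)"
  by (metis Field_natLeq card_of_mono2 card_of_ordLeq_infinite infinite_UNIV_nat ordLess_imp_ordLeq)

lemma Pow_nat_ordLeq:
  assumes "natLeq <o \<kappa>" "|sequences_below \<kappa>| \<le>o (\<kappa> :: 'k rel)"
  shows "|Pow (UNIV :: nat set)| \<le>o \<kappa>"
proof -
  obtain u where u: "u \<in> Field \<kappa>" using infinite_Field[OF assms(1)] by (metis finite.emptyI ex_in_conv)
  obtain v where v: "v \<in> Field \<kappa>" "v \<noteq> u"
    using infinite_Field[OF assms(1)] by (metis finite.emptyI finite_insert finite_subset singletonI subsetI)
  define g where "g = (\<lambda>Z n. if n \<in> (Z :: nat set) then u else v)"
  have "inj_on g (Pow UNIV)"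
  proof (rule inj_onI)
    fix Y Z assume eq: "g Y = g Z"
    have "n \<in> Y \<longleftrightarrow> n \<in> Z" for n using fun_cong[OF eq, of n] v(2) by (simp add: g_def split: if_splits)
    then show "Y = Z" by blast
  qed
  moreover have "g ` Pow UNIV \<subseteq> {c. range c \<subseteq> Field \<kappa>}" using u v by (auto simp: g_def)
  ultimately have "|Pow (UNIV :: nat set)| \<le>o |{c :: nat \<Rightarrow> 'k. range c \<subseteq> Field \<kappa>}|"
    by (intro card_of_ordLeq[THEN iffD1] exI[of _ g] conjI)
  then show ?thesis using card_of_sequences_ordLeq[OF assms] by (rule ordLeq_transitive)
qed

text \<open>For finite \<open>D\<close> the union is countable, hence below the uncountable
  \<kappa>; for infinite \<open>D\<close> it is no larger than \<open>D\<close>.\<close>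

lemma card_of_UNION_countable_ordLess:
  assumes "Card_order \<kappa>" "natLeq <o \<kappa>" "|D| <o \<kappa>" "\<And>x. x \<in> D \<Longrightarrow> countable (W x)"
  shows "|\<Union>x\<in>D. W x| <o \<kappa>"
proof -
  have W: "|W x| \<le>o |UNIV :: nat set|" if "x \<in> D" for x
    using assms(4)[OF that] unfolding countable_def by (intro card_of_ordLeq[THEN iffD1]) blast
  show ?thesis
  proof (cases "finite D")
    case True
    then have "countable (\<Union>x\<in>D. W x)" using assms(4) by (intro countable_UN[OF countable_finite]) auto
    then have "|\<Union>x\<in>D. W x| \<le>o |UNIV :: nat set|"
      unfolding countable_def by (intro card_of_ordLeq[THEN iffD1]) blast
    then have "|\<Union>x\<in>D. W x| \<le>o natLeq" using card_of_nat ordLeq_ordIso_trans by blast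
    then show ?thesis using assms(2) ordLeq_ordLess_trans by blast
  next
    case False
    then have "|UNIV :: nat set| \<le>o |D|" by (simp add: infinite_iff_card_of_nat)
    then have "\<forall>x\<in>D. |W x| \<le>o |D|" using W ordLeq_transitive by blast
    then have "|\<Union>x\<in>D. W x| \<le>o |D|"
      using card_of_UNION_ordLeq_infinite[OF False, of D] card_of_refl ordIso_iff_ordLeq by blast
    then show ?thesis using assms(3) ordLeq_ordLess_trans by blast
  qed
qed

section \<open>The space of graphs\<close>

definition edge :: "(unit, unit, 'k) struct \<Rightarrow> 'k \<Rightarrow> 'k \<Rightarrow> bool" where
  "edge T x y = rel_interp T () [x, y]"

definition agree :: "('k \<times> 'k) set \<Rightarrow> (unit, unit, 'k) struct \<Rightarrow> (unit, unit, 'k) struct \<Rightarrow> bool" where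
  "agree D T T' \<longleftrightarrow> (\<forall>(x, y)\<in>D. edge T x y = edge T' x y)"

lemma topspace_bounded_topology:
  fixes \<kappa> :: "'k rel" and I :: "'i set"
  assumes "natLeq <o \<kappa>" shows "topspace (bounded_topology \<kappa> I) = (I \<rightarrow>\<^sub>E UNIV)"
proof -
  have "|{} :: 'i set| <o natLeq"
    using finite_iff_ordLess_natLeq by (metis finite.emptyI)
  then have "|{} :: 'i set| <o \<kappa>" using assms ordLess_transitive by blast
  then have "(I \<rightarrow>\<^sub>E UNIV) \<in> {{x \<in> I \<rightarrow>\<^sub>E UNIV. \<forall>i\<in>D. x i = s i} | D s. D \<subseteq> I \<and> |D| <o \<kappa>}"
    by (intro CollectI exI[of _ "{}"]) auto
  then show ?thesis unfolding bounded_topology_def topology_generated_by_topspace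
    by (intro equalityI Union_upper) auto
qed

lemma topspace_structure_space:
  assumes "natLeq <o \<kappa>" shows "topspace (structure_space \<kappa> L) = structures \<kappa> L"
  unfolding structure_space_def topspace_pullback_topology
  by (auto simp: topspace_bounded_topology[OF assms] code_def)

lemma topspace_graph_space:
  assumes "natLeq <o \<kappa>" shows "topspace (graph_space \<kappa>) = graph_models \<kappa>"
  using topspace_structure_space[OF assms, of graph_lang]
  by (auto simp: graph_space_def graph_models_def topspace_subtopology)

lemma topspace_module_space:
  assumes "natLeq <o \<kappa>" shows "topspace (module_space \<kappa> R) = module_models \<kappa> R"
  using topspace_structure_space[OF assms, of "module_lang R"]
  by (auto simp: module_space_def module_models_def topspace_subtopology)

lemma openin_graph_space_agree:
  assumes "natLeq <o \<kappa>" "D \<subseteq> Field \<kappa> \<times> Field \<kappa>" "|D| <o \<kappa>"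
  shows "openin (graph_space \<kappa>) {T' \<in> graph_models \<kappa>. agree D T T'}"
proof -
  define D' where "D' = (\<lambda>(x, y). [x, y]) ` D"
  define I where "I = tuples \<kappa> (graph_arity graph_lang (Inl ()))"
  define N where "N = {z \<in> I \<rightarrow>\<^sub>E UNIV. \<forall>i\<in>D'. z i = rel_interp T () i}"
  have I: "I = {xs. set xs \<subseteq> Field \<kappa> \<and> length xs = 2}"
    by (simp add: I_def tuples_def graph_arity_def graph_lang_def)
  have D': "D' \<subseteq> I" using assms(2) by (auto simp: D'_def I)
  have "|D'| <o \<kappa>" unfolding D'_def using card_of_image assms(3) ordLeq_ordLess_trans by blast
  then have "openin (bounded_topology \<kappa> I) N" unfolding bounded_topology_def N_def
    using D' by (intro topology_generated_by_Basis CollectI exI[of _ D'] exI[of _ "rel_interp T ()"]) auto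
  moreover have sym: "Inl () \<in> symbols graph_lang" by (auto simp: symbols_def graph_lang_def)
  moreover define Y where "Y = product_topology (\<lambda>i. bounded_topology \<kappa> (tuples \<kappa> (graph_arity graph_lang i))) (symbols (graph_lang))"
  ultimately have O: "openin Y {z \<in> topspace Y. z (Inl ()) \<in> N}"
    unfolding Y_def I_def by (intro openin_continuous_map_preimage[OF continuous_map_product_projection])
  define V where "V = {z \<in> topspace Y. z (Inl ()) \<in> N}"
  have "openin (structure_space \<kappa> graph_lang) (code \<kappa> graph_lang -` V \<inter> structures \<kappa> graph_lang)"
    unfolding structure_space_def openin_pullback_topology using O by (auto simp: V_def Y_def)
  then have "openin (graph_space \<kappa>) (graph_models \<kappa> \<inter> (code \<kappa> graph_lang -` V \<inter> structures \<kappa> graph_lang))"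
    unfolding graph_space_def by (rule openin_subtopology_Int2)
  also have "graph_models \<kappa> \<inter> (code \<kappa> graph_lang -` V \<inter> structures \<kappa> graph_lang) = {T' \<in> graph_models \<kappa>. agree D T T'}"
  proof -
    have "code \<kappa> graph_lang T' \<in> V \<longleftrightarrow> agree D T T'" if "T' \<in> graph_models \<kappa>" for T'
    proof -
      have "T' \<in> structures \<kappa> graph_lang" using that by (simp add: graph_models_def)
      then have top: "code \<kappa> graph_lang T' \<in> topspace Y"
        using topspace_structure_space[OF assms(1), of graph_lang]
        unfolding structure_space_def topspace_pullback_topology Y_def by blast
      have c: "code \<kappa> graph_lang T' (Inl ()) = (\<lambda>xs\<in>I. rel_interp T' () xs)"
        using sym by (simp add: code_def I_def)
      have "code \<kappa> graph_lang T' \<in> V \<longleftrightarrow> (\<forall>i\<in>D'. (\<lambda>xs\<in>I. rel_interp T' () xs) i = rel_interp T () i)"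
        using top by (simp add: V_def N_def c)
      also have "\<dots> \<longleftrightarrow> (\<forall>i\<in>D'. rel_interp T' () i = rel_interp T () i)" using D' by auto
      also have "\<dots> \<longleftrightarrow> agree D T T'" by (auto simp: agree_def edge_def D'_def)
      finally show ?thesis .
    qed
    then show ?thesis by (auto simp: graph_models_def)
  qed
  finally show ?thesis .
qed

lemma openin_graph_spaceI:
  assumes "natLeq <o \<kappa>"
    and "\<And>T. T \<in> graph_models \<kappa> \<Longrightarrow> P T \<Longrightarrow> \<exists>D. D \<subseteq> Field \<kappa> \<times> Field \<kappa> \<and> |D| <o \<kappa> \<and>
      (\<forall>T'\<in>graph_models \<kappa>. agree D T T' \<longrightarrow> P T')"
  shows "openin (graph_space \<kappa>) {T \<in> graph_models \<kappa>. P T}"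
proof (subst openin_subopen, rule ballI)
  fix T assume "T \<in> {T \<in> graph_models \<kappa>. P T}"
  then have T: "T \<in> graph_models \<kappa>" "P T" by auto
  obtain D where D: "D \<subseteq> Field \<kappa> \<times> Field \<kappa>" "|D| <o \<kappa>"
    "\<forall>T'\<in>graph_models \<kappa>. agree D T T' \<longrightarrow> P T'" using assms(2)[OF T] by blast
  have "agree D T T" by (simp add: agree_def)
  then show "\<exists>N. openin (graph_space \<kappa>) N \<and> T \<in> N \<and> N \<subseteq> {T \<in> graph_models \<kappa>. P T}"
    using openin_graph_space_agree[OF assms(1) D(1,2), of T] T D(3)
    by (intro exI[of _ "{T' \<in> graph_models \<kappa>. agree D T T'}"]) auto
qed

text \<open>A subbasic open set restricts fewer than \<open>\<kappa>\<close> values, hence involves fewer than \<open>\<kappa>\<close> edges.\<close>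

lemma continuous_map_if_countably_determined:
  assumes \<kappa>: "Card_order \<kappa>" "natLeq <o \<kappa>"
    and f: "\<And>T. T \<in> graph_models \<kappa> \<Longrightarrow> f T \<in> module_models \<kappa> R"
    and dep: "\<And>T i xs. T \<in> graph_models \<kappa> \<Longrightarrow> i \<in> symbols (module_lang R) \<Longrightarrow>
      xs \<in> tuples \<kappa> (graph_arity (module_lang R) i) \<Longrightarrow>
      \<exists>D. D \<subseteq> Field \<kappa> \<times> Field \<kappa> \<and> countable D \<and> (\<forall>T'\<in>graph_models \<kappa>. agree D T T' \<longrightarrow>
        code \<kappa> (module_lang R) (f T') i xs = code \<kappa> (module_lang R) (f T) i xs)"
  shows "continuous_map (graph_space \<kappa>) (module_space \<kappa> R) f"
  unfolding module_space_def continuous_map_in_subtopology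
proof (intro conjI)
  let ?L = "module_lang R"
  have top: "topspace (graph_space \<kappa>) = graph_models \<kappa>" by (rule topspace_graph_space[OF \<kappa>(2)])
  show "f \<in> topspace (graph_space \<kappa>) \<rightarrow> module_models \<kappa> R" using f top by auto
  show "continuous_map (graph_space \<kappa>) (structure_space \<kappa> ?L) f"
    unfolding structure_space_def
  proof (rule continuous_map_pullback')
    show "topspace (graph_space \<kappa>) \<subseteq> f -` structures \<kappa> ?L" using f top by (auto simp: module_models_def)
    show "continuous_map (graph_space \<kappa>)
      (product_topology (\<lambda>i. bounded_topology \<kappa> (tuples \<kappa> (graph_arity ?L i))) (symbols ?L)) (code \<kappa> ?L \<circ> f)"
      unfolding continuous_map_componentwise
    proof (intro conjI ballI)
      show "(code \<kappa> ?L \<circ> f) ` topspace (graph_space \<kappa>) \<subseteq> extensional (symbols ?L)"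
        by (auto simp: code_def)
      fix i assume i: "i \<in> symbols ?L"
      let ?I = "tuples \<kappa> (graph_arity ?L i)"
      have ext: "code \<kappa> ?L A i \<in> ?I \<rightarrow>\<^sub>E UNIV" for A using i by (simp add: code_def)
      show "continuous_map (graph_space \<kappa>) (bounded_topology \<kappa> ?I) (\<lambda>T. (code \<kappa> ?L \<circ> f) T i)"
        unfolding bounded_topology_def
      proof (rule continuous_on_generated_topo)
        show "(\<lambda>T. (code \<kappa> ?L \<circ> f) T i) ` topspace (graph_space \<kappa>)
          \<subseteq> \<Union> {{x \<in> ?I \<rightarrow>\<^sub>E UNIV. \<forall>i\<in>D. x i = s i} |D s. D \<subseteq> ?I \<and> |D| <o \<kappa>}"
          using ext topspace_bounded_topology[OF \<kappa>(2), of ?I]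
          unfolding bounded_topology_def topology_generated_by_topspace by auto
        fix N assume "N \<in> {{x \<in> ?I \<rightarrow>\<^sub>E (UNIV :: bool set). \<forall>i\<in>D. x i = s i} |D s. D \<subseteq> ?I \<and> |D| <o \<kappa>}"
        then obtain D s where D: "N = {x \<in> ?I \<rightarrow>\<^sub>E UNIV. \<forall>i\<in>D. x i = s i}" "D \<subseteq> ?I" "|D| <o \<kappa>" by blast
        have "(\<lambda>T. (code \<kappa> ?L \<circ> f) T i) -` N \<inter> topspace (graph_space \<kappa>)
          = {T \<in> graph_models \<kappa>. \<forall>xs\<in>D. code \<kappa> ?L (f T) i xs = s xs}"
          using ext by (auto simp: D(1) top)
        moreover have "openin (graph_space \<kappa>) \<dots>"
        proof (rule openin_graph_spaceI[OF \<kappa>(2)])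
          fix T assume T: "T \<in> graph_models \<kappa>" "\<forall>xs\<in>D. code \<kappa> ?L (f T) i xs = s xs"
          have "\<forall>xs\<in>D. \<exists>W. W \<subseteq> Field \<kappa> \<times> Field \<kappa> \<and> countable W \<and> (\<forall>T'\<in>graph_models \<kappa>. agree W T T' \<longrightarrow>
            code \<kappa> ?L (f T') i xs = code \<kappa> ?L (f T) i xs)"
            using dep[OF T(1) i] D(2) by blast
          then obtain W where W: "\<forall>xs\<in>D. W xs \<subseteq> Field \<kappa> \<times> Field \<kappa> \<and> countable (W xs) \<and>
            (\<forall>T'\<in>graph_models \<kappa>. agree (W xs) T T' \<longrightarrow> code \<kappa> ?L (f T') i xs = code \<kappa> ?L (f T) i xs)"
            by (rule bchoice[THEN exE])
          show "\<exists>D'. D' \<subseteq> Field \<kappa> \<times> Field \<kappa> \<and> |D'| <o \<kappa> \<and> (\<forall>T'\<in>graph_models \<kappa>. agree D' T T' \<longrightarrow>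
            (\<forall>xs\<in>D. code \<kappa> ?L (f T') i xs = s xs))"
          proof (intro exI[of _ "\<Union>xs\<in>D. W xs"] conjI ballI impI)
            show "(\<Union>xs\<in>D. W xs) \<subseteq> Field \<kappa> \<times> Field \<kappa>" using W by blast
            show "|\<Union>xs\<in>D. W xs| <o \<kappa>" using W by (intro card_of_UNION_countable_ordLess \<kappa> D(3)) blast
            fix T' xs assume T': "T' \<in> graph_models \<kappa>" "agree (\<Union>xs\<in>D. W xs) T T'" and xs: "xs \<in> D"
            have "agree (W xs) T T'" using T'(2) xs by (auto simp: agree_def)
            then show "code \<kappa> ?L (f T') i xs = s xs" using W T'(1) xs T(2) by metis
          qed
        qed
        ultimately show "openin (graph_space \<kappa>) ((\<lambda>T. (code \<kappa> ?L \<circ> f) T i) -` N \<inter> topspace (graph_space \<kappa>))"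
          by simp
      qed
    qed
  qed
qed

section \<open>The module of a graph\<close>

text \<open>Orbits of \<open>j\<close> that start outside \<open>B\<close> are shifted by one step,
  which pushes them into \<open>B\<close>; all other points stay. The formula is explicit so that
  its dependence on \<open>B\<close> at a given point can be traced.\<close>

lemma bij_betw_iterated:
  assumes j: "inj_on j U" "j ` U \<subseteq> B" and B: "B \<subseteq> U"
  defines "moved \<equiv> \<lambda>k. \<exists>n. \<exists>k'\<in>U - B. (j ^^ n) k' = k"
  shows "bij_betw (\<lambda>k. if moved k then j k else k) U B"
proof (rule bij_betw_imageI)
  let ?g = "\<lambda>k. if moved k then j k else k"
  have step: "moved (j k)" if k: "moved k" for k
  proof -
    obtain n k' where "k' \<in> U - B" "(j ^^ n) k' = k" using k unfolding moved_def by blast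
    then show ?thesis unfolding moved_def by (intro exI[of _ "Suc n"] bexI[of _ k']) simp_all
  qed
  show "inj_on ?g U"
  proof (rule inj_onI)
    fix k l assume kl: "k \<in> U" "l \<in> U" "?g k = ?g l"
    then have "moved k \<longleftrightarrow> moved l" using step by (auto split: if_splits)
    then show "k = l" using kl inj_onD[OF j(1)] by (auto split: if_splits)
  qed
  show "?g ` U = B"
  proof (intro equalityI subsetI)
    fix l assume "l \<in> ?g ` U"
    then obtain k where k: "k \<in> U" "l = ?g k" by blast
    have "k \<in> B" if "\<not> moved k"
      using that k(1) unfolding moved_def by (metis DiffI funpow_0)
    then show "l \<in> B" using k j(2) by auto
  next
    fix l assume l: "l \<in> B"
    show "l \<in> ?g ` U"
    proof (cases "moved l")
      case False
      then show ?thesis using l B by (intro image_eqI[of _ _ l]) auto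
    next
      case True
      then obtain n k where k: "k \<in> U" "k \<notin> B" "(j ^^ n) k = l" unfolding moved_def by blast
      then obtain m where m: "n = Suc m" using l by (cases n) auto
      have "(j ^^ m) k \<in> U" using k(1) j(2) B by (induction m) auto
      moreover have "moved ((j ^^ m) k)" unfolding moved_def using k by blast
      ultimately show ?thesis using k m by (intro image_eqI[of _ _ "(j ^^ m) k"]) auto
    qed
  qed
qed

locale graph_coding = transcendental_branch R S \<eta> for R :: "('a, 'b) ring_scheme" (structure) and S \<eta> +
  fixes \<kappa> :: "'k rel"
  assumes \<kappa>: "Card_order \<kappa>" "natLeq <o \<kappa>"
    and card_sequences: "|{c :: nat \<Rightarrow> 'k. range c \<subseteq> Field \<kappa>}| \<le>o \<kappa>"
    and card_completion: "|carrier completion| \<le>o \<kappa>"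
begin

definition seqs :: "(nat \<Rightarrow> 'k) set" where "seqs = {c. range c \<subseteq> Field \<kappa>}"

text \<open>Indices other than 2, 3 and 4 carry the identity, since the locale asks every operator
  to preserve the sequences.\<close>

definition sop :: "nat \<Rightarrow> (nat \<Rightarrow> 'k) \<Rightarrow> nat \<Rightarrow> 'k" where
  "sop i = (if i = 2 then tail_seq else if i = 3 then drop_second else if i = 4 then evens else id)"

sublocale operators R S \<eta> seqs sop
  by unfold_locales (auto simp: seqs_def sop_def tail_seq_def drop_second_def evens_def)

text \<open>Degree 6 records distinctness because a non-adjacent pair could otherwise collapse to
  one vertex; an adjacent pair cannot, as the target graph is irreflexive.\<close>

definition label :: "(unit, unit, 'k) struct \<Rightarrow> nat \<Rightarrow> (nat \<Rightarrow> 'k) \<Rightarrow> bool" where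
  "label T i d = (if i = 5 then edge T (d 0) (d 1)
     else if i = 6 then d 0 \<noteq> d 1 \<and> \<not> edge T (d 0) (d 1) else True)"

abbreviation M :: "(unit, unit, 'k) struct \<Rightarrow> ((nat \<Rightarrow> 'k) \<Rightarrow> nat \<Rightarrow> 'a) set" where
  "M T \<equiv> gmod (label T)"

text \<open>Constants lie in the module of every graph, so this injection of \<kappa> into the
  modules is the same for all graphs.\<close>

definition point :: "'k \<Rightarrow> (nat \<Rightarrow> 'k) \<Rightarrow> nat \<Rightarrow> 'a" where
  "point k = const (delta (\<lambda>_. k))"

lemma const_coeffs: "k \<in> Field \<kappa> \<Longrightarrow> delta (\<lambda>_. k) \<in> coeffs seqs"
  by (rule delta_coeffs) (auto simp: seqs_def)

lemma one_neq_zero: "\<one> \<noteq> \<zero>" using S_one S_subset by auto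

lemma point_inj: "inj_on point (Field \<kappa>)"
proof (rule inj_onI)
  fix k l assume kl: "k \<in> Field \<kappa>" "l \<in> Field \<kappa>" "point k = point l"
  have "delta (\<lambda>_ :: nat. k) = delta (\<lambda>_. l)"
    by (rule const_inj[OF const_coeffs const_coeffs]) (use kl in \<open>simp_all add: point_def\<close>)
  then have "delta (\<lambda>_ :: nat. k) (\<lambda>_. k) = delta (\<lambda>_ :: nat. l) (\<lambda>_. k)" by (rule fun_cong)
  then show "k = l" using one_neq_zero by (auto simp: delta_def fun_eq_iff split: if_splits)
qed

lemma point_M: "k \<in> Field \<kappa> \<Longrightarrow> point k \<in> M T"
proof -
  assume k: "k \<in> Field \<kappa>"
  have "point k = polyvec (single 0 (delta (\<lambda>_. k)))"
    using const_coeffs[OF k] by (simp add: polyvec_single point_def const_def)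
  then show ?thesis
    using polyvec_gmod[OF admissible_single[of "delta (\<lambda>_. k)" 0 "label T"]] const_coeffs[OF k]
    by (simp add: label_def)
qed

text \<open>Finite supports among at most \<kappa> sequences and at most \<kappa> values bound the
  vectors from above, \<open>point\<close> from below. The bijection chosen from this is fixed once
  for all graphs.\<close>

lemma ex_base: "\<exists>f. bij_betw f (Field \<kappa>) (vecs seqs)"
proof -
  have eq: "|Field \<kappa>| =o \<kappa>" by (rule card_of_Field_ordIso[OF \<kappa>(1)])
  have inf: "infinite (Field \<kappa>)" by (rule infinite_Field[OF \<kappa>(2)])
  have 1: "|seqs| \<le>o |Field \<kappa>|" "|carrier A| \<le>o |Field \<kappa>|"
    using card_sequences card_completion ordLeq_ordIso_trans[OF _ ordIso_symmetric[OF eq]] by (auto simp: seqs_def)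
  have "vecs seqs = {f. finite {x. f x \<noteq> \<zero>\<^bsub>A\<^esub>} \<and> {x. f x \<noteq> \<zero>\<^bsub>A\<^esub>} \<subseteq> seqs \<and> range f \<subseteq> carrier A}"
    by (auto simp: finsupp_def)
  then have "|vecs seqs| \<le>o |Field \<kappa>|" using card_of_finite_support[OF inf 1] by simp
  moreover have "|Field \<kappa>| \<le>o |vecs seqs|"
  proof (intro card_of_ordLeq[THEN iffD1] exI[of _ point] conjI point_inj)
    show "point ` Field \<kappa> \<subseteq> vecs seqs" using gmod_vecs[OF point_M] by blast
  qed
  ultimately show ?thesis by (simp add: card_of_ordIso ordIso_iff_ordLeq)
qed

definition base :: "'k \<Rightarrow> (nat \<Rightarrow> 'k) \<Rightarrow> nat \<Rightarrow> 'a" where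
  "base = (SOME f. bij_betw f (Field \<kappa>) (vecs seqs))"

lemma base: "bij_betw base (Field \<kappa>) (vecs seqs)"
  unfolding base_def by (rule someI_ex[OF ex_base])

definition jump :: "'k \<Rightarrow> 'k" where
  "jump k = inv_into (Field \<kappa>) base (point k)"

lemma jump: assumes "k \<in> Field \<kappa>" shows "jump k \<in> Field \<kappa>" "base (jump k) = point k"
proof -
  have "point k \<in> base ` Field \<kappa>"
    using gmod_vecs[OF point_M[OF assms]] base by (simp add: bij_betw_def)
  then show "jump k \<in> Field \<kappa>" "base (jump k) = point k"
    unfolding jump_def by (rule inv_into_into, rule f_inv_into_f)
qed

lemma jump_inj: "inj_on jump (Field \<kappa>)"
proof (rule inj_onI)
  fix k l assume kl: "k \<in> Field \<kappa>" "l \<in> Field \<kappa>" "jump k = jump l"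
  then have "point k = point l" using jump(2) by metis
  then show "k = l" using inj_onD[OF point_inj] kl by blast
qed

text \<open>The bijection of the Cantor--Bernstein theorem for the inclusion of \<open>M T\<close> in \<open>vecs seqs\<close> and
  \<open>jump\<close>; unlike an arbitrary bijection, it depends on \<open>T\<close> locally.\<close>

definition decode :: "(unit, unit, 'k) struct \<Rightarrow> 'k \<Rightarrow> (nat \<Rightarrow> 'k) \<Rightarrow> nat \<Rightarrow> 'a" where
  "decode T k = base (if \<exists>n. \<exists>k'\<in>Field \<kappa> - {l \<in> Field \<kappa>. base l \<in> M T}. (jump ^^ n) k' = k then jump k else k)"

lemma decode: "bij_betw (decode T) (Field \<kappa>) (M T)"
proof -
  let ?B = "{l \<in> Field \<kappa>. base l \<in> M T}"
  have "jump ` Field \<kappa> \<subseteq> ?B" using jump point_M by auto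
  then have "bij_betw (\<lambda>k. if \<exists>n. \<exists>k'\<in>Field \<kappa> - ?B. (jump ^^ n) k' = k then jump k else k) (Field \<kappa>) ?B"
    by (intro bij_betw_iterated jump_inj) auto
  moreover have "bij_betw base ?B (M T)"
  proof (rule bij_betw_imageI)
    show "inj_on base ?B" using base by (auto simp: bij_betw_def intro: inj_on_subset)
    have "base ` Field \<kappa> = vecs seqs" using base by (simp add: bij_betw_def)
    then show "base ` ?B = M T" using gmod_vecs[of _ "label T"] by (auto simp: image_iff)
  qed
  ultimately show ?thesis using bij_betw_trans unfolding decode_def comp_def by fastforce
qed

section \<open>Transport of the module structure to \<kappa>\<close>

definition encode :: "(unit, unit, 'k) struct \<Rightarrow> ((nat \<Rightarrow> 'k) \<Rightarrow> nat \<Rightarrow> 'a) \<Rightarrow> 'k" where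
  "encode T = inv_into (Field \<kappa>) (decode T)"

lemma decode_M [simp]: "k \<in> Field \<kappa> \<Longrightarrow> decode T k \<in> M T"
  using decode[of T] by (auto simp: bij_betw_def)

lemma encode_Field [simp]: "v \<in> M T \<Longrightarrow> encode T v \<in> Field \<kappa>"
  unfolding encode_def using decode[of T] by (metis bij_betw_def inv_into_into)

lemma decode_encode [simp]: "v \<in> M T \<Longrightarrow> decode T (encode T v) = v"
  unfolding encode_def using decode[of T] by (metis bij_betw_def f_inv_into_f)

lemma encode_decode [simp]: "k \<in> Field \<kappa> \<Longrightarrow> encode T (decode T k) = k"
  unfolding encode_def using decode[of T] by (metis bij_betw_def inv_into_f_f)

lemma decode_inj: "k \<in> Field \<kappa> \<Longrightarrow> l \<in> Field \<kappa> \<Longrightarrow> decode T k = decode T l \<Longrightarrow> k = l"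
  by (metis encode_decode)

text \<open>The language has no relation symbols, so extensionality forces \<open>rel_interp\<close>
  to be \<open>undefined\<close> everywhere.\<close>

definition structure_of :: "(unit, unit, 'k) struct \<Rightarrow> (unit, 'a module_symbol, 'k) struct" where
  "structure_of T = \<lparr>rel_interp = (\<lambda>_. undefined),
     fun_interp = (\<lambda>f\<in>fun_syms (module_lang R). \<lambda>as\<in>tuples \<kappa> (fun_arity (module_lang R) f).
       encode T (case f of Plus \<Rightarrow> vadd (decode T (as ! 0)) (decode T (as ! 1))
                         | Scalar r \<Rightarrow> vsmult r (decode T (as ! 0))))\<rparr>"

lemma structure_of_Plus [simp]:
  "x \<in> Field \<kappa> \<Longrightarrow> y \<in> Field \<kappa> \<Longrightarrow> fun_interp (structure_of T) Plus [x, y] = encode T (vadd (decode T x) (decode T y))"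
  by (simp add: structure_of_def module_lang_def tuples_def)

lemma structure_of_Scalar [simp]:
  "r \<in> carrier R \<Longrightarrow> x \<in> Field \<kappa> \<Longrightarrow> fun_interp (structure_of T) (Scalar r) [x] = encode T (vsmult r (decode T x))"
  by (simp add: structure_of_def module_lang_def tuples_def)

lemma tuples_1: "xs \<in> tuples \<kappa> (Suc 0) \<longleftrightarrow> (\<exists>x\<in>Field \<kappa>. xs = [x])"
  by (auto simp: tuples_def length_Suc_conv)

lemma tuples_2: "xs \<in> tuples \<kappa> 2 \<longleftrightarrow> (\<exists>x\<in>Field \<kappa>. \<exists>y\<in>Field \<kappa>. xs = [x, y])"
  by (auto simp: tuples_def length_Suc_conv numeral_2_eq_2)

lemma structure_of_structures: "structure_of T \<in> structures \<kappa> (module_lang R)"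
proof -
  have "fun_interp (structure_of T) f as \<in> Field \<kappa>"
    if f: "f \<in> fun_syms (module_lang R)" "as \<in> tuples \<kappa> (fun_arity (module_lang R) f)" for f as
  proof (cases f)
    case Plus
    then obtain x y where "x \<in> Field \<kappa>" "y \<in> Field \<kappa>" "as = [x, y]"
      using f(2) by (auto simp: module_lang_def tuples_2)
    then show ?thesis using Plus by (simp add: gmod_add)
  next
    case (Scalar r)
    then obtain x where "x \<in> Field \<kappa>" "as = [x]" "r \<in> carrier R"
      using f by (auto simp: module_lang_def tuples_1)
    then show ?thesis using Scalar by (simp add: gmod_smult)
  qed
  then have "fun_interp (structure_of T) \<in> (\<Pi>\<^sub>E f\<in>fun_syms (module_lang R).
    tuples \<kappa> (fun_arity (module_lang R) f) \<rightarrow>\<^sub>E Field \<kappa>)"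
    by (intro PiE_I) (simp_all add: structure_of_def)
  then show ?thesis by (simp add: structures_def) (simp add: structure_of_def module_lang_def)
qed

lemma zero_M: "(\<lambda>_. \<zero>\<^bsub>A\<^esub>) \<in> M T"
proof -
  obtain k where "k \<in> Field \<kappa>" using infinite_Field[OF \<kappa>(2)] by (metis finite.emptyI ex_in_conv)
  then have "vadd (vsmult (\<ominus> \<one>) (point k)) (point k) \<in> M T" by (intro gmod_add gmod_smult point_M) auto
  then show ?thesis using vadd_minus[OF gmod_vecs[OF point_M[OF \<open>k \<in> Field \<kappa>\<close>]]] by simp
qed

lemma decode_vecs [simp]: "k \<in> Field \<kappa> \<Longrightarrow> decode T k \<in> vecs seqs"
  by (rule gmod_vecs[OF decode_M])

lemma module_structure_of: "module R (struct_module \<kappa> (encode T (\<lambda>_. \<zero>\<^bsub>A\<^esub>)) (structure_of T))"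
proof -
  note [simp] = gmod_add gmod_smult zero_M
  let ?N = "struct_module \<kappa> (encode T (\<lambda>_. \<zero>\<^bsub>A\<^esub>)) (structure_of T)"
  have [simp]: "carrier ?N = Field \<kappa>" "\<zero>\<^bsub>?N\<^esub> = encode T (\<lambda>_. \<zero>\<^bsub>A\<^esub>)"
    by (simp_all add: struct_module_def)
  have [simp]: "x \<oplus>\<^bsub>?N\<^esub> y = encode T (vadd (decode T x) (decode T y))" if "x \<in> Field \<kappa>" "y \<in> Field \<kappa>" for x y
    using that by (simp add: struct_module_def)
  have [simp]: "r \<odot>\<^bsub>?N\<^esub> x = encode T (vsmult r (decode T x))" if "r \<in> carrier R" "x \<in> Field \<kappa>" for r x
    using that by (simp add: struct_module_def)
  have scalar: "r \<odot>\<^bsub>?N\<^esub> x \<in> carrier ?N" "\<one> \<odot>\<^bsub>?N\<^esub> x = x"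
    "r \<odot>\<^bsub>?N\<^esub> (x \<oplus>\<^bsub>?N\<^esub> y) = r \<odot>\<^bsub>?N\<^esub> x \<oplus>\<^bsub>?N\<^esub> r \<odot>\<^bsub>?N\<^esub> y"
    "(r \<oplus> s) \<odot>\<^bsub>?N\<^esub> x = r \<odot>\<^bsub>?N\<^esub> x \<oplus>\<^bsub>?N\<^esub> s \<odot>\<^bsub>?N\<^esub> x"
    "(r \<otimes> s) \<odot>\<^bsub>?N\<^esub> x = r \<odot>\<^bsub>?N\<^esub> (s \<odot>\<^bsub>?N\<^esub> x)"
    if "r \<in> carrier R" "s \<in> carrier R" "x \<in> carrier ?N" "y \<in> carrier ?N" for r s x y
    using that vsmult_r_distr[of r "decode T x" seqs "decode T y"] vsmult_l_distr[of r s "decode T x" seqs]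
      vsmult_assoc[of r s "decode T x" seqs] by (simp_all add: vsmult_one[of _ seqs])
  have "abelian_group ?N"
  proof (rule abelian_groupI)
    fix x assume x: "x \<in> carrier ?N"
    then show "\<exists>y\<in>carrier ?N. y \<oplus>\<^bsub>?N\<^esub> x = \<zero>\<^bsub>?N\<^esub>"
      by (intro bexI[of _ "encode T (vsmult (\<ominus> \<one>) (decode T x))"]) (simp_all add: vadd_minus[of _ seqs])
    show "\<zero>\<^bsub>?N\<^esub> \<oplus>\<^bsub>?N\<^esub> x = x" using x by (simp add: vadd_zero[of _ seqs])
    fix y assume y: "y \<in> carrier ?N"
    show "x \<oplus>\<^bsub>?N\<^esub> y \<in> carrier ?N" using x y by simp
    show "x \<oplus>\<^bsub>?N\<^esub> y = y \<oplus>\<^bsub>?N\<^esub> x" using x y vadd_commute[of "decode T x" seqs "decode T y"] by simp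
    fix z assume z: "z \<in> carrier ?N"
    show "x \<oplus>\<^bsub>?N\<^esub> y \<oplus>\<^bsub>?N\<^esub> z = x \<oplus>\<^bsub>?N\<^esub> (y \<oplus>\<^bsub>?N\<^esub> z)"
      using x y z vadd_assoc[of "decode T x" seqs "decode T y" "decode T z"] by simp
  qed simp
  then show ?thesis using scalar by (intro moduleI is_cring) (auto simp: vsmult_one[of _ seqs])
qed

lemma structure_of_models: "structure_of T \<in> module_models \<kappa> R"
  using structure_of_structures module_structure_of by (auto simp: module_models_def)

section \<open>Embeddings of graphs and embeddings of modules\<close>

lemma embedding_module_iff:
  "embedding \<kappa> (module_lang R) (structure_of T) (structure_of V) x \<longleftrightarrow>
    x \<in> Field \<kappa> \<rightarrow> Field \<kappa> \<and> inj_on x (Field \<kappa>) \<and>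
    (\<forall>k\<in>Field \<kappa>. \<forall>l\<in>Field \<kappa>. x (encode T (vadd (decode T k) (decode T l)))
      = encode V (vadd (decode V (x k)) (decode V (x l)))) \<and>
    (\<forall>r\<in>carrier R. \<forall>k\<in>Field \<kappa>. x (encode T (vsmult r (decode T k))) = encode V (vsmult r (decode V (x k))))"
  (is "?L \<longleftrightarrow> ?R")
proof
  assume L: ?L
  then have x: "x \<in> Field \<kappa> \<rightarrow> Field \<kappa>" "inj_on x (Field \<kappa>)" by (simp_all add: embedding_def)
  have f: "x (fun_interp (structure_of T) f as) = fun_interp (structure_of V) f (map x as)"
    if "f \<in> fun_syms (module_lang R)" "as \<in> tuples \<kappa> (fun_arity (module_lang R) f)" for f as
    using L that by (simp add: embedding_def)
  show ?R
  proof (intro conjI x ballI)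
    fix k l assume kl: "k \<in> Field \<kappa>" "l \<in> Field \<kappa>"
    then show "x (encode T (vadd (decode T k) (decode T l))) = encode V (vadd (decode V (x k)) (decode V (x l)))"
      using f[of Plus "[k, l]"] x(1) by (auto simp: module_lang_def tuples_2 Pi_def)
  next
    fix r k assume "r \<in> carrier R" "k \<in> Field \<kappa>"
    then show "x (encode T (vsmult r (decode T k))) = encode V (vsmult r (decode V (x k)))"
      using f[of "Scalar r" "[k]"] x(1) by (auto simp: module_lang_def tuples_1 Pi_def)
  qed
next
  assume R: ?R
  then have x: "\<And>k. k \<in> Field \<kappa> \<Longrightarrow> x k \<in> Field \<kappa>" by auto
  have "x (fun_interp (structure_of T) f as) = fun_interp (structure_of V) f (map x as)"
    if f: "f \<in> fun_syms (module_lang R)" "as \<in> tuples \<kappa> (fun_arity (module_lang R) f)" for f as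
  proof (cases f)
    case Plus
    then obtain k l where "k \<in> Field \<kappa>" "l \<in> Field \<kappa>" "as = [k, l]"
      using f(2) by (auto simp: module_lang_def tuples_2)
    then show ?thesis using Plus R x by simp
  next
    case (Scalar r)
    then obtain k where "k \<in> Field \<kappa>" "as = [k]" "r \<in> carrier R"
      using f by (auto simp: module_lang_def tuples_1)
    then show ?thesis using Scalar R x by simp
  qed
  then show ?L using R by (simp add: embedding_def) (simp add: module_lang_def)
qed

lemma embedding_graph_iff:
  "embedding \<kappa> graph_lang T V x \<longleftrightarrow> x \<in> Field \<kappa> \<rightarrow> Field \<kappa> \<and> inj_on x (Field \<kappa>) \<and>
    (\<forall>k\<in>Field \<kappa>. \<forall>l\<in>Field \<kappa>. edge T k l = edge V (x k) (x l))"
  unfolding embedding_def graph_lang_def edge_def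
  by (auto simp: tuples_2)

lemma edge_irrefl: "T \<in> graph_models \<kappa> \<Longrightarrow> k \<in> Field \<kappa> \<Longrightarrow> \<not> edge T k k"
  by (auto simp: graph_models_def edge_def)

text \<open>Applying \<open>x\<close> entrywise commutes with the operators, since these only select
  positions, and it preserves the labels because \<open>x\<close> preserves adjacency, non-adjacency
  and distinctness. The induced map on vectors is \<open>lift\<close>.\<close>

lemma graph_embedding_imp_module_embedding:
  assumes "embeddable \<kappa> graph_lang T V"
  shows "embeddable \<kappa> (module_lang R) (structure_of T) (structure_of V)"
proof -
  obtain x where "embedding \<kappa> graph_lang T V x" using assms by (auto simp: embeddable_def)
  then have x: "\<And>k. k \<in> Field \<kappa> \<Longrightarrow> x k \<in> Field \<kappa>" "inj_on x (Field \<kappa>)"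
    "\<And>k l. k \<in> Field \<kappa> \<Longrightarrow> l \<in> Field \<kappa> \<Longrightarrow> edge T k l = edge V (x k) (x l)"
    by (auto simp: embedding_graph_iff)
  define g where "g = (\<lambda>c :: nat \<Rightarrow> 'k. \<lambda>n. x (c n))"
  interpret label_embedding R S \<eta> seqs sop "label T" "label V" g
  proof unfold_locales
    show "inj_on g seqs"
    proof (rule inj_onI, rule ext)
      fix c d n assume cd: "c \<in> seqs" "d \<in> seqs" "g c = g d"
      have "x (c n) = x (d n)" using fun_cong[OF cd(3), of n] by (simp add: g_def)
      moreover have "c n \<in> Field \<kappa>" "d n \<in> Field \<kappa>" using cd(1,2) by (auto simp: seqs_def)
      ultimately show "c n = d n" using x(2) by (simp add: inj_on_eq_iff)
    qed
    show "g ` seqs \<subseteq> seqs" using x(1) by (auto simp: g_def seqs_def)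
    show "sop i (g c) = g (sop i c)" if "i \<in> {2, 3, 4}" for i c
      by (auto simp: sop_def g_def tail_seq_def drop_second_def evens_def)
    show "label V i (g c)" if "c \<in> seqs" "label T i c" for c i
    proof -
      have c: "c 0 \<in> Field \<kappa>" "c 1 \<in> Field \<kappa>" using that(1) by (auto simp: seqs_def)
      then show ?thesis using that(2) x(3)[OF c] inj_on_eq_iff[OF x(2) c] by (auto simp: label_def g_def)
    qed
  qed
  define y where "y = (\<lambda>k. encode V (lift \<zero>\<^bsub>A\<^esub> (decode T k)))"
  have dy: "decode V (y k) = lift \<zero>\<^bsub>A\<^esub> (decode T k)" if "k \<in> Field \<kappa>" for k
    using that by (simp add: y_def lift_gmod)
  have yF: "y k \<in> Field \<kappa>" if "k \<in> Field \<kappa>" for k using that by (simp add: y_def lift_gmod)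
  have "embedding \<kappa> (module_lang R) (structure_of T) (structure_of V) y"
    unfolding embedding_module_iff
  proof (intro conjI ballI)
    show "y \<in> Field \<kappa> \<rightarrow> Field \<kappa>" using yF by auto
    show "inj_on y (Field \<kappa>)"
    proof (rule inj_onI)
      fix k l assume kl: "k \<in> Field \<kappa>" "l \<in> Field \<kappa>" "y k = y l"
      then have "lift \<zero>\<^bsub>A\<^esub> (decode T k) = lift \<zero>\<^bsub>A\<^esub> (decode T l)" using dy by metis
      then have "decode T k = decode T l" using inj_onD[OF lift_inj] kl decode_vecs by blast
      then show "k = l" using decode_inj kl by blast
    qed
  next
    fix k l assume kl: "k \<in> Field \<kappa>" "l \<in> Field \<kappa>"
    then show "y (encode T (vadd (decode T k) (decode T l))) = encode V (vadd (decode V (y k)) (decode V (y l)))"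
      unfolding dy[OF kl(1)] dy[OF kl(2)] by (simp add: y_def gmod_add lift_vadd)
  next
    fix r k assume r: "r \<in> carrier R" and k: "k \<in> Field \<kappa>"
    then show "y (encode T (vsmult r (decode T k))) = encode V (vsmult r (decode V (y k)))"
      unfolding dy[OF k] by (simp add: y_def gmod_smult lift_vsmult)
  qed
  then show ?thesis by (auto simp: embeddable_def)
qed

text \<open>Read through \<open>encode\<close> and \<open>decode\<close>, the embedding is an
  injective homomorphism of the modules, so that \<open>phi\<close> is available together with its
  compatibility with operators and labels.\<close>

lemma module_embedding_imp_graph_embedding:
  assumes T: "T \<in> graph_models \<kappa>" and V: "V \<in> graph_models \<kappa>"
    and emb: "embeddable \<kappa> (module_lang R) (structure_of T) (structure_of V)"
  shows "embeddable \<kappa> graph_lang T V"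
proof -
  obtain x where "embedding \<kappa> (module_lang R) (structure_of T) (structure_of V) x"
    using emb by (auto simp: embeddable_def)
  then have x: "\<And>k. k \<in> Field \<kappa> \<Longrightarrow> x k \<in> Field \<kappa>" "inj_on x (Field \<kappa>)"
    "\<And>k l. k \<in> Field \<kappa> \<Longrightarrow> l \<in> Field \<kappa> \<Longrightarrow> x (encode T (vadd (decode T k) (decode T l)))
      = encode V (vadd (decode V (x k)) (decode V (x l)))"
    "\<And>r k. r \<in> carrier R \<Longrightarrow> k \<in> Field \<kappa> \<Longrightarrow> x (encode T (vsmult r (decode T k))) = encode V (vsmult r (decode V (x k)))"
    unfolding embedding_module_iff by auto
  define h where "h = (\<lambda>v. decode V (x (encode T v)))"
  interpret gmod_hom R S \<eta> seqs sop "label T" "label V" h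
  proof unfold_locales
    show "label T i c" if "i \<notin> {5, 6}" for i c using that by (simp add: label_def)
    show "h v \<in> M V" if "v \<in> M T" for v using that x(1) by (simp add: h_def)
    show "h (vadd v w) = vadd (h v) (h w)" if "v \<in> M T" "w \<in> M T" for v w
      using that x(1) x(3)[of "encode T v" "encode T w"] by (simp add: h_def gmod_add)
    show "h (vsmult r v) = vsmult r (h v)" if "r \<in> carrier R" "v \<in> M T" for r v
      using that x(1) x(4)[of r "encode T v"] by (simp add: h_def gmod_smult)
  qed
  have h_inj: "inj_on h (M T)"
  proof (rule inj_onI)
    fix v w assume vw: "v \<in> M T" "w \<in> M T" "h v = h w"
    then have "x (encode T v) = x (encode T w)" using decode_inj x(1) encode_Field by (metis h_def)
    then have "encode T v = encode T w" using inj_onD[OF x(2)] vw by simp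
    then show "v = w" using vw decode_encode by metis
  qed
  \<comment> \<open>The supports of the images of the basis vectors. Injectivity makes them
    nonempty, \<open>phi_op\<close> relates them along the operators, and \<open>phi_label\<close>
    gives the two conditions on the first two entries.\<close>
  define F where "F = (\<lambda>c. {t. phi (delta c) t \<noteq> \<zero>})"
  have d: "delta c \<in> coeffs seqs" if "range c \<subseteq> Field \<kappa>" for c
    using that by (intro delta_coeffs) (simp add: seqs_def)
  have "\<exists>f\<in>Field \<kappa> \<rightarrow> Field \<kappa>. \<forall>k\<in>Field \<kappa>. \<forall>l\<in>Field \<kappa>. (edge T k l \<longrightarrow> edge V (f k) (f l)) \<and>
    (k \<noteq> l \<and> \<not> edge T k l \<longrightarrow> f k \<noteq> f l \<and> \<not> edge V (f k) (f l))"
  proof (rule map_from_supports[of _ F])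
    show "Field \<kappa> \<noteq> {}" using infinite_Field[OF \<kappa>(2)] by auto
  next
    fix c :: "nat \<Rightarrow> 'k" assume c: "range c \<subseteq> Field \<kappa>"
    have "phi (delta c) \<noteq> (\<lambda>_. \<zero>)"
      by (rule phi_nonzero[OF h_inj d[OF c], of c]) (simp add: delta_def one_neq_zero)
    then show "finite (F c) \<and> F c \<noteq> {} \<and> F c \<subseteq> {t. range t \<subseteq> Field \<kappa>}"
      using phi(1)[OF d[OF c]] by (auto simp: F_def finsupp_def seqs_def)
    have "F (sop i c) \<subseteq> sop i ` F c" if i: "i \<in> {2, 3, 4}" for i
    proof
      fix t assume "t \<in> F (sop i c)"
      then have "push (sop i) (phi (delta c)) t \<noteq> \<zero>"
        using phi_op[OF d[OF c] i] by (simp add: F_def push_delta)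
      from push_support[OF this] show "t \<in> sop i ` F c" by (auto simp: F_def)
    qed
    from this[of 2] this[of 3] this[of 4]
    show "F (f c) \<subseteq> f ` F c" if "f \<in> {tail_seq, drop_second, evens}" for f
      using that by (auto simp: sop_def)
    fix t assume t: "t \<in> F c"
    have lab: "label V i t" if "i \<in> {5, 6}" "label T i c" for i
    proof (rule phi_label[OF d[OF c] that(1)])
      show "label T i y" if "delta c y \<noteq> \<zero>" for y
        using that \<open>label T i c\<close> by (auto simp: delta_def split: if_splits)
      show "phi (delta c) t \<noteq> \<zero>" using t by (simp add: F_def)
    qed
    show "edge V (t 0) (t 1)" if "edge T (c 0) (c 1)" using lab[of 5] that by (simp add: label_def)
    show "t 0 \<noteq> t 1 \<and> \<not> edge V (t 0) (t 1)" if "c 0 \<noteq> c 1 \<and> \<not> edge T (c 0) (c 1)"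
      using lab[of 6] that by (simp add: label_def)
  qed
  then obtain f where f: "\<And>k. k \<in> Field \<kappa> \<Longrightarrow> f k \<in> Field \<kappa>"
    "\<And>k l. k \<in> Field \<kappa> \<Longrightarrow> l \<in> Field \<kappa> \<Longrightarrow> edge T k l \<Longrightarrow> edge V (f k) (f l)"
    "\<And>k l. k \<in> Field \<kappa> \<Longrightarrow> l \<in> Field \<kappa> \<Longrightarrow> k \<noteq> l \<Longrightarrow> \<not> edge T k l \<Longrightarrow> f k \<noteq> f l \<and> \<not> edge V (f k) (f l)"
    by (auto simp: Pi_iff)
  have "embedding \<kappa> graph_lang T V f"
    unfolding embedding_graph_iff
  proof (intro conjI ballI)
    show "f \<in> Field \<kappa> \<rightarrow> Field \<kappa>" using f(1) by auto
    show "inj_on f (Field \<kappa>)"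
    proof (rule inj_onI, rule ccontr)
      fix k l assume kl: "k \<in> Field \<kappa>" "l \<in> Field \<kappa>" "f k = f l" "k \<noteq> l"
      show False
        using f(2)[OF kl(1,2)] f(3)[OF kl(1,2,4)] edge_irrefl[OF V f(1)[OF kl(1)]] kl(3) by auto
    qed
    show "edge T k l = edge V (f k) (f l)" if kl: "k \<in> Field \<kappa>" "l \<in> Field \<kappa>" for k l
    proof (cases "k = l")
      case True
      then show ?thesis using edge_irrefl T V kl f(1) by simp
    next
      case False
      then show ?thesis using f(2,3) kl by blast
    qed
  qed
  then show ?thesis by (auto simp: embeddable_def)
qed

section \<open>Continuity\<close>

text \<open>The pairs whose adjacency decides \<open>decode T k\<close>. Whether \<open>k\<close> is
  shifted depends on membership of \<open>base l\<close> in \<open>M T\<close> for the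
  \<open>l\<close> on the backward orbit of \<open>k\<close>, and that in turn only on the first two
  entries of the sequences in the support of \<open>base l\<close>.\<close>

definition depends :: "'k \<Rightarrow> ('k \<times> 'k) set" where
  "depends k = (\<Union>n. \<Union>l\<in>{l \<in> Field \<kappa>. (jump ^^ n) l = k}. (\<lambda>d. (d 0, d 1)) ` {d. base l d \<noteq> \<zero>\<^bsub>A\<^esub>})"

lemma base_vecs: "l \<in> Field \<kappa> \<Longrightarrow> base l \<in> vecs seqs"
  using base by (auto simp: bij_betw_def)

lemma depends_subset: "depends k \<subseteq> Field \<kappa> \<times> Field \<kappa>"
proof
  fix e assume "e \<in> depends k"
  then obtain l d where ld: "l \<in> Field \<kappa>" "base l d \<noteq> \<zero>\<^bsub>A\<^esub>" "e = (d 0, d 1)" by (auto simp: depends_def)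
  then have "d \<in> seqs" using base_vecs[OF ld(1)] by (auto simp: finsupp_def)
  then show "e \<in> Field \<kappa> \<times> Field \<kappa>" using ld(3) by (auto simp: seqs_def)
qed

text \<open>As \<open>jump\<close> is injective, each \<open>n\<close> contributes at most one
  \<open>l\<close>, and the support of \<open>base l\<close> is finite.\<close>

lemma countable_depends: "countable (depends k)"
  unfolding depends_def
proof (intro countable_UN countable_image)
  fix n
  have jump_pow: "(jump ^^ n) l \<in> Field \<kappa>" if "l \<in> Field \<kappa>" for l n
    using that jump(1) by (induction n) auto
  have "l = l'" if "l \<in> Field \<kappa>" "l' \<in> Field \<kappa>" "(jump ^^ n) l = (jump ^^ n) l'" for l l'
    using that
  proof (induction n)
    case (Suc n)
    then show ?case using inj_onD[OF jump_inj] jump_pow by simp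
  qed simp
  then have "{l \<in> Field \<kappa>. (jump ^^ n) l = k} = {} \<or> (\<exists>l. {l \<in> Field \<kappa>. (jump ^^ n) l = k} = {l})" by blast
  then show "countable {l \<in> Field \<kappa>. (jump ^^ n) l = k}" by (elim disjE exE) (simp_all only: countable_empty countable_insert)
  fix l assume "l \<in> {l \<in> Field \<kappa>. (jump ^^ n) l = k}"
  then show "countable {d. base l d \<noteq> \<zero>\<^bsub>A\<^esub>}"
    using base_vecs[of l] by (intro countable_finite) (auto simp: finsupp_def)
qed simp

lemma M_agree:
  assumes "agree D T T'" "(\<lambda>d. (d 0, d 1)) ` {d. v d \<noteq> \<zero>\<^bsub>A\<^esub>} \<subseteq> D"
  shows "v \<in> M T \<longleftrightarrow> v \<in> M T'"
proof -
  have "edge T (d 0) (d 1) = edge T' (d 0) (d 1)" if "v d \<noteq> \<zero>\<^bsub>A\<^esub>" for d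
  proof -
    have "(d 0, d 1) \<in> D" using assms(2) that by blast
    then show ?thesis using assms(1) by (auto simp: agree_def)
  qed
  then show ?thesis
    by (auto intro: gmod_cong simp: label_def split: if_splits)
qed

lemma decode_agree:
  assumes "agree D T T'" "depends k \<subseteq> D" shows "decode T k = decode T' k"
proof -
  have "base l \<in> M T \<longleftrightarrow> base l \<in> M T'" if "l \<in> Field \<kappa>" "(jump ^^ n) l = k" for l n
  proof (rule M_agree[OF assms(1)])
    have "(\<lambda>d. (d 0, d 1)) ` {d. base l d \<noteq> \<zero>\<^bsub>A\<^esub>} \<subseteq> depends k"
      unfolding depends_def using that by blast
    then show "(\<lambda>d. (d 0, d 1)) ` {d. base l d \<noteq> \<zero>\<^bsub>A\<^esub>} \<subseteq> D" using assms(2) by blast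
  qed
  then have "(\<exists>n. \<exists>k'\<in>Field \<kappa> - {l \<in> Field \<kappa>. base l \<in> M T}. (jump ^^ n) k' = k) \<longleftrightarrow>
    (\<exists>n. \<exists>k'\<in>Field \<kappa> - {l \<in> Field \<kappa>. base l \<in> M T'}. (jump ^^ n) k' = k)" by blast
  then show ?thesis by (simp add: decode_def)
qed

text \<open>The inverse \<open>encode T'\<close> involves all values of \<open>decode T'\<close>,
  yet agreement of the two decodings at the single point \<open>encode T v\<close> settles its value
  at \<open>v\<close>.\<close>

lemma encode_agree:
  assumes "agree D T T'" "v \<in> M T" "v \<in> M T'" "depends (encode T v) \<subseteq> D"
  shows "encode T' v = encode T v"
proof -
  have "decode T' (encode T v) = v" using decode_agree[OF assms(1,4)] assms(2) by simp
  then show ?thesis using encode_decode[of "encode T v" T'] assms(2) by simp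
qed

lemma structure_of_continuous:
  "continuous_map (graph_space \<kappa>) (module_space \<kappa> R) structure_of"
proof (rule continuous_map_if_countably_determined[OF \<kappa>])
  show "structure_of T \<in> module_models \<kappa> R" for T by (rule structure_of_models)
  fix T :: "(unit, unit, 'k) struct" and i xs
  assume i: "i \<in> symbols (module_lang R)" and xs: "xs \<in> tuples \<kappa> (graph_arity (module_lang R) i)"
  show "\<exists>D. D \<subseteq> Field \<kappa> \<times> Field \<kappa> \<and> countable D \<and> (\<forall>T'\<in>graph_models \<kappa>. agree D T T' \<longrightarrow>
    code \<kappa> (module_lang R) (structure_of T') i xs = code \<kappa> (module_lang R) (structure_of T) i xs)"
  proof -
    obtain f where f: "i = Inr f" "f \<in> fun_syms (module_lang R)"
      using i by (auto simp: symbols_def module_lang_def)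
    define as where "as = butlast xs"
    have as: "as \<in> tuples \<kappa> (fun_arity (module_lang R) f)"
      using xs f(1) by (auto simp: as_def tuples_def graph_arity_def dest: in_set_butlastD)
    \<comment> \<open>Besides the arguments, the value itself is included, as
      \<open>encode_agree\<close> needs the decodings to agree there.\<close>
    define D where "D = (\<Union>k\<in>insert (fun_interp (structure_of T) f as) (set as). depends k)"
    have "fun_interp (structure_of T') f as = fun_interp (structure_of T) f as" if agr: "agree D T T'" for T'
    proof (cases f)
      case Plus
      then obtain k l where kl: "k \<in> Field \<kappa>" "l \<in> Field \<kappa>" "as = [k, l]"
        using as by (auto simp: module_lang_def tuples_2)
      have "decode T k = decode T' k" "decode T l = decode T' l"
        by (rule decode_agree[OF agr]; use kl in \<open>auto simp: D_def\<close>)+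
      moreover have "vadd (decode T k) (decode T l) \<in> M T" "vadd (decode T' k) (decode T' l) \<in> M T'"
        using kl by (auto intro: gmod_add)
      ultimately show ?thesis using Plus kl
        by (simp, intro encode_agree[OF agr]) (auto simp: D_def)
    next
      case (Scalar r)
      then obtain k where k: "k \<in> Field \<kappa>" "as = [k]" "r \<in> carrier R"
        using as f(2) by (auto simp: module_lang_def tuples_1)
      have "decode T k = decode T' k"
        by (rule decode_agree[OF agr]) (use k in \<open>auto simp: D_def\<close>)
      moreover have "vsmult r (decode T k) \<in> M T" "vsmult r (decode T' k) \<in> M T'"
        using k by (auto intro: gmod_smult)
      ultimately show ?thesis using Scalar k
        by (simp, intro encode_agree[OF agr]) (auto simp: D_def)
    qed
    then have "\<forall>T'\<in>graph_models \<kappa>. agree D T T' \<longrightarrow>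
      code \<kappa> (module_lang R) (structure_of T') i xs = code \<kappa> (module_lang R) (structure_of T) i xs"
      using i xs f(1) by (simp add: code_def as_def)
    moreover have "D \<subseteq> Field \<kappa> \<times> Field \<kappa>" using depends_subset by (auto simp: D_def)
    moreover have "countable D" unfolding D_def by (intro countable_UN countable_depends countable_finite) simp
    ultimately show ?thesis by blast
  qed
qed

lemma borel_reduction_structure_of:
  "borel_reduction \<kappa> (graph_space \<kappa>) (embeddable \<kappa> graph_lang)
     (module_space \<kappa> R) (embeddable \<kappa> (module_lang R)) structure_of"
  unfolding borel_reduction_def kappa_borel_map_def
proof (intro conjI allI impI ballI)
  show "structure_of \<in> topspace (graph_space \<kappa>) \<rightarrow> topspace (module_space \<kappa> R)"
    using structure_of_models by (simp add: topspace_module_space[OF \<kappa>(2)])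
  show "{T \<in> topspace (graph_space \<kappa>). structure_of T \<in> U} \<in> kappa_borel \<kappa> (graph_space \<kappa>)"
    if "openin (module_space \<kappa> R) U" for U
    by (rule kappa_borel.intros(1)[OF openin_continuous_map_preimage[OF structure_of_continuous that]])
  fix T V assume "T \<in> topspace (graph_space \<kappa>)" "V \<in> topspace (graph_space \<kappa>)"
  then have "T \<in> graph_models \<kappa>" "V \<in> graph_models \<kappa>" by (simp_all add: topspace_graph_space[OF \<kappa>(2)])
  then show "embeddable \<kappa> graph_lang T V
    \<longleftrightarrow> embeddable \<kappa> (module_lang R) (structure_of T) (structure_of V)"
    using graph_embedding_imp_module_embedding module_embedding_imp_graph_embedding by blast
qed

end

section \<open>The reduction\<close>

text \<open>If \<open>s\<close> kills \<open>r\<close>, then multiplication by \<open>r\<close> is well defined on \<open>R/sR\<close>, and composing it with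
  the projection of the completion gives a homomorphism to \<open>R\<close> that maps the unit to \<open>r\<close>.\<close>

lemma torsion_free_if_cotorsion_free:
  fixes R :: "('a, 'b) ring_scheme" (structure)
  assumes "cring R" and S: "S \<subseteq> carrier R" and cf: "S_cotorsion_free R S (self_module R)"
    and s: "s \<in> S" and r: "r \<in> carrier R" "s \<otimes> r = \<zero>"
  shows "r = \<zero>"
proof -
  interpret cring R by fact
  let ?M = "self_module R"
  let ?C = "S_completion R S ?M"
  have M [simp]: "carrier ?M = carrier R" "add ?M = add R" "zero ?M = zero R" "smult ?M = monoid.mult R"
    by (simp_all add: self_module_def)
  have sR: "s \<in> carrier R" using S s by blast
  have mult: "multiple ?M t = (\<lambda>x. t \<otimes> x) ` carrier R" for t by (simp add: multiple_def)
  have coset: "multiple ?M t +>\<^bsub>?M\<^esub> m = (\<lambda>x. t \<otimes> x \<oplus> m) ` carrier R" for t m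
    by (auto simp: a_r_coset_def r_coset_def mult)
  have sum: "X <+>\<^bsub>?M\<^esub> Y = {x \<oplus> y | x y. x \<in> X \<and> y \<in> Y}" for X Y
    by (auto simp: set_add_def set_mult_def)
  have ann: "r \<otimes> (s \<otimes> x) = \<zero>" if "x \<in> carrier R" for x
    using that r sR by (metis m_assoc m_comm l_null)
  have const: "r \<otimes> m = r \<otimes> m'" if X: "X \<in> a_rcosets\<^bsub>?M\<^esub> (multiple ?M s)" and m: "m \<in> X" "m' \<in> X" for X m m'
  proof -
    obtain a where a: "a \<in> carrier R" "X = (\<lambda>x. s \<otimes> x \<oplus> a) ` carrier R"
      using X coset by (auto simp: A_RCOSETS_def' simp del: M(2-))
    have "r \<otimes> y = r \<otimes> a" if y: "y \<in> X" for y
    proof -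
      obtain x where x: "x \<in> carrier R" "y = s \<otimes> x \<oplus> a" using y a(2) by blast
      then show ?thesis using ann[OF x(1)] r sR a(1) by (simp add: r_distr)
    qed
    then show ?thesis using m by simp
  qed
  have xs: "x s \<in> a_rcosets\<^bsub>?M\<^esub> (multiple ?M s)" if "x \<in> carrier ?C" for x
    using that s by (auto simp: S_completion_def)
  have xs_ne: "\<exists>m. m \<in> x s" and xs_sub: "x s \<subseteq> carrier R" if x: "x \<in> carrier ?C" for x
  proof -
    obtain a where a: "a \<in> carrier R" "x s = (\<lambda>x. s \<otimes> x \<oplus> a) ` carrier R"
      using xs[OF x] coset by (auto simp: A_RCOSETS_def' simp del: M(2-))
    show "\<exists>m. m \<in> x s" "x s \<subseteq> carrier R" using a sR by auto
  qed
  define h where "h = (\<lambda>x :: 'a \<Rightarrow> 'a set. r \<otimes> (SOME m. m \<in> x s))"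
  have h: "h x = r \<otimes> m" if "x \<in> carrier ?C" "m \<in> x s" for x m
    unfolding h_def using const[OF xs[OF that(1)]] that(2) someI[of "\<lambda>m. m \<in> x s" m] by blast
  have "h \<in> module_hom R ?C ?M"
    unfolding module_hom_def
  proof (intro CollectI conjI ballI)
    show "h \<in> carrier ?C \<rightarrow> carrier ?M"
    proof
      fix x assume x: "x \<in> carrier ?C"
      then obtain m where "m \<in> x s" using xs_ne by blast
      then show "h x \<in> carrier ?M" using h[OF x] xs_sub[OF x] r by auto
    qed
  next
    fix x y assume x: "x \<in> carrier ?C" and y: "y \<in> carrier ?C"
    have eq: "(x \<oplus>\<^bsub>?C\<^esub> y) s = {a \<oplus> b | a b. a \<in> x s \<and> b \<in> y s}"
      using s by (simp add: S_completion_def sum)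
    obtain a b where ab: "a \<in> x s" "b \<in> y s" using xs_ne x y by metis
    then have "\<exists>m. m \<in> (x \<oplus>\<^bsub>?C\<^esub> y) s" unfolding eq by blast
    \<comment> \<open>Splitting the chosen representative of the sum into representatives of the
      summands gives the value of \<open>h\<close> there without first checking that the sum lies in
      the completion.\<close>
    from someI_ex[OF this] obtain a' b' where ab': "a' \<in> x s" "b' \<in> y s"
      "(SOME m. m \<in> (x \<oplus>\<^bsub>?C\<^esub> y) s) = a' \<oplus> b'" unfolding eq by blast
    have "h (x \<oplus>\<^bsub>?C\<^esub> y) = r \<otimes> (a' \<oplus> b')" by (simp only: h_def ab'(3))
    also have "\<dots> = r \<otimes> a' \<oplus> r \<otimes> b'" using ab'(1,2) xs_sub x y r by (intro r_distr) auto
    finally show "h (x \<oplus>\<^bsub>?C\<^esub> y) = h x \<oplus>\<^bsub>?M\<^esub> h y" using h x y ab' by simp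
  next
    fix k x assume k: "k \<in> carrier R" and x: "x \<in> carrier ?C"
    have eq: "(k \<odot>\<^bsub>?C\<^esub> x) s = {k \<otimes> a \<oplus> s \<otimes> b | a b. a \<in> x s \<and> b \<in> carrier R}"
      using s by (auto simp: S_completion_def sum mult)
    obtain a where a: "a \<in> x s" using xs_ne x by blast
    then have "\<exists>m. m \<in> (k \<odot>\<^bsub>?C\<^esub> x) s" unfolding eq by blast
    from someI_ex[OF this] obtain a' b' where ab': "a' \<in> x s" "b' \<in> carrier R"
      "(SOME m. m \<in> (k \<odot>\<^bsub>?C\<^esub> x) s) = k \<otimes> a' \<oplus> s \<otimes> b'" unfolding eq by blast
    have a'R: "a' \<in> carrier R" using ab'(1) xs_sub x by blast
    have "h (k \<odot>\<^bsub>?C\<^esub> x) = r \<otimes> (k \<otimes> a' \<oplus> s \<otimes> b')" by (simp only: h_def ab'(3))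
    also have "\<dots> = k \<otimes> (r \<otimes> a')" using ann[OF ab'(2)] a'R ab'(2) k r sR by (simp add: r_distr m_lcomm)
    finally show "h (k \<odot>\<^bsub>?C\<^esub> x) = k \<odot>\<^bsub>?M\<^esub> h x" using h x ab'(1) by simp
  qed
  moreover define u where "u = (\<lambda>t\<in>S. multiple ?M t +>\<^bsub>?M\<^esub> \<one>)"
  have "u \<in> carrier ?C"
  proof -
    have "u t <+>\<^bsub>?M\<^esub> multiple ?M q = u q" if "q \<in> S" "t \<in> S" "w \<in> S" "t = q \<otimes> w" for q t w
    proof -
      have c: "q \<in> carrier R" "w \<in> carrier R" using that S by auto
      have "{t \<otimes> x \<oplus> \<one> \<oplus> q \<otimes> y | x y. x \<in> carrier R \<and> y \<in> carrier R} = (\<lambda>x. q \<otimes> x \<oplus> \<one>) ` carrier R"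
      proof (intro equalityI subsetI)
        fix z assume "z \<in> {t \<otimes> x \<oplus> \<one> \<oplus> q \<otimes> y | x y. x \<in> carrier R \<and> y \<in> carrier R}"
        then obtain x y where xy: "x \<in> carrier R" "y \<in> carrier R" "z = t \<otimes> x \<oplus> \<one> \<oplus> q \<otimes> y" by blast
        have "z = q \<otimes> (w \<otimes> x \<oplus> y) \<oplus> \<one>" unfolding xy(3) that(4) using c xy(1,2) by algebra
        then show "z \<in> (\<lambda>x. q \<otimes> x \<oplus> \<one>) ` carrier R" using c xy by blast
      next
        fix z assume "z \<in> (\<lambda>x. q \<otimes> x \<oplus> \<one>) ` carrier R"
        then obtain y where y: "y \<in> carrier R" "z = q \<otimes> y \<oplus> \<one>" by blast
        have "z = t \<otimes> \<zero> \<oplus> \<one> \<oplus> q \<otimes> y" using that(2) S y c a_comm by (auto simp: y(2))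
        then show "z \<in> {t \<otimes> x \<oplus> \<one> \<oplus> q \<otimes> y | x y. x \<in> carrier R \<and> y \<in> carrier R}" using y by blast
      qed
      moreover have "u t <+>\<^bsub>?M\<^esub> multiple ?M q = {t \<otimes> x \<oplus> \<one> \<oplus> q \<otimes> y | x y. x \<in> carrier R \<and> y \<in> carrier R}"
      proof -
        have "u t = (\<lambda>x. t \<otimes> x \<oplus> \<one>) ` carrier R" using that(2) by (simp add: u_def coset)
        then show ?thesis unfolding sum mult by auto
      qed
      ultimately show ?thesis using that(1) by (simp add: u_def coset)
    qed
    moreover have "u \<in> (\<Pi>\<^sub>E t\<in>S. a_rcosets\<^bsub>?M\<^esub> (multiple ?M t))"
      by (auto simp: u_def A_RCOSETS_def' simp del: M(2-))
    ultimately show ?thesis by (auto simp: S_completion_def)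
  qed
  ultimately have "h u = \<zero>" using cf unfolding S_cotorsion_free_def by simp
  moreover have "\<one> \<in> u s" using s sR by (auto simp: u_def coset intro!: image_eqI[of _ _ \<zero>])
  ultimately show ?thesis using h[OF \<open>u \<in> carrier ?C\<close>, of \<one>] r by simp
qed

theorem theorem1p3:
  fixes R :: "('a, 'b) ring_scheme" (structure)
    and S :: "'a set"
    and \<kappa> :: "'k rel"
  assumes "cring R"
    and "countable S" and "S \<subseteq> carrier R - {\<zero>}" and "\<one> \<in> S"
    and "\<And>s t. s \<in> S \<Longrightarrow> t \<in> S \<Longrightarrow> s \<otimes> t \<in> S"
    and "S_cotorsion_free R S (self_module R)"
    and "|carrier R| <o |Pow (UNIV :: nat set)|"
    and "Card_order \<kappa>" and "natLeq <o \<kappa>"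
    and "|sequences_below \<kappa>| =o \<kappa>"
  shows "\<exists>f. borel_reduction \<kappa>
           (graph_space \<kappa>) (embeddable \<kappa> graph_lang)
           (module_space \<kappa> R) (embeddable \<kappa> (module_lang R)) f"
proof -
  interpret cring R by fact
  have seq: "|sequences_below \<kappa>| \<le>o \<kappa>" using assms(10) ordIso_iff_ordLeq by blast
  have red: "r = \<zero>" if "r \<in> carrier R" "\<And>s. s \<in> S \<Longrightarrow> s divides r" for r
  proof -
    have "r \<in> multiple (self_module R) s" if "s \<in> S" for s
      using \<open>\<And>s. s \<in> S \<Longrightarrow> s divides r\<close>[OF that] by (auto simp: multiple_def self_module_def factor_def)
    then have "r \<in> (\<Inter>s\<in>S. multiple (self_module R) s)" by blast
    also have "\<dots> = {\<zero>\<^bsub>self_module R\<^esub>}" using assms(6) by (simp only: S_cotorsion_free_def S_reduced_def)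
    finally show ?thesis by (simp add: self_module_def)
  qed
  interpret S_ring R S
  proof unfold_locales
    show "r = \<zero>" if "s \<in> S" "r \<in> carrier R" "s \<otimes> r = \<zero>" for s r
      using torsion_free_if_cotorsion_free[OF assms(1) _ assms(6) that] assms(3) by blast
  qed (fact assms(2-5) red)+
  obtain \<eta> where \<eta>: "\<And>cs. set cs \<subseteq> carrier R \<Longrightarrow> cs \<noteq> [] \<Longrightarrow> last cs \<noteq> \<zero> \<Longrightarrow> \<exists>n. \<not> q n divides horner cs (branch \<eta> n)"
    using exists_transcendental[OF assms(7)] by auto
  interpret transcendental_branch R S \<eta> by unfold_locales (rule \<eta>)
  interpret graph_coding R S \<eta> \<kappa>
  proof unfold_locales
    show "Card_order \<kappa>" "natLeq <o \<kappa>" by fact+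
    show "|{c :: nat \<Rightarrow> 'k. range c \<subseteq> Field \<kappa>}| \<le>o \<kappa>" by (rule card_of_sequences_ordLeq[OF assms(9) seq])
    show "|carrier completion| \<le>o \<kappa>"
      using card_of_completion[OF assms(7)] Pow_nat_ordLeq[OF assms(9) seq] ordLeq_transitive by blast
  qed
  show ?thesis using borel_reduction_structure_of by blast
qed

end
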